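(* Let $l\ge 1$ and let $n_1,\dots,n_l\ge 0$ be integers. Then there exist an integer $N\geq 1$ and an $N$-dimensional rep-tile that is homotopy equivalent to the wedge of spheres $S^{n_1}\vee S^{n_2}\vee\dots\vee S^{n_l}$.
   Context: A rep-tile in $\mathbb{R}^N$ is a subset $X\subset\mathbb{R}^N$ with non-empty interior which can be written as a finite union $X=\bigcup_{i=1}^{k}X_i$ with $k\ge 2$, where the sets $X_i$ are pairwise isometric, each $X_i$ is similar to $X$ (i.e. is the image of $X$ under a similarity of $\mathbb{R}^N$), and $X_i$, $X_j$ have disjoint interiors whenever $i\ne j$. (Connectedness is not required.) An $N$-dimensional rep-tile is a rep-tile in $\mathbb{R}^N$ that is homeomorphic to a compact smooth $N$-manifold (with boundary). *)

theory Defs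
  imports "HOL-Analysis.Analysis"
begin

text \<open>
  Since the dimension is existentially quantified in the main statement, $N$-space is the library's
  \<^const>\<open>Euclidean_space\<close>: sequences of reals vanishing at all indices \<open>i \<ge> N\<close>.
\<close>

subsection \<open>Rep-tiles\<close>

definition euclid_dist :: "nat \<Rightarrow> (nat \<Rightarrow> real) \<Rightarrow> (nat \<Rightarrow> real) \<Rightarrow> real" where
  "euclid_dist N x y = L2_set (\<lambda>i. x i - y i) {..<N}"

definition similarity :: "nat \<Rightarrow> real \<Rightarrow> ((nat \<Rightarrow> real) \<Rightarrow> (nat \<Rightarrow> real)) \<Rightarrow> bool" where
  "similarity N r f \<longleftrightarrow> r > 0 \<and>
     bij_betw f (topspace (Euclidean_space N)) (topspace (Euclidean_space N)) \<and>
     (\<forall>x\<in>topspace (Euclidean_space N). \<forall>y\<in>topspace (Euclidean_space N).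
        euclid_dist N (f x) (f y) = r * euclid_dist N x y)"

definition similar :: "nat \<Rightarrow> (nat \<Rightarrow> real) set \<Rightarrow> (nat \<Rightarrow> real) set \<Rightarrow> bool" where
  "similar N A B \<longleftrightarrow> (\<exists>r f. similarity N r f \<and> f ` A = B)"

definition isometric :: "nat \<Rightarrow> (nat \<Rightarrow> real) set \<Rightarrow> (nat \<Rightarrow> real) set \<Rightarrow> bool" where
  "isometric N A B \<longleftrightarrow> (\<exists>f. similarity N 1 f \<and> f ` A = B)"

definition rep_tile :: "nat \<Rightarrow> (nat \<Rightarrow> real) set \<Rightarrow> bool" where
  "rep_tile N X \<longleftrightarrow>
     X \<subseteq> topspace (Euclidean_space N) \<and>
     Euclidean_space N interior_of X \<noteq> {} \<and>
     (\<exists>(k::nat) Y. k \<ge> 2 \<and> X = (\<Union>i\<in>{1..k}. Y i) \<and>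
        (\<forall>i\<in>{1..k}. \<forall>j\<in>{1..k}. isometric N (Y i) (Y j)) \<and>
        (\<forall>i\<in>{1..k}. similar N X (Y i)) \<and>
        (\<forall>i\<in>{1..k}. \<forall>j\<in>{1..k}. i \<noteq> j \<longrightarrow>
           Euclidean_space N interior_of (Y i) \<inter> Euclidean_space N interior_of (Y j) = {}))"


subsection \<open>Smooth manifolds with boundary\<close>

definition partial_deriv :: "nat \<Rightarrow> ((nat \<Rightarrow> real) \<Rightarrow> real) \<Rightarrow> (nat \<Rightarrow> real) \<Rightarrow> real" where
  "partial_deriv i f x = deriv (\<lambda>t. f (x(i := t))) (x i)"

text \<open>Continuous differentiability of order \<open>k\<close>; meaningful for \<open>U\<close> open in \<open>Euclidean_space N\<close>.\<close>

primrec Ck_on :: "nat \<Rightarrow> nat \<Rightarrow> (nat \<Rightarrow> real) set \<Rightarrow> ((nat \<Rightarrow> real) \<Rightarrow> real) \<Rightarrow> bool" where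
  "Ck_on N 0 U f \<longleftrightarrow> continuous_map (subtopology (Euclidean_space N) U) euclideanreal f"
| "Ck_on N (Suc k) U f \<longleftrightarrow>
     continuous_map (subtopology (Euclidean_space N) U) euclideanreal f \<and>
     (\<forall>i<N. (\<forall>x\<in>U. (\<lambda>t. f (x(i := t))) field_differentiable at (x i)) \<and>
            Ck_on N k U (partial_deriv i f))"

text \<open>
  On an arbitrary subset \<open>S\<close> (here: relatively open subsets of the half-space), smooth means locally
  extendable to a smooth function on an open subset of $N$-space.
\<close>

definition smooth_real_on :: "nat \<Rightarrow> (nat \<Rightarrow> real) set \<Rightarrow> ((nat \<Rightarrow> real) \<Rightarrow> real) \<Rightarrow> bool" where
  "smooth_real_on N S f \<longleftrightarrow>
     (\<forall>p\<in>S. \<exists>W g. openin (Euclidean_space N) W \<and> p \<in> W \<and> (\<forall>k. Ck_on N k W g) \<and>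
                  (\<forall>x\<in>W \<inter> S. g x = f x))"

definition smooth_map_on ::
    "nat \<Rightarrow> (nat \<Rightarrow> real) set \<Rightarrow> ((nat \<Rightarrow> real) \<Rightarrow> (nat \<Rightarrow> real)) \<Rightarrow> bool" where
  "smooth_map_on N S f \<longleftrightarrow> (\<forall>i<N. smooth_real_on N S (\<lambda>x. f x i))"

definition half_space :: "nat \<Rightarrow> (nat \<Rightarrow> real) topology" where
  "half_space N = subtopology (Euclidean_space N) {x. x 0 \<ge> 0}"

definition half_space_chart :: "nat \<Rightarrow> 'a topology \<Rightarrow> 'a set \<Rightarrow> ('a \<Rightarrow> nat \<Rightarrow> real) \<Rightarrow> bool" where
  "half_space_chart N M U \<phi> \<longleftrightarrow>
     openin M U \<and> openin (half_space N) (\<phi> ` U) \<and>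
     homeomorphic_map (subtopology M U) (subtopology (half_space N) (\<phi> ` U)) \<phi>"

definition smooth_atlas :: "nat \<Rightarrow> 'a topology \<Rightarrow> ('a set \<times> ('a \<Rightarrow> nat \<Rightarrow> real)) set \<Rightarrow> bool" where
  "smooth_atlas N M A \<longleftrightarrow>
     (\<forall>(U, \<phi>)\<in>A. half_space_chart N M U \<phi>) \<and>
     (\<Union>(U, \<phi>)\<in>A. U) = topspace M \<and>
     (\<forall>(U, \<phi>)\<in>A. \<forall>(V, \<psi>)\<in>A. smooth_map_on N (\<phi> ` (U \<inter> V)) (\<psi> \<circ> inv_into U \<phi>))"

definition smooth_manifold_with_boundary ::
    "nat \<Rightarrow> 'a topology \<Rightarrow> ('a set \<times> ('a \<Rightarrow> nat \<Rightarrow> real)) set \<Rightarrow> bool" where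
  "smooth_manifold_with_boundary N M A \<longleftrightarrow>
     Hausdorff_space M \<and> second_countable M \<and> smooth_atlas N M A"

text \<open>
  The carrier type of \<open>M\<close> is no restriction: a smooth structure can be transported along the
  homeomorphism to \<open>X\<close> itself.
\<close>

definition dim_rep_tile :: "nat \<Rightarrow> (nat \<Rightarrow> real) set \<Rightarrow> bool" where
  "dim_rep_tile N X \<longleftrightarrow> rep_tile N X \<and>
     (\<exists>(M :: (nat \<Rightarrow> real) topology) A.
        smooth_manifold_with_boundary N M A \<and> compact_space M \<and>
        subtopology (Euclidean_space N) X homeomorphic_space M)"


subsection \<open>Wedges of spheres\<close>

definition quotient_topology :: "'a topology \<Rightarrow> ('a \<times> 'a) set \<Rightarrow> 'a set topology" where
  "quotient_topology X R = topology (\<lambda>\<U>. \<U> \<subseteq> topspace X // R \<and> openin X (\<Union>\<U>))"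

lemma openin_quotient_topology:
  assumes "equiv (topspace X) R"
  shows "openin (quotient_topology X R) \<U> \<longleftrightarrow> \<U> \<subseteq> topspace X // R \<and> openin X (\<Union>\<U>)"
proof -
  have "\<Union>(\<U> \<inter> \<V>) = \<Union>\<U> \<inter> \<Union>\<V>" if "\<U> \<subseteq> topspace X // R" "\<V> \<subseteq> topspace X // R" for \<U> \<V>
    using that quotient_disj[OF assms] by blast
  moreover have "openin X (\<Union>(\<Union>\<K>))" if "\<forall>\<U>\<in>\<K>. openin X (\<Union>\<U>)" for \<K>
  proof -
    have "\<Union>(\<Union>\<K>) = \<Union>(Union ` \<K>)" by blast
    then show ?thesis using that by auto
  qed
  ultimately have "istopology (\<lambda>\<U>. \<U> \<subseteq> topspace X // R \<and> openin X (\<Union>\<U>))"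
    unfolding istopology_def by (auto simp: openin_Int)
  then show ?thesis
    by (simp add: quotient_topology_def)
qed

lemma quotient_map_quotient_topology:
  assumes "equiv (topspace X) R"
  shows "quotient_map X (quotient_topology X R) (\<lambda>x. R `` {x})"
proof -
  have top: "topspace (quotient_topology X R) = topspace X // R"
  proof
    show "topspace (quotient_topology X R) \<subseteq> topspace X // R"
      using openin_quotient_topology[OF assms] by (metis openin_topspace)
    have "openin (quotient_topology X R) (topspace X // R)"
      by (simp add: openin_quotient_topology[OF assms] Union_quotient[OF assms])
    then show "topspace X // R \<subseteq> topspace (quotient_topology X R)"
      by (rule openin_subset)
  qed
  have "{x \<in> topspace X. R `` {x} \<in> \<U>} = \<Union>\<U>" if \<U>: "\<U> \<subseteq> topspace X // R" for \<U>
  proof -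
    have "x \<in> topspace X \<and> R `` {x} = C" if "C \<in> \<U>" "x \<in> C" for x C
    proof -
      have C: "C \<in> topspace X // R" using that \<U> by blast
      then have "x \<in> topspace X" using that Union_quotient[OF assms] by blast
      then have "R `` {x} \<in> topspace X // R" "x \<in> R `` {x}"
        by (rule quotientI, rule equiv_class_self[OF assms])
      with C that show ?thesis
        using quotient_disj[OF assms] \<open>x \<in> topspace X\<close> by blast
    qed
    moreover have "x \<in> R `` {x}" if "x \<in> topspace X" for x
      using assms that by (rule equiv_class_self)
    ultimately show ?thesis by blast
  qed
  then show ?thesis
    unfolding quotient_map_def top
    by (auto simp: openin_quotient_topology[OF assms] quotient_def)
qed

definition collapse_rel :: "'a topology \<Rightarrow> 'a set \<Rightarrow> ('a \<times> 'a) set" where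
  "collapse_rel X B = {(x, y). x \<in> topspace X \<and> y \<in> topspace X \<and> (x = y \<or> x \<in> B \<and> y \<in> B)}"

lemma equiv_collapse_rel: "equiv (topspace X) (collapse_rel X B)"
  by (auto simp: collapse_rel_def intro!: equivI refl_onI symI transI)

definition wedge :: "'i set \<Rightarrow> ('i \<Rightarrow> 'a topology) \<Rightarrow> ('i \<Rightarrow> 'a) \<Rightarrow> ('i \<times> 'a) set topology" where
  "wedge I X p = quotient_topology (sum_topology X I)
     (collapse_rel (sum_topology X I) ((\<lambda>i. (i, p i)) ` I))"

definition sphere_basepoint :: "nat \<Rightarrow> real" where
  "sphere_basepoint = (\<lambda>i. if i = 0 then 1 else 0)"

lemma sphere_basepoint_in_nsphere: "sphere_basepoint \<in> topspace (nsphere n)"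
proof -
  have "(\<Sum>i\<le>n. (sphere_basepoint i)\<^sup>2) = (\<Sum>i\<le>n. if i = 0 then 1 else 0)"
    by (rule sum.cong) (auto simp: sphere_basepoint_def)
  also have "\<dots> = 1"
    by simp
  finally show ?thesis
    by (simp add: nsphere sphere_basepoint_def)
qed

definition wedge_of_spheres :: "nat \<Rightarrow> (nat \<Rightarrow> nat) \<Rightarrow> (nat \<times> (nat \<Rightarrow> real)) set topology" where
  "wedge_of_spheres l n = wedge {1..l} (\<lambda>i. nsphere (n i)) (\<lambda>i. sphere_basepoint)"

end

theory Submission
  imports Defs
begin

text \<open>
  Embed the wedge as the union of the boundaries of the cubes \<open>[0,2]\<close> to the power \<open>n\<^sub>i + 1\<close>, which lie in
  mutually orthogonal coordinate subspaces and meet in the vertex \<open>0\<close>, and thicken it to a union of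
  unit cubes with centers in \<open>{0,1,2,3}\<close> to some power. Joining it by a stalk to a solid box gives a
  plate of the same homotopy type. Putting on top of the solid part plugs in the shape of the
  point-reflected holes of the plate does not change the homotopy type either, and two congruent copies of the
  result fill a box, since the plugs of each copy fill the holes of the other. Hence finitely many
  copies tile a cube, and replacing every unit cube of the tile by such a tiled cube exhibits the tile as a
  rep-tile.

  The tile is a smooth manifold because it is a neighbourhood of a cubical complex: its set of cubes
  is closed downwards in a product of zigzags \<open>0 < 1 > 2 < 3\<close>, so that a flow acting on each
  coordinate separately leaves it transversally through its whole boundary. Pushing the interior of the
  tile along the flow to the open set swept out by the flow, the boundary becomes the space of orbits
  that escape; the flow being linear in suitable coordinates, smooth charts result from
  normalising homogeneous coordinates, as for projective space.
\<close>

text \<open>Cubes may touch in a corner only, so an arbitrary polycube need not be a manifold. The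
  zigzag order prevents this: across every wall one side precedes the other, so the cubes around a
  vertex form a down-set of a Boolean lattice and look like a staircase. Reflected holes must
  respect the same order, so the reflection has to reverse it; \<open>k\<close> to
  \<open>3 - k\<close> does so on four cells, whereas \<open>k\<close> to \<open>2 - k\<close>
  preserves the order on three. This is why cell 3 is there, although cubes of side 2 need only
  cells 0, 1, 2.

  The gauge that cuts out the tile is a minimum of maxima, hence merely continuous. It enters the
  charts but drops out of all changes of charts, so that smoothness concerns rational functions
  only.

  The dimension is \<open>D + 2\<close>, where \<open>D\<close> is the sum of the
  \<open>n i + 1\<close>. One extra coordinate separates wedge, stalk and box; the other separates
  plate and plugs. The box occupies half of the plate's height, so that reflected holes fall into
  the box and every plug stands on solid ground.\<close>

abbreviation real_seq :: "nat \<Rightarrow> (nat \<Rightarrow> real) set" where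
  "real_seq N \<equiv> {x. \<forall>i\<ge>N. x i = 0}"

lemma Euclidean_space_top_of_set: "Euclidean_space N = top_of_set (real_seq N)"
  by (simp add: Euclidean_space_def euclidean_product_topology)

lemma continuous_map_Euclidean_space_subtopology:
  "continuous_map (subtopology (Euclidean_space N) U) euclideanreal f \<longleftrightarrow> continuous_on (real_seq N \<inter> U) f"
  by (simp add: Euclidean_space_top_of_set subtopology_subtopology)

lemma open_coordinate_line:
  assumes U: "openin (Euclidean_space N) U" and i: "i < N" and x: "x \<in> U"
  shows "open {t. x(i := t) \<in> U}"
proof -
  obtain W where W: "open W" "U = real_seq N \<inter> W"
    using U unfolding Euclidean_space_top_of_set by (auto simp: openin_open)
  have "continuous_on UNIV (\<lambda>t. x(i := t))"
  proof (rule continuous_on_coordinatewise_then_product)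
    show "continuous_on UNIV (\<lambda>t. (x(i := t)) k)" for k
      by (cases "k = i") auto
  qed
  then have "open ((\<lambda>t. x(i := t)) -` W)"
    using W(1) open_vimage by blast
  moreover have "{t. x(i := t) \<in> U} = (\<lambda>t. x(i := t)) -` W"
    using W i x by auto
  ultimately show ?thesis by simp
qed

text \<open>A class of functions closed under partial derivatives by construction: this gives smoothness
  without any multivariate chain rule.\<close>

inductive rational_on :: "nat \<Rightarrow> (nat \<Rightarrow> real) set \<Rightarrow> ((nat \<Rightarrow> real) \<Rightarrow> real) \<Rightarrow> bool"
  for N U where
  const: "rational_on N U (\<lambda>x. c)"
| coord: "rational_on N U (\<lambda>x. x i)"
| add: "rational_on N U f \<Longrightarrow> rational_on N U g \<Longrightarrow> rational_on N U (\<lambda>x. f x + g x)"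
| mult: "rational_on N U f \<Longrightarrow> rational_on N U g \<Longrightarrow> rational_on N U (\<lambda>x. f x * g x)"
| inverse: "rational_on N U f \<Longrightarrow> (\<And>x. x \<in> U \<Longrightarrow> f x \<noteq> 0) \<Longrightarrow> rational_on N U (\<lambda>x. inverse (f x))"

lemma rational_on_uminus: "rational_on N U f \<Longrightarrow> rational_on N U (\<lambda>x. - f x)"
  using mult[OF const[of N U "-1"], of f] by simp

lemma rational_on_divide:
  "rational_on N U f \<Longrightarrow> rational_on N U g \<Longrightarrow> (\<And>x. x \<in> U \<Longrightarrow> g x \<noteq> 0) \<Longrightarrow>
    rational_on N U (\<lambda>x. f x / g x)"
  unfolding divide_inverse by (intro mult inverse)

lemma rational_on_diff: "rational_on N U f \<Longrightarrow> rational_on N U g \<Longrightarrow> rational_on N U (\<lambda>x. f x - g x)"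
  using add[OF _ rational_on_uminus, of N U f g] by simp

lemma continuous_on_rational:
  assumes "rational_on N U f" shows "continuous_on U f"
  using assms
  by induction (auto intro!: continuous_intros intro: continuous_on_subset[OF continuous_on_product_coordinates])

lemma rational_on_partial_deriv:
  assumes "rational_on N U f" "i < N"
  shows "\<exists>f'. rational_on N U f' \<and>
           (\<forall>x\<in>U. ((\<lambda>t. f (x(i := t))) has_field_derivative f' x) (at (x i)))"
  using assms(1)
proof induction
  case (const c)
  then show ?case by (intro exI[of _ "\<lambda>x. 0"]) (auto intro: rational_on.const)
next
  case (coord j)
  show ?case
    by (rule exI[of _ "\<lambda>x. if i = j then 1 else 0"])
      (use rational_on.const[of N U] in \<open>auto intro!: derivative_eq_intros\<close>)
next
  case (add f g)
  then obtain f' g' where "rational_on N U f'" "rational_on N U g'"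
    "\<forall>x\<in>U. ((\<lambda>t. f (x(i := t))) has_field_derivative f' x) (at (x i))"
    "\<forall>x\<in>U. ((\<lambda>t. g (x(i := t))) has_field_derivative g' x) (at (x i))" by blast
  then show ?case
    by (intro exI[of _ "\<lambda>x. f' x + g' x"]) (auto intro!: DERIV_add rational_on.add simp del: fun_upd_apply)
next
  case (mult f g)
  then obtain f' g' where *: "rational_on N U f'" "rational_on N U g'"
    "\<forall>x\<in>U. ((\<lambda>t. f (x(i := t))) has_field_derivative f' x) (at (x i))"
    "\<forall>x\<in>U. ((\<lambda>t. g (x(i := t))) has_field_derivative g' x) (at (x i))" by blast
  have "((\<lambda>t. f (x(i := t)) * g (x(i := t))) has_field_derivative f' x * g x + g' x * f x) (at (x i))"
    if "x \<in> U" for x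
    using DERIV_mult[OF *(3,4)[rule_format, OF that]] by simp
  then show ?case
    using * mult.hyps
    by (intro exI[of _ "\<lambda>x. f' x * g x + g' x * f x"]) (auto intro!: rational_on.add rational_on.mult simp del: fun_upd_apply)
next
  case (inverse f)
  then obtain f' where *: "rational_on N U f'"
    "\<forall>x\<in>U. ((\<lambda>t. f (x(i := t))) has_field_derivative f' x) (at (x i))" by blast
  have "((\<lambda>t. inverse (f (x(i := t)))) has_field_derivative - (inverse (f x) * f' x * inverse (f x))) (at (x i))"
    if "x \<in> U" for x
    using DERIV_inverse'[OF *(2)[rule_format, OF that]] inverse.hyps(2)[OF that] by simp
  then show ?case
    using * inverse.hyps
    by (intro exI[of _ "\<lambda>x. - (inverse (f x) * f' x * inverse (f x))"])
      (auto intro!: rational_on.mult rational_on.inverse rational_on_uminus simp del: fun_upd_apply)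
qed

text \<open>The function \<open>partial_deriv i h\<close> is known to agree with a rational function
  only on \<open>U\<close>, so the induction runs over all \<open>h\<close> that coincide on
  \<open>U\<close> with one. Openness of \<open>U\<close> makes the derivative depend on values in
  \<open>U\<close> alone.\<close>

lemma Ck_on_rational:
  assumes U: "openin (Euclidean_space N) U"
  shows "rational_on N U f \<Longrightarrow> (\<And>x. x \<in> U \<Longrightarrow> h x = f x) \<Longrightarrow> Ck_on N k U h"
proof (induction k arbitrary: f h)
  case 0
  then have "continuous_on (real_seq N \<inter> U) h"
    by (metis (no_types, lifting) continuous_on_cong continuous_on_rational continuous_on_subset inf_le2)
  then show ?case by (simp add: continuous_map_Euclidean_space_subtopology)
next
  case (Suc k)
  then have "continuous_on (real_seq N \<inter> U) h"
    by (metis (no_types, lifting) continuous_on_cong continuous_on_rational continuous_on_subset inf_le2)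
  moreover have "(\<forall>x\<in>U. (\<lambda>t. h (x(i := t))) field_differentiable at (x i)) \<and> Ck_on N k U (partial_deriv i h)"
    if i: "i < N" for i
  proof -
    obtain f' where f': "rational_on N U f'"
      "\<And>x. x \<in> U \<Longrightarrow> ((\<lambda>t. f (x(i := t))) has_field_derivative f' x) (at (x i))"
      using rational_on_partial_deriv[OF Suc.prems(1) i] by blast
    have D: "((\<lambda>t. h (x(i := t))) has_field_derivative f' x) (at (x i))" if x: "x \<in> U" for x
      using f'(2)[OF x] open_coordinate_line[OF U i x]
      by (rule has_field_derivative_transform_within_open) (use x Suc.prems(2) in \<open>simp_all del: fun_upd_apply\<close>)
    then have "partial_deriv i h x = f' x" if "x \<in> U" for x
      unfolding partial_deriv_def using that by (blast intro: DERIV_imp_deriv)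
    with Suc.IH[OF f'(1)] D show ?thesis
      unfolding field_differentiable_def by blast
  qed
  ultimately show ?case by (simp add: continuous_map_Euclidean_space_subtopology)
qed

lemma smooth_real_on_rational:
  assumes "openin (Euclidean_space N) U" "rational_on N U f" "S \<subseteq> U" "\<And>x. x \<in> S \<Longrightarrow> h x = f x"
  shows "smooth_real_on N S h"
  unfolding smooth_real_on_def
proof
  fix p assume "p \<in> S"
  then show "\<exists>W g. openin (Euclidean_space N) W \<and> p \<in> W \<and> (\<forall>k. Ck_on N k W g) \<and> (\<forall>x\<in>W \<inter> S. g x = h x)"
    using assms Ck_on_rational[OF assms(1,2)]
    by (intro exI[of _ U] exI[of _ f]) auto
qed

section \<open>Manifolds with boundary from homogeneous gauges\<close>

definition stretch :: "real \<Rightarrow> real" where "stretch t = t / (1 - \<bar>t\<bar>)"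
definition shrink :: "real \<Rightarrow> real" where "shrink w = w / (1 + \<bar>w\<bar>)"

lemma abs_shrink: "\<bar>shrink w\<bar> = \<bar>w\<bar> / (1 + \<bar>w\<bar>)"
  by (simp add: shrink_def abs_divide)

lemma abs_shrink_less: "\<bar>shrink w\<bar> < 1"
  by (simp add: abs_shrink)

lemma one_minus_abs_shrink: "1 - \<bar>shrink w\<bar> = 1 / (1 + \<bar>w\<bar>)"
proof -
  have "1 + \<bar>w\<bar> \<noteq> 0" by linarith
  then show ?thesis by (simp add: abs_shrink field_simps)
qed

lemma stretch_shrink [simp]: "stretch (shrink w) = w"
proof -
  have "1 + \<bar>w\<bar> \<noteq> 0" by linarith
  then show ?thesis by (simp add: stretch_def one_minus_abs_shrink) (simp add: shrink_def)
qed

lemma shrink_stretch: "\<bar>t\<bar> < 1 \<Longrightarrow> shrink (stretch t) = t"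
proof -
  assume t: "\<bar>t\<bar> < 1"
  have "\<bar>stretch t\<bar> = \<bar>t\<bar> / (1 - \<bar>t\<bar>)" using t by (simp add: stretch_def abs_divide)
  then have "1 + \<bar>stretch t\<bar> = 1 / (1 - \<bar>t\<bar>)" using t by (simp add: field_simps)
  then show ?thesis using t by (simp add: shrink_def) (simp add: stretch_def)
qed

lemma continuous_on_shrink [continuous_intros]: "continuous_on A f \<Longrightarrow> continuous_on A (\<lambda>x. shrink (f x))"
proof -
  assume "continuous_on A f"
  moreover have "1 + \<bar>f x\<bar> \<noteq> 0" for x by linarith
  ultimately show ?thesis unfolding shrink_def by (intro continuous_intros) auto
qed

text \<open>For \<open>e = 1\<close> the two values are \<open>t / (1 - t)\<close> and
  \<open>- (1 - t) / t\<close>; the other case is symmetric. This is the reason for choosing this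
  particular homeomorphism from the interval (-1,1) to the line: passing to a neighbouring center is
  rational.\<close>

lemma stretch_neighbour:
  assumes "\<bar>t\<bar> < 1" "\<bar>t - e\<bar> < 1" "e = 1 \<or> e = -1"
  shows "stretch t \<noteq> 0" "stretch (t - e) = - 1 / stretch t"
  using assms by (auto simp: stretch_def abs_if field_simps split: if_splits)

definition moebius :: "real \<Rightarrow> real \<Rightarrow> real" where "moebius lam t = lam * t / (1 - t + lam * t)"

definition weighted :: "(nat \<Rightarrow> real) \<Rightarrow> nat \<Rightarrow> real \<Rightarrow> real \<Rightarrow> real" where
  "weighted c i lam w = (if c i = 1 then w / lam else lam * w)"

definition point_at :: "nat \<Rightarrow> (nat \<Rightarrow> real) \<Rightarrow> (nat \<Rightarrow> real) \<Rightarrow> nat \<Rightarrow> real" where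
  "point_at N c W = (\<lambda>i. if i < N then c i + shrink (W i) else 0)"

lemma point_at_in_real_seq: "point_at N c W \<in> real_seq N"
  by (simp add: point_at_def)

lemma weighted_weighted: "lam \<noteq> 0 \<Longrightarrow> mu \<noteq> 0 \<Longrightarrow> weighted c i lam (weighted c i mu w) = weighted c i (lam * mu) w"
  by (simp add: weighted_def)

lemma weighted_1 [simp]: "weighted c i 1 w = w"
  by (simp add: weighted_def)

text \<open>On each coordinate line, the fixed points \<open>0\<close>, \<open>2\<close> repel and \<open>1\<close> attracts. In the coordinate
  \<open>stretch (x - c)\<close> around the fixed point \<open>c\<close> the flow is multiplication by \<open>lam\<close>, respectively
  \<open>1 / lam\<close>; adjacent coordinates \<open>w\<close>, \<open>w'\<close> satisfy \<open>w' = - 1 / w\<close>. The function \<open>\<Gamma>\<close> stands for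
  \<open>g / (1 + g)\<close>, where \<open>g\<close> is homogeneous of degree 1 with values in \<open>[0, \<infinity>]\<close>; this turns multiplication
  by \<open>lam\<close> into \<open>moebius lam\<close>.\<close>

locale gauge_domain =
  fixes N :: nat and \<Gamma> :: "(nat \<Rightarrow> real) \<Rightarrow> real"
  assumes N: "N \<ge> 1"
    and continuous: "continuous_on (real_seq N) \<Gamma>"
    and nonneg: "\<And>x. 0 \<le> \<Gamma> x"
    and le_1: "\<And>x. \<Gamma> x \<le> 1"
    and homogeneous: "\<And>c lam W. 0 < lam \<Longrightarrow> (\<forall>i<N. c i \<in> {0, 1, 2}) \<Longrightarrow>
       \<Gamma> (point_at N c (\<lambda>i. weighted c i lam (W i))) = moebius lam (\<Gamma> (point_at N c W))"
    and bounded: "\<And>x i. x \<in> real_seq N \<Longrightarrow> \<Gamma> x \<le> 1/2 \<Longrightarrow> i < N \<Longrightarrow> -1 < x i \<and> x i < 3"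
begin

definition g :: "(nat \<Rightarrow> real) \<Rightarrow> real" where "g x = \<Gamma> x / (1 - \<Gamma> x)"

definition K :: "(nat \<Rightarrow> real) set" where "K = {x \<in> real_seq N. \<Gamma> x \<le> 1/2}"

text \<open>Where \<open>\<Gamma> x = 1\<close> the gauge is meant to be infinite, but division by
  zero yields \<open>g x = 0\<close>; therefore \<open>\<Gamma> x < 1\<close> has to be carried
  along.\<close>

lemma K_iff: "x \<in> K \<longleftrightarrow> x \<in> real_seq N \<and> \<Gamma> x < 1 \<and> g x \<le> 1"
  unfolding K_def g_def by (auto simp: field_simps)

lemma g_homogeneous:
  assumes "0 < lam" "\<forall>i<N. c i \<in> {0, 1, 2}" "\<Gamma> (point_at N c W) < 1"
  shows "\<Gamma> (point_at N c (\<lambda>i. weighted c i lam (W i))) < 1"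
    and "g (point_at N c (\<lambda>i. weighted c i lam (W i))) = lam * g (point_at N c W)"
proof -
  define t where "t = \<Gamma> (point_at N c W)"
  have t: "0 \<le> t" "t < 1" using assms(3) nonneg by (auto simp: t_def)
  have D: "1 - t + lam * t > 0" using t assms(1) by (simp add: add_pos_nonneg)
  have "1 - moebius lam t = (1 - t) / (1 - t + lam * t)"
    using D by (simp add: moebius_def field_simps)
  moreover have "moebius lam t = lam * t / (1 - t + lam * t)" by (simp add: moebius_def)
  moreover have "(1 - t) / (1 - t + lam * t) > 0" using D t by simp
  ultimately have "moebius lam t < 1" "moebius lam t / (1 - moebius lam t) = lam * (t / (1 - t))"
    using D t by simp_all
  moreover have "\<Gamma> (point_at N c (\<lambda>i. weighted c i lam (W i))) = moebius lam t"
    unfolding t_def by (rule homogeneous[OF assms(1,2)])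
  ultimately show "\<Gamma> (point_at N c (\<lambda>i. weighted c i lam (W i))) < 1"
    and "g (point_at N c (\<lambda>i. weighted c i lam (W i))) = lam * g (point_at N c W)"
    unfolding g_def t_def[symmetric] by simp_all
qed

text \<open>Write \<open>w\<close> for the stretched coordinates of \<open>x \<in> K\<close>. Up to the weighted scaling,
  \<open>(w\<^sub>0, \<dots>, w\<^sub>N\<^sub>-\<^sub>1, 1 - g x)\<close> are homogeneous coordinates of \<open>x\<close>: a chart normalises one of
  them to \<open>\<plusminus>1\<close>, and all changes of charts are rational.\<close>

definition center :: "nat \<Rightarrow> real \<Rightarrow> (nat \<Rightarrow> real) \<Rightarrow> bool" where
  "center j s c \<longleftrightarrow> j \<le> N \<and> (s = 1 \<or> s = -1) \<and> (j = N \<longrightarrow> s = 1) \<and>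
     (\<forall>i<N. c i \<in> {0, 1, 2}) \<and> c N = 0 \<and> c j \<noteq> 1"

definition hom_coord :: "(nat \<Rightarrow> real) \<Rightarrow> (nat \<Rightarrow> real) \<Rightarrow> nat \<Rightarrow> real" where
  "hom_coord c x i = (if i < N then stretch (x i - c i) else 1 - g x)"

text \<open>Under \<open>center j s c\<close> coordinate \<open>j\<close> scales with weight 1 (for
  \<open>j = N\<close> because \<open>c N = 0\<close>), so this factor turns it into the sign
  \<open>s\<close>.\<close>

definition normalise :: "nat \<Rightarrow> real \<Rightarrow> (nat \<Rightarrow> real) \<Rightarrow> (nat \<Rightarrow> real) \<Rightarrow> nat \<Rightarrow> real" where
  "normalise j s c Y i = weighted c i (1 / (s * Y j)) (Y i)"

text \<open>Chart number \<open>N\<close> serves interior points only. Its coordinates may be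
  negative; adding 1 to the first and keeping only values above -1 puts its image into the open
  half-space, and the fixed points of the flow, which have coordinates 0, stay inside.\<close>

definition offset :: "nat \<Rightarrow> nat \<Rightarrow> real" where
  "offset j k = (if j = N \<and> k = 0 then 1 else 0)"

text \<open>Of the \<open>N + 1\<close> homogeneous coordinates, number \<open>j\<close> is normalised away; \<open>slot j\<close> enumerates
  the others so that the one vanishing on the boundary comes first when \<open>j < N\<close>.\<close>

definition slot :: "nat \<Rightarrow> nat \<Rightarrow> nat" where
  "slot j k = (if j = N then k else if k = 0 then N else if k = j then 0 else k)"

definition unslot_index :: "nat \<Rightarrow> nat \<Rightarrow> nat" where
  "unslot_index j i = (if j = N then i else if i = N then 0 else if i = 0 then j else i)"

definition chart :: "nat \<Rightarrow> real \<Rightarrow> (nat \<Rightarrow> real) \<Rightarrow> (nat \<Rightarrow> real) \<Rightarrow> nat \<Rightarrow> real" where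
  "chart j s c x k = (if k < N then normalise j s c (hom_coord c x) (slot j k) + offset j k else 0)"

definition unslot :: "nat \<Rightarrow> real \<Rightarrow> (nat \<Rightarrow> real) \<Rightarrow> nat \<Rightarrow> real" where
  "unslot j s y i = (if i = j then s else y (unslot_index j i) - offset j (unslot_index j i))"

definition chart_domain :: "nat \<Rightarrow> real \<Rightarrow> (nat \<Rightarrow> real) \<Rightarrow> (nat \<Rightarrow> real) set" where
  "chart_domain j s c = {x \<in> K. (\<forall>i<N. \<bar>x i - c i\<bar> < 1) \<and> 0 < s * hom_coord c x j \<and>
     (j = N \<longrightarrow> -1 < normalise j s c (hom_coord c x) 0)}"

definition chart_image :: "nat \<Rightarrow> real \<Rightarrow> (nat \<Rightarrow> real) \<Rightarrow> (nat \<Rightarrow> real) set" where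
  "chart_image j s c = {y \<in> real_seq N \<inter> {y. 0 \<le> y 0}. \<Gamma> (point_at N c (unslot j s y)) < 1 \<and>
      0 < unslot j s y N + g (point_at N c (unslot j s y)) \<and> (j = N \<longrightarrow> 0 < y 0)}"

text \<open>Write a tuple as \<open>(w, v)\<close> with \<open>v\<close> the last entry. If
  \<open>v + g w > 0\<close>, exactly one multiple satisfies \<open>v = 1 - g w\<close>, the
  relation that holds for homogeneous coordinates of points of \<open>K\<close>; homogeneity of
  \<open>g\<close> gives the factor \<open>mu\<close>.\<close>

definition chart_inv :: "nat \<Rightarrow> real \<Rightarrow> (nat \<Rightarrow> real) \<Rightarrow> (nat \<Rightarrow> real) \<Rightarrow> nat \<Rightarrow> real" where
  "chart_inv j s c y = (let Y = unslot j s y; mu = 1 / (Y N + g (point_at N c Y))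
     in point_at N c (\<lambda>i. weighted c i mu (Y i)))"

lemma chart_eq_0: "N \<le> i \<Longrightarrow> chart j s c x i = 0"
  by (simp add: chart_def)

lemma point_at_cong: "(\<And>i. i < N \<Longrightarrow> W i = W' i) \<Longrightarrow> point_at N c W = point_at N c W'"
  by (auto simp: point_at_def)

lemma point_at_hom_coord:
  assumes "x \<in> real_seq N" "\<forall>i<N. \<bar>x i - c i\<bar> < 1"
  shows "point_at N c (hom_coord c x) = x"
  using assms by (auto simp: point_at_def hom_coord_def shrink_stretch)

lemma unslot_slot:
  assumes "j \<le> N" "k < N"
  shows "unslot j s y (slot j k) = y k - offset j k"
  using assms by (auto simp: unslot_def slot_def unslot_index_def)

lemma unslot_eq:
  assumes "j \<le> N" "i \<le> N" "i \<noteq> j"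
  obtains k where "k < N" "slot j k = i" "unslot j s y i = y k - offset j k"
proof -
  have "unslot_index j i < N" "slot j (unslot_index j i) = i"
    using assms by (auto simp: slot_def unslot_index_def)
  then show thesis using assms by (intro that[of "unslot_index j i"]) (auto simp: unslot_def)
qed

lemma unslot_chart:
  assumes "center j s c" "x \<in> chart_domain j s c" "i \<le> N"
  shows "unslot j s (chart j s c x) i = normalise j s c (hom_coord c x) i"
proof (cases "i = j")
  case True
  have "s * hom_coord c x j > 0" using assms(2) by (simp add: chart_domain_def)
  then have "hom_coord c x j \<noteq> 0" by auto
  moreover have "s \<noteq> 0" "1 / s = s" using assms(1) by (auto simp: center_def)
  ultimately show ?thesis using True assms(1)
    by (simp add: unslot_def normalise_def weighted_def center_def)
next
  case False
  have "j \<le> N" using assms(1) by (simp add: center_def)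
  then obtain k where "k < N" "slot j k = i"
    "unslot j s (chart j s c x) i = chart j s c x k - offset j k"
    using unslot_eq[of j i s "chart j s c x"] assms(3) False by blast
  then show ?thesis by (simp add: chart_def)
qed

text \<open>Normalising divides by \<open>nu\<close>, in particular both \<open>1 - g x\<close> and
  \<open>g x\<close>. Their sum is then \<open>1 / nu\<close>, so the factor \<open>mu\<close> in
  \<open>chart_inv\<close> equals \<open>nu\<close> and undoes the division.\<close>

lemma chart_in_image:
  assumes c: "center j s c" and x: "x \<in> chart_domain j s c"
  shows "chart j s c x \<in> chart_image j s c" "chart_inv j s c (chart j s c x) = x"
proof -
  define nu where "nu = s * hom_coord c x j"
  have nu: "nu > 0" using x by (simp add: chart_domain_def nu_def)
  define Y where "Y = unslot j s (chart j s c x)"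
  have Y: "Y i = weighted c i (1 / nu) (hom_coord c x i)" if "i \<le> N" for i
    using unslot_chart[OF c x that] by (simp add: Y_def normalise_def nu_def)
  have xE: "x \<in> real_seq N" and xd: "\<forall>i<N. \<bar>x i - c i\<bar> < 1" and xK: "x \<in> K"
    using x by (auto simp: chart_domain_def K_def)
  have x1: "\<Gamma> x < 1" "g x \<le> 1" using xK by (auto simp: K_iff)
  have cc: "\<forall>i<N. c i \<in> {0, 1, 2}" "c N = 0" "j \<le> N" using c by (auto simp: center_def)
  have ptY: "point_at N c Y = point_at N c (\<lambda>i. weighted c i (1 / nu) (hom_coord c x i))"
    by (rule point_at_cong) (simp add: Y)
  have G: "\<Gamma> (point_at N c Y) < 1" "g (point_at N c Y) = 1 / nu * g x"
    unfolding ptY using g_homogeneous[OF _ cc(1), of "1/nu" "hom_coord c x"] nu x1 point_at_hom_coord[OF xE xd] by auto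
  have YN: "Y N = (1 - g x) / nu" using Y[of N] cc by (simp add: weighted_def hom_coord_def)
  have sum: "Y N + g (point_at N c Y) = 1 / nu" unfolding YN G by (simp add: add_divide_distrib[symmetric])
  have "chart_inv j s c (chart j s c x) = point_at N c (\<lambda>i. weighted c i nu (Y i))"
    unfolding chart_inv_def Let_def Y_def[symmetric] sum by simp
  also have "\<dots> = point_at N c (hom_coord c x)"
    by (rule point_at_cong) (use nu in \<open>simp add: Y weighted_weighted\<close>)
  finally show "chart_inv j s c (chart j s c x) = x" by (simp add: point_at_hom_coord[OF xE xd])
  have y0: "chart j s c x 0 = (if j = N then normalise j s c (hom_coord c x) 0 + 1 else Y N)"
  proof (cases "j = N")
    case True
    then show ?thesis using N by (simp add: chart_def slot_def offset_def)
  next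
    case False
    then have "unslot j s (chart j s c x) N = chart j s c x 0"
      using unslot_slot[of j 0 s "chart j s c x"] cc N by (simp add: slot_def offset_def)
    then show ?thesis using False by (simp add: Y_def)
  qed
  have "0 \<le> Y N" using YN x1 nu by simp
  then show "chart j s c x \<in> chart_image j s c"
    unfolding chart_image_def mem_Collect_eq Int_iff Y_def[symmetric]
    using G(1) sum nu y0 x N by (auto simp: chart_domain_def chart_eq_0)
qed

text \<open>The half-space condition yields \<open>g x \<le> 1\<close>: this needs
  \<open>0 \<le> Y N\<close>, and \<open>Y N\<close> is the coordinate \<open>y 0\<close> when
  \<open>j < N\<close> and the normalised value 1 when \<open>j = N\<close>.\<close>

lemma chart_inv_in_domain:
  assumes c: "center j s c" and y: "y \<in> chart_image j s c"
  shows "chart_inv j s c y \<in> chart_domain j s c" "chart j s c (chart_inv j s c y) = y"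
proof -
  define Y where "Y = unslot j s y"
  define q where "q = point_at N c Y"
  have y': "y \<in> real_seq N" "0 \<le> y 0" "\<Gamma> q < 1" "0 < Y N + g q" "j = N \<longrightarrow> 0 < y 0"
    using y by (auto simp: chart_image_def Y_def q_def)
  have cc: "\<forall>i<N. c i \<in> {0, 1, 2}" "c N = 0" "j \<le> N" "s * s = 1" "c j \<noteq> 1"
    using c by (auto simp: center_def)
  define mu where "mu = 1 / (Y N + g q)"
  have mu: "mu > 0" using y' by (simp add: mu_def)
  define x where "x = chart_inv j s c y"
  have x: "x = point_at N c (\<lambda>i. weighted c i mu (Y i))"
    by (simp add: x_def chart_inv_def Let_def Y_def q_def mu_def)
  have G: "\<Gamma> x < 1" "g x = mu * g q"
    unfolding x q_def using g_homogeneous[OF mu cc(1)] y'(3) unfolding q_def by auto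
  have YN: "0 \<le> Y N"
  proof (cases "j = N")
    case True
    then have "s = 1" using c by (simp add: center_def)
    then show ?thesis using True by (simp add: Y_def unslot_def)
  next
    case False
    then have "Y N = y 0"
      using unslot_slot[of j 0 s y] cc N by (simp add: slot_def offset_def Y_def)
    then show ?thesis using y' by simp
  qed
  have "g x \<le> 1" unfolding G mu_def using YN y' by simp
  then have xK: "x \<in> K" unfolding K_iff using G x point_at_in_real_seq by blast
  have hom_coord_x: "hom_coord c x i = weighted c i mu (Y i)" if "i \<le> N" for i
  proof (cases "i < N")
    case True
    then show ?thesis by (simp add: hom_coord_def x point_at_def)
  next
    case False
    then have "i = N" using that by simp
    moreover have "1 - g x = mu * Y N" unfolding G using y' by (simp add: mu_def field_simps)
    ultimately show ?thesis using cc by (simp add: hom_coord_def weighted_def)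
  qed
  have Yj: "Y j = s" by (simp add: Y_def unslot_def)
  have nu: "s * hom_coord c x j = mu"
    unfolding hom_coord_x[OF cc(3)] Yj using cc by (simp add: weighted_def mult.left_commute[of s])
  have normalise: "normalise j s c (hom_coord c x) i = Y i" if "i \<le> N" for i
    unfolding normalise_def nu hom_coord_x[OF that] using mu by (simp add: weighted_weighted)
  have "\<forall>i<N. \<bar>x i - c i\<bar> < 1" by (simp add: x point_at_def abs_shrink_less)
  moreover have "-1 < normalise j s c (hom_coord c x) 0" if "j = N"
  proof -
    have "Y 0 = y 0 - 1" using that N by (simp add: Y_def unslot_def unslot_index_def offset_def)
    then show ?thesis using normalise[of 0] y' that by simp
  qed
  ultimately show "chart_inv j s c y \<in> chart_domain j s c"
    unfolding x_def[symmetric] chart_domain_def using xK nu mu by simp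
  show "chart j s c (chart_inv j s c y) = y"
  proof
    fix k
    have "slot j k \<le> N" if "k < N" using that cc by (auto simp: slot_def)
    then show "chart j s c (chart_inv j s c y) k = y k"
      unfolding x_def[symmetric] chart_def using normalise unslot_slot[OF cc(3), of k s y] y'(1)
      by (auto simp: Y_def)
  qed
qed

section \<open>Continuity and openness of the charts\<close>

lemma continuous_on_g: "continuous_on {x \<in> real_seq N. \<Gamma> x < 1} g"
  unfolding g_def
  by (intro continuous_intros continuous_on_subset[OF continuous]) auto

lemma continuous_on_hom_coord:
  assumes "i \<le> N"
  shows "continuous_on {x \<in> K. \<forall>i<N. \<bar>x i - c i\<bar> < 1} (\<lambda>x. hom_coord c x i)"
proof (cases "i < N")
  case True
  then have "\<forall>x\<in>{x \<in> K. \<forall>i<N. \<bar>x i - c i\<bar> < 1}. 1 - \<bar>x i - c i\<bar> \<noteq> 0" by force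
  then show ?thesis using True unfolding hom_coord_def stretch_def
    by (simp, intro continuous_intros) (auto intro: continuous_on_subset[OF continuous_on_product_coordinates])
next
  case False
  have "{x \<in> K. \<forall>i<N. \<bar>x i - c i\<bar> < 1} \<subseteq> {x \<in> real_seq N. \<Gamma> x < 1}" by (auto simp: K_iff)
  with False show ?thesis unfolding hom_coord_def
    by simp (intro continuous_intros continuous_on_subset[OF continuous_on_g], auto)
qed

lemma continuous_on_normalise:
  assumes "center j s c" "i \<le> N"
  shows "continuous_on {x \<in> K. (\<forall>i<N. \<bar>x i - c i\<bar> < 1) \<and> 0 < s * hom_coord c x j} (\<lambda>x. normalise j s c (hom_coord c x) i)"
    (is "continuous_on ?A _")
proof -
  have "j \<le> N" using assms by (simp add: center_def)
  then have *: "continuous_on ?A (\<lambda>x. hom_coord c x i)" "continuous_on ?A (\<lambda>x. hom_coord c x j)"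
    using assms(2) by (auto intro: continuous_on_subset[OF continuous_on_hom_coord])
  have "s * hom_coord c x j \<noteq> 0" if "x \<in> ?A" for x using that by auto
  then show ?thesis
    unfolding normalise_def weighted_def by (cases "c i = 1") (simp_all, (intro continuous_intros *; force)+)
qed

lemma continuous_on_chart:
  assumes "center j s c" shows "continuous_on (chart_domain j s c) (chart j s c)"
proof (rule continuous_on_coordinatewise_then_product)
  fix k
  have "slot j k \<le> N" if "k < N" using that assms by (auto simp: slot_def center_def)
  then show "continuous_on (chart_domain j s c) (\<lambda>x. chart j s c x k)"
    unfolding chart_def
    by (cases "k < N") (simp_all, intro continuous_intros continuous_on_subset[OF continuous_on_normalise[OF assms]],
        auto simp: chart_domain_def)
qed

text \<open>The conditions are imposed one after another because each function is continuous only on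
  the set cut out before: \<open>hom_coord\<close> needs all distances to \<open>c\<close> below 1,
  \<open>normalise\<close> moreover a positive divisor.\<close>

lemma openin_chart_domain:
  assumes "center j s c" shows "openin (top_of_set K) (chart_domain j s c)"
proof -
  define A where "A = {x \<in> K. \<forall>i<N. \<bar>x i - c i\<bar> < 1}"
  define B where "B = {x \<in> A. 0 < s * hom_coord c x j}"
  have jN: "j \<le> N" using assms by (simp add: center_def)
  have "open {x::nat \<Rightarrow> real. \<bar>x i - c i\<bar> < 1}" for i
    by (intro open_Collect_less continuous_intros continuous_on_product_coordinates)
  then have "open (\<Inter>i\<in>{..<N}. {x::nat \<Rightarrow> real. \<bar>x i - c i\<bar> < 1})" by (intro open_INT) auto
  moreover have "A = K \<inter> (\<Inter>i\<in>{..<N}. {x::nat \<Rightarrow> real. \<bar>x i - c i\<bar> < 1})" by (auto simp: A_def)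
  ultimately have A: "openin (top_of_set K) A" by (simp add: openin_open_Int)
  have "openin (top_of_set A) (A \<inter> (\<lambda>x. s * hom_coord c x j) -` {0<..})"
    by (rule continuous_openin_preimage_gen) (auto simp: A_def intro!: continuous_intros continuous_on_hom_coord jN)
  moreover have "B = A \<inter> (\<lambda>x. s * hom_coord c x j) -` {0<..}" by (auto simp: B_def)
  ultimately have B: "openin (top_of_set K) B" using A openin_trans by metis
  have "openin (top_of_set B) (B \<inter> (\<lambda>x. normalise j s c (hom_coord c x) 0) -` {-1<..})"
    by (rule continuous_openin_preimage_gen)
      (auto simp: A_def B_def intro!: continuous_on_subset[OF continuous_on_normalise[OF assms, of 0]])
  then have C: "openin (top_of_set K) (B \<inter> (\<lambda>x. normalise j s c (hom_coord c x) 0) -` {-1<..})"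
    using B openin_trans by metis
  show ?thesis
  proof (cases "j = N")
    case True
    then have "chart_domain j s c = B \<inter> (\<lambda>x. normalise j s c (hom_coord c x) 0) -` {-1<..}"
      by (auto simp: chart_domain_def A_def B_def)
    then show ?thesis using C by simp
  next
    case False
    then have "chart_domain j s c = B" by (auto simp: chart_domain_def A_def B_def)
    then show ?thesis using B by simp
  qed
qed

lemma continuous_on_unslot: "continuous_on A (\<lambda>y. unslot j s y i)"
  unfolding unslot_def
  by (cases "i = j") (auto intro!: continuous_intros continuous_on_subset[OF continuous_on_product_coordinates])

lemma continuous_on_point_at:
  assumes "\<And>i. i < N \<Longrightarrow> continuous_on A (\<lambda>y. W y i)"
  shows "continuous_on A (\<lambda>y. point_at N c (W y))"
proof (rule continuous_on_coordinatewise_then_product)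
  show "continuous_on A (\<lambda>y. point_at N c (W y) i)" for i
    unfolding point_at_def using assms[of i] by (cases "i < N") (auto intro!: continuous_intros)
qed

lemma continuous_on_Gamma_unslot: "continuous_on A (\<lambda>y. \<Gamma> (point_at N c (unslot j s y)))"
  by (rule continuous_on_compose2[OF continuous]) (auto intro: continuous_on_point_at continuous_on_unslot simp: point_at_in_real_seq[simplified])

lemma openin_chart_image: "openin (half_space N) (chart_image j s c)"
proof -
  let ?H = "real_seq N \<inter> {y. 0 \<le> y 0}"
  let ?f = "\<lambda>y. \<Gamma> (point_at N c (unslot j s y))"
  \<comment> \<open>This is the positivity condition multiplied by \<open>1 - ?f y\<close>. Unlike
    \<open>g\<close>, it is continuous on the whole half-space.\<close>
  let ?h = "\<lambda>y. unslot j s y N * (1 - ?f y) + ?f y"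
  have 1: "openin (top_of_set ?H) (?H \<inter> ?f -` {..<1})"
    by (rule continuous_openin_preimage_gen) (auto intro: continuous_on_Gamma_unslot)
  have 2: "openin (top_of_set ?H) (?H \<inter> ?h -` {0<..})"
    by (rule continuous_openin_preimage_gen)
      (auto intro!: continuous_intros continuous_on_Gamma_unslot continuous_on_unslot)
  have 3: "openin (top_of_set ?H) (?H \<inter> {y. j = N \<longrightarrow> 0 < y 0})"
  proof (cases "j = N")
    case True
    have "openin (top_of_set ?H) (?H \<inter> (\<lambda>y. y 0) -` {0<..})"
      by (rule continuous_openin_preimage_gen)
        (auto intro: continuous_on_subset[OF continuous_on_product_coordinates])
    moreover have "?H \<inter> {y. j = N \<longrightarrow> 0 < y 0} = ?H \<inter> (\<lambda>y. y 0) -` {0<..}" using True by auto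
    ultimately show ?thesis by simp
  qed simp
  have "0 < unslot j s y N + g (point_at N c (unslot j s y)) \<longleftrightarrow> 0 < ?h y" if "?f y < 1" for y
    using that unfolding g_def by (simp add: field_simps)
  then have "chart_image j s c = (?H \<inter> ?f -` {..<1}) \<inter> (?H \<inter> ?h -` {0<..}) \<inter> (?H \<inter> {y. j = N \<longrightarrow> 0 < y 0})"
    unfolding chart_image_def by auto
  moreover have "half_space N = top_of_set ?H"
    by (simp add: half_space_def Euclidean_space_top_of_set subtopology_subtopology)
  ultimately show ?thesis using openin_Int[OF openin_Int[OF 1 2] 3] by simp
qed

lemma continuous_on_chart_inv: "continuous_on (chart_image j s c) (chart_inv j s c)"
proof -
  let ?mu = "\<lambda>y. 1 / (unslot j s y N + g (point_at N c (unslot j s y)))"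
  have "continuous_on (chart_image j s c) (\<lambda>y. g (point_at N c (unslot j s y)))"
    by (rule continuous_on_compose2[OF continuous_on_g])
      (auto intro: continuous_on_point_at continuous_on_unslot simp: chart_image_def point_at_in_real_seq[simplified])
  moreover have nz: "unslot j s y N + g (point_at N c (unslot j s y)) \<noteq> 0" if "y \<in> chart_image j s c" for y
    using that by (auto simp: chart_image_def)
  ultimately have mu: "continuous_on (chart_image j s c) ?mu"
    by (intro continuous_intros continuous_on_unslot) auto
  have "continuous_on (chart_image j s c) (\<lambda>y. weighted c i (?mu y) (unslot j s y i))" for i
  proof (cases "c i = 1")
    case True
    have "continuous_on (chart_image j s c) (\<lambda>y. unslot j s y i / ?mu y)"
      by (rule continuous_on_divide[OF continuous_on_unslot mu]) (use nz in auto)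
    then show ?thesis using True by (simp add: weighted_def)
  next
    case False
    have "continuous_on (chart_image j s c) (\<lambda>y. ?mu y * unslot j s y i)"
      by (rule continuous_on_mult[OF mu continuous_on_unslot])
    then show ?thesis using False by (simp add: weighted_def)
  qed
  then show ?thesis unfolding chart_inv_def Let_def by (intro continuous_on_point_at) auto
qed

lemma chart_image_eq:
  assumes "center j s c" shows "chart j s c ` chart_domain j s c = chart_image j s c"
  using chart_in_image[OF assms] chart_inv_in_domain[OF assms] by (force simp: image_iff)

lemma half_space_chart_chart:
  assumes c: "center j s c"
  shows "half_space_chart N (top_of_set K) (chart_domain j s c) (chart j s c)"
proof -
  have H: "subtopology (half_space N) (chart_image j s c) = top_of_set (chart_image j s c)"
    using openin_subset[OF openin_chart_image[of j s c]]
    by (simp add: half_space_def Euclidean_space_top_of_set subtopology_subtopology inf.absorb2)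
  have D: "subtopology (top_of_set K) (chart_domain j s c) = top_of_set (chart_domain j s c)"
    using openin_subset[OF openin_chart_domain[OF c]]
    by (simp add: subtopology_subtopology inf.absorb2)
  have "homeomorphic_maps (top_of_set (chart_domain j s c)) (top_of_set (chart_image j s c))
      (chart j s c) (chart_inv j s c)"
    unfolding homeomorphic_maps_def using continuous_on_chart[OF c] continuous_on_chart_inv
      chart_in_image[OF c] chart_inv_in_domain[OF c] by auto
  then show ?thesis
    unfolding half_space_chart_def chart_image_eq[OF c] H D
    using openin_chart_domain[OF c] openin_chart_image homeomorphic_maps_map by blast
qed

text \<open>If some \<open>x j\<close> is not a fixed point of the line flow, choosing centers 0 and
  2 on either side of 1 makes coordinate \<open>j\<close> nonzero of weight 1, and it can be
  normalised. Otherwise the scaling fixes \<open>x\<close>, homogeneity gives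
  \<open>g x = 2 * g x\<close>, so \<open>g x = 0\<close> and the last coordinate
  \<open>1 - g x\<close> is 1.\<close>

lemma chart_cover:
  assumes x: "x \<in> K" obtains j s c where "center j s c" "x \<in> chart_domain j s c"
proof (cases "\<exists>j<N. x j \<notin> {0, 1, 2}")
  case True
  then obtain j where j: "j < N" "x j \<notin> {0, 1, 2}" by blast
  have b: "-1 < x i \<and> x i < 3" if "i < N" for i
    using bounded x that by (simp add: K_def)
  define c where "c i = (if i \<ge> N then 0 else if x i < 1 then 0 else if x i > 1 then 2 else (1::real))" for i
  define s where "s = sgn (x j - c j)"
  have d: "\<forall>i<N. \<bar>x i - c i\<bar> < 1" using b by (force simp: c_def)
  have "x j \<noteq> c j" using j by (auto simp: c_def)
  then have s: "s = 1 \<or> s = -1" by (auto simp: s_def sgn_if)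
  have "center j s c" using j s by (auto simp: center_def c_def)
  moreover have "0 < s * hom_coord c x j"
  proof -
    have "hom_coord c x j = (x j - c j) / (1 - \<bar>x j - c j\<bar>)" using j by (simp add: hom_coord_def stretch_def)
    moreover have "s * (x j - c j) > 0" unfolding s_def using \<open>x j \<noteq> c j\<close> by (simp add: sgn_if)
    ultimately show ?thesis using d j by simp
  qed
  ultimately show ?thesis using j d x by (intro that[of j s c]) (auto simp: chart_domain_def)
next
  case False
  define c where "c i = (if i < N then x i else 0)" for i
  have cen: "center N 1 c" using False by (auto simp: center_def c_def)
  have h0: "hom_coord c x i = 0" if "i < N" for i using that by (simp add: hom_coord_def c_def stretch_def)
  have d: "\<forall>i<N. \<bar>x i - c i\<bar> < 1" by (simp add: c_def)
  have xE: "x \<in> real_seq N" "\<Gamma> x \<le> 1/2" using x by (auto simp: K_def)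
  have "point_at N c (\<lambda>i. weighted c i 2 (hom_coord c x i)) = point_at N c (hom_coord c x)"
    by (rule point_at_cong) (simp add: h0 weighted_def)
  then have "g x = 2 * g x"
    using g_homogeneous(2)[of 2 c "hom_coord c x"] cen xE point_at_hom_coord[OF xE(1) d] by (auto simp: center_def)
  then have "g x = 0" by simp
  then show ?thesis using cen d x h0[of 0] N
    by (intro that[of N 1 c]) (auto simp: chart_domain_def hom_coord_def normalise_def weighted_def)
qed

text \<open>If the unit intervals around two different centers overlap, exactly one of the centers
  is 1. The weights are then opposite, in accordance with the inversion.\<close>

definition recenter :: "(nat \<Rightarrow> real) \<Rightarrow> (nat \<Rightarrow> real) \<Rightarrow> (nat \<Rightarrow> real) \<Rightarrow> nat \<Rightarrow> real" where
  "recenter c c' Y i = (if c i = c' i then Y i else - 1 / Y i)"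

definition transition ::
    "nat \<Rightarrow> real \<Rightarrow> (nat \<Rightarrow> real) \<Rightarrow> nat \<Rightarrow> real \<Rightarrow> (nat \<Rightarrow> real) \<Rightarrow> (nat \<Rightarrow> real) \<Rightarrow> nat \<Rightarrow> real" where
  "transition j s c j' s' c' y k =
     normalise j' s' c' (recenter c c' (unslot j s y)) (slot j' k) + offset j' k"

text \<open>Only the scaling class of the homogeneous coordinates matters, and its last entry
  \<open>1 - g x\<close> is the same for both centers. So \<open>g\<close> does not occur in
  \<open>transition\<close>, which is why a merely continuous gauge gives a smooth atlas. The second
  claim provides the nonzero denominators.\<close>

lemma transition_chart:
  assumes c: "center j s c" "center j' s' c'"
    and x: "x \<in> chart_domain j s c" "x \<in> chart_domain j' s' c'" and k: "k < N"
  shows "chart j' s' c' x k = transition j s c j' s' c' (chart j s c x) k"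
    and "\<And>i. i \<le> N \<Longrightarrow> c i \<noteq> c' i \<or> i = j' \<Longrightarrow> unslot j s (chart j s c x) i \<noteq> 0"
proof -
  define nu where "nu = s * hom_coord c x j"
  have nu: "nu > 0" using x by (simp add: chart_domain_def nu_def)
  define Y where "Y = unslot j s (chart j s c x)"
  have Y: "Y i = weighted c i (1 / nu) (hom_coord c x i)" if "i \<le> N" for i
    using unslot_chart[OF c(1) x(1) that] by (simp add: Y_def normalise_def nu_def)
  have nbr: "hom_coord c x i \<noteq> 0 \<and> hom_coord c' x i = - 1 / hom_coord c x i \<and> (c i = 1 \<longleftrightarrow> c' i \<noteq> 1) \<and> i < N"
    if i: "i \<le> N" "c i \<noteq> c' i" for i
  proof -
    have iN: "i < N" using i c by (cases "i = N") (auto simp: center_def)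
    have d: "\<bar>x i - c i\<bar> < 1" "\<bar>x i - c' i\<bar> < 1" using x iN by (auto simp: chart_domain_def)
    have "c i \<in> {0,1,2}" "c' i \<in> {0,1,2}" using c iN by (auto simp: center_def)
    then have e: "c' i - c i = 1 \<or> c' i - c i = -1" and "c i = 1 \<longleftrightarrow> c' i \<noteq> 1" using d i(2) by auto
    moreover have "\<bar>(x i - c i) - (c' i - c i)\<bar> < 1" using d(2) by simp
    ultimately show ?thesis
      using stretch_neighbour[OF d(1) _ e] iN by (simp add: hom_coord_def)
  qed
  have R: "recenter c c' Y i = weighted c' i (1 / nu) (hom_coord c' x i)" if "i \<le> N" for i
  proof (cases "c i = c' i")
    case True
    then have "hom_coord c x i = hom_coord c' x i" by (simp add: hom_coord_def)
    then show ?thesis using True by (simp add: recenter_def Y[OF that]) (simp add: weighted_def)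
  next
    case False
    then show ?thesis using nbr[OF that False] nu unfolding recenter_def Y[OF that]
      by (auto simp: weighted_def field_simps)
  qed
  have j': "j' \<le> N" "c' j' \<noteq> 1" using c by (auto simp: center_def)
  have nu': "s' * hom_coord c' x j' > 0" using x by (simp add: chart_domain_def)
  have sl: "slot j' k \<le> N" using k j' by (auto simp: slot_def)
  have "s' * recenter c c' Y j' = (s' * hom_coord c' x j') / nu"
    unfolding R[OF j'(1)] using j' by (simp add: weighted_def)
  then have "normalise j' s' c' (recenter c c' Y) (slot j' k) = normalise j' s' c' (hom_coord c' x) (slot j' k)"
    unfolding normalise_def R[OF sl] using nu nu' by (auto simp: weighted_def)
  then show "chart j' s' c' x k = transition j s c j' s' c' (chart j s c x) k"
    using k by (simp add: chart_def transition_def Y_def)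
  fix i assume i: "i \<le> N" "c i \<noteq> c' i \<or> i = j'"
  have "hom_coord c x i \<noteq> 0"
  proof (cases "c i = c' i")
    case True
    then have "hom_coord c x i = hom_coord c' x i" by (simp add: hom_coord_def)
    moreover have "hom_coord c' x j' \<noteq> 0" using nu' by auto
    ultimately show ?thesis using i True by auto
  qed (use nbr i in blast)
  then show "unslot j s (chart j s c x) i \<noteq> 0"
    using Y[OF i(1)] nu unfolding Y_def[symmetric] by (simp add: weighted_def)
qed

lemma smooth_transition:
  assumes c: "center j s c" "center j' s' c'"
  shows "smooth_map_on N (chart j s c ` (chart_domain j s c \<inter> chart_domain j' s' c'))
     (chart j' s' c' \<circ> inv_into (chart_domain j s c) (chart j s c))"
  unfolding smooth_map_on_def
proof (intro allI impI)
  fix k assume k: "k < N"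
  \<comment> \<open>These are the indices at which the transition divides: coordinates to be
    inverted, and the new divisor \<open>j'\<close>.\<close>
  define I where "I = {i. i \<le> N \<and> (c i \<noteq> c' i \<or> i = j')}"
  define U where "U = {y \<in> real_seq N. \<forall>i\<in>I. unslot j s y i \<noteq> 0}"
  have "open ((\<lambda>y. unslot j s y i) -` (- {0}))" for i
    by (rule open_vimage) (auto intro: continuous_on_unslot)
  then have "open (\<Inter>i\<in>I. (\<lambda>y. unslot j s y i) -` (- {0}))"
    by (intro open_INT) (auto simp: I_def)
  moreover have "U = real_seq N \<inter> (\<Inter>i\<in>I. (\<lambda>y. unslot j s y i) -` (- {0}))"
    by (auto simp: U_def)
  ultimately have U: "openin (Euclidean_space N) U" by (simp add: Euclidean_space_top_of_set openin_open_Int)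
  have us: "rational_on N U (\<lambda>y. unslot j s y i)" for i
    unfolding unslot_def by (cases "i = j") (auto intro: rational_on.intros rational_on_diff)
  have re: "rational_on N U (\<lambda>y. recenter c c' (unslot j s y) i)" if "i \<le> N" for i
    unfolding recenter_def using that
    by (cases "c i = c' i") (simp_all add: us, (intro rational_on_uminus rational_on_divide rational_on.const us, auto simp: U_def I_def)?)
  have j': "j' \<le> N" "s' \<noteq> 0" using c by (auto simp: center_def)
  have nz: "s' * recenter c c' (unslot j s y) j' \<noteq> 0" if "y \<in> U" for y
    using that j' by (auto simp: U_def I_def recenter_def)
  have sl: "slot j' k \<le> N" using k j' by (auto simp: slot_def)
  have "rational_on N U (\<lambda>y. transition j s c j' s' c' y k)"
    unfolding transition_def normalise_def weighted_def
    using nz by (cases "c' (slot j' k) = 1")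
      (auto intro!: rational_on.add rational_on.const rational_on_divide rational_on.mult re sl j'(1))
  then show "smooth_real_on N (chart j s c ` (chart_domain j s c \<inter> chart_domain j' s' c'))
     (\<lambda>x. (chart j' s' c' \<circ> inv_into (chart_domain j s c) (chart j s c)) x k)"
  proof (rule smooth_real_on_rational[OF U])
    show "chart j s c ` (chart_domain j s c \<inter> chart_domain j' s' c') \<subseteq> U"
      using transition_chart(2)[OF c _ _ k] by (auto simp: U_def I_def chart_def)
    fix y assume "y \<in> chart j s c ` (chart_domain j s c \<inter> chart_domain j' s' c')"
    then obtain x where x: "y = chart j s c x" "x \<in> chart_domain j s c" "x \<in> chart_domain j' s' c'" by blast
    have "inj_on (chart j s c) (chart_domain j s c)"
      using chart_in_image(2)[OF c(1)] by (metis inj_onI)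
    then show "(chart j' s' c' \<circ> inv_into (chart_domain j s c) (chart j s c)) y k = transition j s c j' s' c' y k"
      using x transition_chart(1)[OF c x(2,3) k] by simp
  qed
qed

lemma compact_K: "compact K"
proof -
  have "compactin (powertop_real UNIV) (PiE UNIV (\<lambda>i. if i < N then {-1..3} else {0}))"
    by (auto simp: compactin_PiE)
  then have C: "compact (PiE UNIV (\<lambda>i. if i < N then {-1..3} else {0::real}))"
    by (simp add: euclidean_product_topology)
  have "closed (real_seq N)"
    using closedin_Euclidean_space[of N] by (simp add: topspace_Euclidean_space euclidean_product_topology)
  then have "closed (real_seq N \<inter> \<Gamma> -` {..1/2})"
    by (rule continuous_closed_preimage[OF continuous]) simp
  moreover have "K = real_seq N \<inter> \<Gamma> -` {..1/2}" by (auto simp: K_def)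
  ultimately have "closed K" by simp
  moreover have "K \<subseteq> PiE UNIV (\<lambda>i. if i < N then {-1..3} else {0})"
  proof
    fix x assume "x \<in> K"
    then show "x \<in> PiE UNIV (\<lambda>i. if i < N then {-1..3} else {0})"
      using bounded[of x] by (force simp: K_def PiE_UNIV_domain)
  qed
  ultimately show ?thesis using C compact_Int_closed[OF C] by (metis inf.absorb_iff2)
qed

theorem smooth_manifold_K:
  "\<exists>A. smooth_manifold_with_boundary N (top_of_set K) A"
proof (intro exI)
  let ?A = "{(chart_domain j s c, chart j s c) | j s c. center j s c}"
  have "second_countable (euclidean :: (nat \<Rightarrow> real) topology)"
  proof -
    obtain B :: "(nat \<Rightarrow> real) set set" where "countable B" "topological_basis B"
      using ex_countable_basis by blast
    moreover from this have "open V" if "V \<in> B" for V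
      using that topological_basis_open by blast
    ultimately show ?thesis unfolding second_countable_def
      by (intro exI[of _ B]) (auto elim!: topological_basisE)
  qed
  then have "second_countable (top_of_set K)" by (rule second_countable_subtopology)
  moreover have "Hausdorff_space (top_of_set K)" by (simp add: Hausdorff_space_subtopology)
  moreover have "smooth_atlas N (top_of_set K) ?A"
    unfolding smooth_atlas_def
  proof (intro conjI)
    show "\<forall>(U, \<phi>)\<in>?A. half_space_chart N (top_of_set K) U \<phi>"
      using half_space_chart_chart by auto
    show "(\<Union>(U, \<phi>)\<in>?A. U) = topspace (top_of_set K)"
    proof
      show "topspace (top_of_set K) \<subseteq> (\<Union>(U, \<phi>)\<in>?A. U)"
        by (auto elim!: chart_cover)
    qed (auto simp: chart_domain_def)
    show "\<forall>(U, \<phi>)\<in>?A. \<forall>(V, \<psi>)\<in>?A. smooth_map_on N (\<phi> ` (U \<inter> V)) (\<psi> \<circ> inv_into U \<phi>)"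
      using smooth_transition by auto
  qed
  ultimately show "smooth_manifold_with_boundary N (top_of_set K) ?A"
    by (simp add: smooth_manifold_with_boundary_def)
qed

end

section \<open>Zigzag polycubes\<close>

definition cells :: "nat \<Rightarrow> (nat \<Rightarrow> nat) set" where
  "cells N = {..<N} \<rightarrow>\<^sub>E {..3}"

definition polycube :: "nat \<Rightarrow> (nat \<Rightarrow> nat) set \<Rightarrow> (nat \<Rightarrow> real) set" where
  "polycube N S = {x \<in> real_seq N. \<exists>z\<in>S. \<forall>i<N. \<bar>x i - real (z i)\<bar> \<le> 1/2}"

text \<open>On each coordinate line, a flow leaves the centers of the cells 0 and 2 for that of cell 1, and
  the center of cell 2 for infinity through cell 3; a cell precedes another if the flow passes from it
  into the other.\<close>

definition zigzag_le :: "nat \<Rightarrow> nat \<Rightarrow> bool" where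
  "zigzag_le k m \<longleftrightarrow> k = m \<or> (m = 1 \<and> (k = 0 \<or> k = 2)) \<or> (m = 3 \<and> k = 2)"

definition down_closed :: "nat \<Rightarrow> (nat \<Rightarrow> nat) set \<Rightarrow> bool" where
  "down_closed N S \<longleftrightarrow> (\<forall>z\<in>S. \<forall>z'\<in>cells N. (\<forall>i<N. zigzag_le (z' i) (z i)) \<longrightarrow> z' \<in> S)"

text \<open>\<open>g / (1 + g)\<close> for the \<open>g\<close> with \<open>g \<le> 1\<close> exactly on the union of the cells preceding cell \<open>m\<close>;
  the value 1 means that the flow never meets these cells.\<close>

definition cell_gauge :: "nat \<Rightarrow> real \<Rightarrow> real" where
  "cell_gauge m x =
    (if m = 0 then min 1 \<bar>x\<bar>
     else if m = 1 then min 1 (max 0 (max (- x) (x - 2)))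
     else if m = 2 then min 1 \<bar>x - 2\<bar>
     else min 1 (max 0 (2 - x)) + max 0 (min 1 (x - 2)) / (3 - 2 * max 0 (min 1 (x - 2))))"

lemma continuous_on_cell_gauge: "continuous_on A f \<Longrightarrow> continuous_on A (\<lambda>x. cell_gauge m (f x))"
proof -
  assume f: "continuous_on A f"
  have "3 - 2 * max 0 (min 1 (f x - 2)) \<noteq> 0" for x by (simp add: max_def min_def)
  then show ?thesis unfolding cell_gauge_def using f
    by (cases "m = 0"; cases "m = 1"; cases "m = 2") (simp_all, (intro continuous_intros; force)+)
qed

text \<open>The middle formula is \<open>g / (1 + g)\<close> for \<open>g = w / 3\<close>, where
  \<open>w = stretch (x - 2)\<close>. Since \<open>stretch (3/4) = 3\<close>, the value
  \<open>g = 1\<close> occurs at 11/4, the end of the shrunk cell 3.\<close>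

lemma cell_gauge_3:
  "x \<le> 2 \<Longrightarrow> cell_gauge 3 x = min 1 (2 - x)"
  "2 \<le> x \<Longrightarrow> x \<le> 3 \<Longrightarrow> cell_gauge 3 x = (x - 2) / (3 - 2 * (x - 2))"
  "3 \<le> x \<Longrightarrow> cell_gauge 3 x = 1"
  by (simp_all add: cell_gauge_def max_absorb1 max_absorb2 min_absorb1 min_absorb2)

lemma cell_gauge_bounds: "m \<le> 3 \<Longrightarrow> 0 \<le> cell_gauge m x \<and> cell_gauge m x \<le> 1"
proof -
  assume "m \<le> 3"
  then consider "m = 0" | "m = 1" | "m = 2" | "m = 3" by linarith
  then show ?thesis
  proof cases
    case 4
    consider "x \<le> 2" | "2 \<le> x" "x \<le> 3" | "3 \<le> x" by linarith
    then show ?thesis by cases (auto simp: 4 cell_gauge_3)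
  qed (auto simp: cell_gauge_def)
qed

lemma moebius_frac: "0 < lam \<Longrightarrow> 0 \<le> v \<Longrightarrow> moebius lam (v / (1 + v)) = lam * v / (1 + lam * v)"
proof -
  assume "0 < lam" "0 \<le> v"
  then have "1 + v > 0" "1 + lam * v > 0" by (auto intro: add_pos_nonneg)
  moreover from this have "1 - v / (1 + v) + lam * (v / (1 + v)) = (1 + lam * v) / (1 + v)"
    by (simp add: field_simps)
  ultimately show ?thesis unfolding moebius_def by simp
qed

lemma moebius_1: "0 < lam \<Longrightarrow> moebius lam 1 = 1"
  by (simp add: moebius_def)

lemma shrink_pos: "0 \<le> w \<Longrightarrow> shrink w = w / (1 + w)" by (simp add: shrink_def)
lemma shrink_neg: "w \<le> 0 \<Longrightarrow> shrink w = - ((- w) / (1 + (- w)))" by (simp add: shrink_def)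
text \<open>All values other than the constants 0 and 1, which \<open>moebius lam\<close> fixes, can
  be put in the form \<open>v / (1 + v)\<close>, where \<open>v\<close> is homogeneous in
  \<open>w\<close> under positive factors: of degree 1 around 0 and 2, of degree -1 around 1.
  Homogeneity of the gauge can be read off from this.\<close>

lemma cell_gauge_values:
  "cell_gauge 0 (0 + shrink w) = \<bar>w\<bar> / (1 + \<bar>w\<bar>)"
  "0 \<le> w \<Longrightarrow> cell_gauge 0 (1 + shrink w) = 1"
  "w < 0 \<Longrightarrow> cell_gauge 0 (1 + shrink w) = (1 / (- w)) / (1 + 1 / (- w))"
  "cell_gauge 0 (2 + shrink w) = 1"
  "cell_gauge 1 (0 + shrink w) = max 0 (- w) / (1 + max 0 (- w))"
  "cell_gauge 1 (1 + shrink w) = 0"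
  "cell_gauge 1 (2 + shrink w) = max 0 w / (1 + max 0 w)"
  "cell_gauge 2 (0 + shrink w) = 1"
  "w \<le> 0 \<Longrightarrow> cell_gauge 2 (1 + shrink w) = 1"
  "0 < w \<Longrightarrow> cell_gauge 2 (1 + shrink w) = (1 / w) / (1 + 1 / w)"
  "cell_gauge 2 (2 + shrink w) = \<bar>w\<bar> / (1 + \<bar>w\<bar>)"
  "cell_gauge 3 (0 + shrink w) = 1"
  "cell_gauge 3 (1 + shrink w) = cell_gauge 2 (1 + shrink w)"
  "cell_gauge 3 (2 + shrink w) = max (- w) (w / 3) / (1 + max (- w) (w / 3))"
proof -
  note b = abs_shrink_less[of w]
  show "cell_gauge 0 (0 + shrink w) = \<bar>w\<bar> / (1 + \<bar>w\<bar>)" "cell_gauge 2 (2 + shrink w) = \<bar>w\<bar> / (1 + \<bar>w\<bar>)"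
    using b by (auto simp: cell_gauge_def abs_shrink)
  show "cell_gauge 0 (2 + shrink w) = 1" "cell_gauge 2 (0 + shrink w) = 1" "cell_gauge 3 (0 + shrink w) = 1" "cell_gauge 1 (1 + shrink w) = 0"
    using b by (auto simp: cell_gauge_def)
  show "cell_gauge 3 (1 + shrink w) = cell_gauge 2 (1 + shrink w)" using b by (auto simp: cell_gauge_def)
  show "cell_gauge 0 (1 + shrink w) = 1" if "0 \<le> w" using that by (simp add: cell_gauge_def shrink_pos)
  show "cell_gauge 2 (1 + shrink w) = 1" if "w \<le> 0" using that b by (simp add: cell_gauge_def shrink_def divide_nonpos_pos)
  show "cell_gauge 0 (1 + shrink w) = (1 / (- w)) / (1 + 1 / (- w))" if "w < 0"
  proof -
    have "1 + shrink w = 1 / (1 - w)" using that by (simp add: shrink_neg field_simps)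
    moreover have "min 1 \<bar>1 / (1 - w)\<bar> = 1 / (1 - w)" using that by simp
    moreover have "1 / (1 - w) = (1 / (- w)) / (1 + 1 / (- w))" using that by (simp add: field_simps)
    ultimately show ?thesis by (simp add: cell_gauge_def)
  qed
  show "cell_gauge 2 (1 + shrink w) = (1 / w) / (1 + 1 / w)" if "0 < w"
  proof -
    have "1 + shrink w - 2 = - (1 / (1 + w))" using that by (simp add: shrink_pos field_simps)
    moreover have "min 1 \<bar>- (1 / (1 + w))\<bar> = 1 / (1 + w)" using that by simp
    moreover have "1 / (1 + w) = (1 / w) / (1 + 1 / w)" using that by (simp add: field_simps)
    ultimately show ?thesis by (simp add: cell_gauge_def)
  qed
  have g1: "cell_gauge 1 (0 + shrink w) = max 0 (- shrink w)" "cell_gauge 1 (2 + shrink w) = max 0 (shrink w)"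
    using b by (auto simp: cell_gauge_def max_def min_def)
  have max0: "max 0 (- shrink w) = max 0 (- w) / (1 + max 0 (- w))" "max 0 (shrink w) = max 0 w / (1 + max 0 w)"
  proof -
    consider "0 \<le> w" "0 \<le> shrink w" | "w \<le> 0" "shrink w \<le> 0"
      by (cases "0 \<le> w") (auto simp: shrink_def divide_nonpos_pos)
    then show "max 0 (- shrink w) = max 0 (- w) / (1 + max 0 (- w))"
      by cases (simp_all add: max_absorb1 max_absorb2, simp add: shrink_neg)
    consider "0 \<le> w" "0 \<le> shrink w" | "w \<le> 0" "shrink w \<le> 0"
      by (cases "0 \<le> w") (auto simp: shrink_def divide_nonpos_pos)
    then show "max 0 (shrink w) = max 0 w / (1 + max 0 w)"
      by cases (simp_all add: max_absorb1 max_absorb2, simp add: shrink_pos)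
  qed
  show "cell_gauge 1 (0 + shrink w) = max 0 (- w) / (1 + max 0 (- w))" "cell_gauge 1 (2 + shrink w) = max 0 w / (1 + max 0 w)"
    by (simp_all only: g1 max0)
  show "cell_gauge 3 (2 + shrink w) = max (- w) (w / 3) / (1 + max (- w) (w / 3))"
  proof (cases "0 \<le> w")
    case True
    have "0 \<le> shrink w" using True by (simp add: shrink_def)
    then have "cell_gauge 3 (2 + shrink w) = shrink w / (3 - 2 * shrink w)"
      using cell_gauge_3(2)[of "2 + shrink w"] b by simp
    also have "\<dots> = w / (3 + w)"
    proof -
      have "3 - 2 * shrink w = (3 + w) / (1 + w)" using True by (simp add: shrink_pos field_simps)
      then show ?thesis using True by (simp add: shrink_pos)
    qed
    also have "\<dots> = (w / 3) / (1 + w / 3)" using True by (simp add: field_simps)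
    finally show ?thesis using True by (simp add: max_def)
  next
    case False
    then have "shrink w \<le> 0" by (simp add: shrink_def divide_nonpos_pos)
    then have "cell_gauge 3 (2 + shrink w) = - shrink w" using cell_gauge_3(1)[of "2 + shrink w"] b by simp
    then show ?thesis using False by (simp add: shrink_neg max_def)
  qed
qed

lemma cell_gauge_homogeneous:
  assumes "m \<le> 3" "0 < lam" "c i \<in> {0, 1, 2}"
  shows "cell_gauge m (c i + shrink (weighted c i lam w)) = moebius lam (cell_gauge m (c i + shrink w))"
proof -
  have l: "\<bar>lam * w\<bar> = lam * \<bar>w\<bar>" "max 0 (- (lam * w)) = lam * max 0 (- w)"
    "max 0 (lam * w) = lam * max 0 w"
    "max (- (lam * w)) (lam * w / 3) = lam * max (- w) (w / 3)"
    using assms(2) by (auto simp: abs_mult max_def mult_le_0_iff zero_le_mult_iff field_simps)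
  have p: "0 \<le> max (- w) (w / 3)" by (simp add: max_def)
  have s: "w / lam \<le> 0 \<longleftrightarrow> w \<le> 0" "0 \<le> w / lam \<longleftrightarrow> 0 \<le> w" "0 < w / lam \<longleftrightarrow> 0 < w" "w / lam < 0 \<longleftrightarrow> w < 0"
    using assms(2) by (auto simp: divide_le_0_iff zero_le_divide_iff divide_less_0_iff zero_less_divide_iff)
  have m: "m = 0 \<or> m = 1 \<or> m = 2 \<or> m = 3" using assms(1) by linarith
  have moebius0: "moebius lam 0 = 0" by (simp add: moebius_def)
  have g2: "cell_gauge 2 (1 + shrink (w / lam)) = moebius lam (cell_gauge 2 (1 + shrink w))"
  proof (cases "w \<le> 0")
    case True
    then show ?thesis using assms(2) by (simp add: cell_gauge_values s moebius_1)
  next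
    case False
    then have "0 < w" "0 < w / lam" using assms(2) by auto
    then show ?thesis using cell_gauge_values(10)[of w] cell_gauge_values(10)[of "w / lam"] moebius_frac[of lam "1 / w"] assms(2)
      by simp
  qed
  have g0: "cell_gauge 0 (1 + shrink (w / lam)) = moebius lam (cell_gauge 0 (1 + shrink w))"
  proof (cases "0 \<le> w")
    case True
    then show ?thesis using assms(2) by (simp add: cell_gauge_values s moebius_1)
  next
    case False
    then have "w < 0" "w / lam < 0" using assms(2) by (auto simp: divide_less_0_iff)
    then show ?thesis using cell_gauge_values(3)[of w] cell_gauge_values(3)[of "w / lam"] moebius_frac[of lam "1 / (- w)"] assms(2)
      by simp
  qed
  have c0: "cell_gauge m (0 + shrink (lam * w)) = moebius lam (cell_gauge m (0 + shrink w))"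
    using m
  proof (elim disjE)
    assume "m = 0" then show ?thesis using moebius_frac[of lam "\<bar>w\<bar>"] assms(2) by (simp only: cell_gauge_values l abs_ge_zero)
  next
    assume "m = 1" then show ?thesis using moebius_frac[of lam "max 0 (- w)"] assms(2) by (simp only: cell_gauge_values l max.cobounded1)
  qed (simp_all only: cell_gauge_values moebius_1[OF assms(2)])
  have c1: "cell_gauge m (1 + shrink (w / lam)) = moebius lam (cell_gauge m (1 + shrink w))"
    using m
  proof (elim disjE)
    assume "m = 1" then show ?thesis by (simp only: cell_gauge_values moebius0)
  next
    assume "m = 3" then show ?thesis by (simp only: cell_gauge_values(13) g2)
  qed (simp_all only: g0 g2)
  have c2: "cell_gauge m (2 + shrink (lam * w)) = moebius lam (cell_gauge m (2 + shrink w))"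
    using m
  proof (elim disjE)
    assume "m = 1" then show ?thesis using moebius_frac[of lam "max 0 w"] assms(2) by (simp only: cell_gauge_values l max.cobounded1)
  next
    assume "m = 2" then show ?thesis using moebius_frac[of lam "\<bar>w\<bar>"] assms(2) by (simp only: cell_gauge_values l abs_ge_zero)
  next
    assume "m = 3" then show ?thesis using moebius_frac[of lam "max (- w) (w / 3)"] assms(2) p by (simp only: cell_gauge_values l)
  qed (simp_all only: cell_gauge_values moebius_1[OF assms(2)])
  show ?thesis using assms(3) c0 c1 c2 unfolding weighted_def by auto
qed

lemma continuous_on_Max_image:
  fixes f :: "'i \<Rightarrow> 'a::topological_space \<Rightarrow> real"
  assumes "finite I" "I \<noteq> {}" "\<And>i. i \<in> I \<Longrightarrow> continuous_on A (f i)"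
  shows "continuous_on A (\<lambda>x. Max ((\<lambda>i. f i x) ` I))"
  using assms by (induction rule: finite_ne_induct) (auto intro!: continuous_intros)

lemma continuous_on_Min_image:
  fixes f :: "'i \<Rightarrow> 'a::topological_space \<Rightarrow> real"
  assumes "finite I" "I \<noteq> {}" "\<And>i. i \<in> I \<Longrightarrow> continuous_on A (f i)"
  shows "continuous_on A (\<lambda>x. Min ((\<lambda>i. f i x) ` I))"
  using assms by (induction rule: finite_ne_induct) (auto intro!: continuous_intros)

definition cube_gauge :: "nat \<Rightarrow> (nat \<Rightarrow> nat) set \<Rightarrow> (nat \<Rightarrow> real) \<Rightarrow> real" where
  "cube_gauge N S x = Min ((\<lambda>z. Max ((\<lambda>i. cell_gauge (z i) (x i)) ` {..<N})) ` S)"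

text \<open>A monotone map commutes with finite \<open>Min\<close> and \<open>Max\<close>, which
  carries homogeneity over from \<open>cell_gauge\<close> to \<open>cube_gauge\<close>. Clipping to
  [0,1] makes the map monotone on the whole line without changing it on actual gauge values.\<close>

lemma mono_moebius_clip: "0 < lam \<Longrightarrow> mono (\<lambda>t. moebius lam (max 0 (min 1 t)))"
proof (rule monoI)
  fix a b :: real assume lam: "0 < lam" and "a \<le> b"
  define s t where "s = max 0 (min 1 a)" and "t = max 0 (min 1 b)"
  have st: "0 \<le> s" "s \<le> t" "t \<le> 1" using \<open>a \<le> b\<close> by (auto simp: s_def t_def)
  have pos: "1 - u + lam * u > 0" if "0 \<le> u" "u \<le> 1" for u
    using that lam by (cases "u = 1") (auto intro!: add_pos_nonneg)
  have "lam * s * (1 - t + lam * t) \<le> lam * t * (1 - s + lam * s)"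
    using st lam by (simp add: algebra_simps)
  then have "moebius lam s \<le> moebius lam t"
    unfolding moebius_def using pos[of s] pos[of t] st by (simp add: divide_le_eq le_divide_eq mult.commute)
  then show "moebius lam (max 0 (min 1 a)) \<le> moebius lam (max 0 (min 1 b))" by (simp add: s_def t_def)
qed

lemma finite_cells: "finite (cells N)"
  by (simp add: cells_def finite_PiE)

lemma cells_le: "z \<in> cells N \<Longrightarrow> i < N \<Longrightarrow> z i \<le> 3"
  by (auto simp: cells_def)

context
  fixes N :: nat and S :: "(nat \<Rightarrow> nat) set"
  assumes N: "N \<ge> 1" and S: "S \<subseteq> cells N" "S \<noteq> {}"
begin

lemma cube_gauge_le_iff: "cube_gauge N S x \<le> a \<longleftrightarrow> (\<exists>z\<in>S. \<forall>i<N. cell_gauge (z i) (x i) \<le> a)"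
proof -
  have "finite S" using S finite_cells finite_subset by blast
  moreover have "{..<N} \<noteq> {}" using N by (auto simp: lessThan_empty_iff)
  ultimately show ?thesis unfolding cube_gauge_def using S by (subst Min_le_iff) auto
qed

lemma cube_gauge_nonneg: "0 \<le> cube_gauge N S x"
proof (rule ccontr)
  assume "\<not> 0 \<le> cube_gauge N S x"
  then obtain z where "z \<in> S" "\<forall>i<N. cell_gauge (z i) (x i) \<le> cube_gauge N S x"
    using cube_gauge_le_iff[of x "cube_gauge N S x"] by blast
  moreover have "0 \<le> cell_gauge (z 0) (x 0)" using cell_gauge_bounds cells_le S N \<open>z \<in> S\<close> by (metis less_eq_Suc_le One_nat_def subsetD)
  ultimately show False using \<open>\<not> 0 \<le> cube_gauge N S x\<close> N by force
qed

lemma cube_gauge_le_1: "cube_gauge N S x \<le> 1"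
  unfolding cube_gauge_le_iff using S cell_gauge_bounds cells_le by blast

lemma cube_gauge_homogeneous:
  assumes "0 < lam" "\<forall>i<N. c i \<in> {0, 1, 2}"
  shows "cube_gauge N S (point_at N c (\<lambda>i. weighted c i lam (W i))) = moebius lam (cube_gauge N S (point_at N c W))"
proof -
  define h where "h = (\<lambda>t. moebius lam (max 0 (min 1 t)))"
  have h: "mono h" unfolding h_def by (rule mono_moebius_clip[OF assms(1)])
  have h01: "h t = moebius lam t" if "0 \<le> t" "t \<le> 1" for t using that by (simp add: h_def)
  have fS: "finite S" using S finite_cells finite_subset by blast
  have ne: "{..<N} \<noteq> {}" using N by (auto simp: lessThan_empty_iff)
  have "Max ((\<lambda>i. cell_gauge (z i) (point_at N c (\<lambda>i. weighted c i lam (W i)) i)) ` {..<N})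
      = h (Max ((\<lambda>i. cell_gauge (z i) (point_at N c W i)) ` {..<N}))" if "z \<in> S" for z
  proof -
    have "cell_gauge (z i) (point_at N c (\<lambda>i. weighted c i lam (W i)) i) = h (cell_gauge (z i) (point_at N c W i))" if "i < N" for i
      using cell_gauge_homogeneous[OF _ assms(1), of "z i" c i] assms(2) that cells_le S \<open>z \<in> S\<close>
        cell_gauge_bounds[of "z i"] by (subst h01) (auto simp: point_at_def)
    then have "(\<lambda>i. cell_gauge (z i) (point_at N c (\<lambda>i. weighted c i lam (W i)) i)) ` {..<N} = h ` (\<lambda>i. cell_gauge (z i) (point_at N c W i)) ` {..<N}"
      by (auto simp: image_image)
    then show ?thesis using mono_Max_commute[OF h, of "(\<lambda>i. cell_gauge (z i) (point_at N c W i)) ` {..<N}"] ne by simp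
  qed
  then have "(\<lambda>z. Max ((\<lambda>i. cell_gauge (z i) (point_at N c (\<lambda>i. weighted c i lam (W i)) i)) ` {..<N})) ` S
     = h ` (\<lambda>z. Max ((\<lambda>i. cell_gauge (z i) (point_at N c W i)) ` {..<N})) ` S"
    by (auto simp: image_image)
  then have "cube_gauge N S (point_at N c (\<lambda>i. weighted c i lam (W i))) = h (cube_gauge N S (point_at N c W))"
    using mono_Min_commute[OF h, of "(\<lambda>z. Max ((\<lambda>i. cell_gauge (z i) (point_at N c W i)) ` {..<N})) ` S"] fS S
    by (simp add: cube_gauge_def)
  then show ?thesis using h01 cube_gauge_nonneg cube_gauge_le_1 by simp
qed

lemma continuous_on_cube_gauge: "continuous_on A (cube_gauge N S)"
proof -
  have "finite S" using S finite_cells finite_subset by blast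
  moreover have "{..<N} \<noteq> {}" using N by (auto simp: lessThan_empty_iff)
  ultimately show ?thesis unfolding cube_gauge_def using S
    by (intro continuous_on_Min_image continuous_on_Max_image continuous_on_cell_gauge)
      (auto intro: continuous_on_subset[OF continuous_on_product_coordinates])
qed

lemma cell_gauge_less_1:
  assumes "m \<le> 3" "cell_gauge m x < 1" shows "-1 < x" "x < 3"
proof -
  consider "m = 0" | "m = 1" | "m = 2" | "m = 3" using assms(1) by linarith
  then have "-1 < x \<and> x < 3"
  proof cases
    case 4
    have "\<not> 3 \<le> x" using assms(2) cell_gauge_3(3)[of x] 4 by auto
    moreover have "\<not> x \<le> 1" using assms(2) cell_gauge_3(1)[of x] 4 by auto
    ultimately show ?thesis by auto
  qed (use assms(2) in \<open>auto simp: cell_gauge_def min_less_iff_disj\<close>)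
  then show "-1 < x" "x < 3" by auto
qed

lemma gauge_domain_cube_gauge: "gauge_domain N (cube_gauge N S)"
proof
  show "1 \<le> N" by (rule N)
  show "continuous_on (real_seq N) (cube_gauge N S)" by (rule continuous_on_cube_gauge)
  show "0 \<le> cube_gauge N S x" "cube_gauge N S x \<le> 1" for x by (rule cube_gauge_nonneg, rule cube_gauge_le_1)
  show "cube_gauge N S (point_at N c (\<lambda>i. weighted c i lam (W i))) = moebius lam (cube_gauge N S (point_at N c W))"
    if "0 < lam" "\<forall>i<N. c i \<in> {0, 1, 2}" for c lam W
    by (rule cube_gauge_homogeneous[OF that])
  fix x i assume "cube_gauge N S x \<le> 1 / 2" "i < N"
  then obtain z where z: "z \<in> S" "cell_gauge (z i) (x i) \<le> 1/2" using cube_gauge_le_iff by blast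
  then have "z i \<le> 3" using cells_le S \<open>i < N\<close> by blast
  moreover have "cell_gauge (z i) (x i) < 1" using z by simp
  ultimately show "-1 < x i \<and> x i < 3" using cell_gauge_less_1 by blast
qed

end

text \<open>The coordinate around the fixed point 2 only reaches up to 3, so cell 3 is shrunk to \<open>[5/2, 11/4]\<close>.\<close>

definition compress :: "real \<Rightarrow> real" where "compress x = min x (x / 4 + 15/8)"
definition decompress :: "real \<Rightarrow> real" where "decompress x = max x (4 * x - 15/2)"

lemma compress_decompress: "compress (decompress x) = x" "decompress (compress x) = x"
proof -
  have k: "compress y = (if y \<le> 5/2 then y else y / 4 + 15/8)" "decompress y = (if y \<le> 5/2 then y else 4 * y - 15/2)" for y
    by (auto simp: compress_def decompress_def min_def max_def)
  show "compress (decompress x) = x" unfolding k by (auto simp: field_simps)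
  show "decompress (compress x) = x" unfolding k by (auto simp: field_simps)
qed

lemma compress_le_iff: "a \<le> 5/2 \<Longrightarrow> compress x \<le> a \<longleftrightarrow> x \<le> a" "a \<le> 5/2 \<Longrightarrow> a \<le> compress x \<longleftrightarrow> a \<le> x"
  by (auto simp: compress_def min_le_iff_disj)

text \<open>The value 1/2 corresponds to \<open>g = 1\<close>. In terms of \<open>x\<close> the set
  is [-1/2, 5/2] for cell 1, [3/2, 7/2] for cell 3, and the cell itself for 0 and 2.\<close>

lemma cell_gauge_compress_iff:
  assumes "m \<le> 3"
  shows "cell_gauge m (compress x) \<le> 1/2 \<longleftrightarrow> (\<exists>k\<le>3. zigzag_le k m \<and> \<bar>x - real k\<bar> \<le> 1/2)"
proof -
  have ex3: "(\<exists>k\<le>3. P k) \<longleftrightarrow> P 0 \<or> P 1 \<or> P 2 \<or> P (3::nat)" for P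
    by (auto simp: le_Suc_eq numeral_3_eq_3 numeral_2_eq_2)
  consider "m = 0" | "m = 1" | "m = 2" | "m = 3" using assms(1) by linarith
  then show ?thesis
  proof cases
    case 4
    consider "x \<le> 2" | "2 \<le> x" "x \<le> 5/2" | "5/2 \<le> x" "x \<le> 9/2" | "9/2 \<le> x" by linarith
    then show ?thesis
    proof cases
      case 3
      then have k: "compress x = x / 4 + 15/8" by (simp add: compress_def min_def)
      have "cell_gauge 3 (compress x) = (compress x - 2) / (3 - 2 * (compress x - 2))"
        by (rule cell_gauge_3(2)) (use 3 k in auto)
      moreover have "3 - 2 * (compress x - 2) > 0" using 3 k by simp
      ultimately have "cell_gauge 3 (compress x) \<le> 1/2 \<longleftrightarrow> x \<le> 7/2" unfolding k by (simp add: divide_le_eq) (auto simp: field_simps)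
      moreover have "\<bar>x - 3\<bar> \<le> 1/2 \<longleftrightarrow> x \<le> 7/2" "\<bar>x - 2\<bar> \<le> 1/2 \<longrightarrow> x \<le> 7/2"
        unfolding abs_le_iff using 3 by auto
      ultimately show ?thesis unfolding ex3 4 zigzag_le_def by auto
    next
      case 4
      then have "compress x \<ge> 3" by (simp add: compress_def min_def)
      then have "cell_gauge 3 (compress x) = 1" by (rule cell_gauge_3)
      then show ?thesis using 4 \<open>m = 3\<close> unfolding ex3 by (auto simp: zigzag_le_def abs_le_iff)
    next
      case 1
      then have k: "compress x = x" by (simp add: compress_def min_def)
      then show ?thesis using 1 \<open>m = 3\<close> unfolding ex3 by (auto simp: zigzag_le_def abs_le_iff cell_gauge_3 min_def)
    next
      case 2
      then have k: "compress x = x" by (simp add: compress_def min_def)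
      have "(x - 2) / (3 - 2 * (x - 2)) \<le> 1 / 2" using 2 by (simp add: divide_le_eq)
      then show ?thesis using 2 \<open>m = 3\<close> k unfolding ex3 by (auto simp: zigzag_le_def abs_le_iff cell_gauge_3)
    qed
  next
    case 1
    then have "cell_gauge m (compress x) \<le> 1/2 \<longleftrightarrow> compress x \<le> 1/2 \<and> -1/2 \<le> compress x" by (auto simp: cell_gauge_def min_le_iff_disj)
    also have "\<dots> \<longleftrightarrow> \<bar>x - real 0\<bar> \<le> 1/2"
      using compress_le_iff(1)[of "1/2" x] compress_le_iff(2)[of "-1/2" x] unfolding abs_le_iff by auto
    finally show ?thesis unfolding ex3 by (simp add: 1 zigzag_le_def)
  next
    case 2
    then have "cell_gauge m (compress x) \<le> 1/2 \<longleftrightarrow> compress x \<le> 5/2 \<and> -1/2 \<le> compress x"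
      unfolding cell_gauge_def by (simp only: refl if_True if_False one_neq_zero) arith
    also have "\<dots> \<longleftrightarrow> -1/2 \<le> x \<and> x \<le> 5/2"
      using compress_le_iff(1)[of "5/2" x] compress_le_iff(2)[of "-1/2" x] by auto
    also have "\<dots> \<longleftrightarrow> \<bar>x - real 0\<bar> \<le> 1/2 \<or> \<bar>x - real 1\<bar> \<le> 1/2 \<or> \<bar>x - real 2\<bar> \<le> 1/2"
      unfolding abs_le_iff by auto
    finally show ?thesis unfolding ex3 by (simp add: 2 zigzag_le_def disj_commute disj_left_commute)
  next
    case 3
    then have gam2: "cell_gauge m (compress x) = min 1 \<bar>compress x - 2\<bar>" by (simp add: cell_gauge_def)
    then have "cell_gauge m (compress x) \<le> 1/2 \<longleftrightarrow> compress x \<le> 5/2 \<and> 3/2 \<le> compress x"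
      using gam2 by arith
    also have "\<dots> \<longleftrightarrow> 3/2 \<le> x \<and> x \<le> 5/2"
      using compress_le_iff(1)[of "5/2" x] compress_le_iff(2)[of "3/2" x] by auto
    also have "\<dots> \<longleftrightarrow> \<bar>x - real 2\<bar> \<le> 1/2" unfolding abs_le_iff by auto
    finally show ?thesis unfolding ex3 by (simp add: 3 zigzag_le_def)
  qed
qed

text \<open>The sublevel set for one cell of \<open>S\<close> is the product of its coordinatewise
  sublevel sets, that is, the union of all cells that precede it. Down-closure says that these cells
  belong to \<open>S\<close> already.\<close>

lemma down_closed_polycube_iff:
  assumes N: "N \<ge> 1" and S: "S \<subseteq> cells N" "S \<noteq> {}" "down_closed N S" and x: "x \<in> real_seq N"
  shows "x \<in> polycube N S \<longleftrightarrow> cube_gauge N S (\<lambda>i. if i < N then compress (x i) else 0) \<le> 1/2"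
proof -
  have "x \<in> polycube N S \<longleftrightarrow> (\<exists>z\<in>S. \<forall>i<N. cell_gauge (z i) (compress (x i)) \<le> 1/2)"
  proof
    assume "x \<in> polycube N S"
    then obtain z where z: "z \<in> S" "\<forall>i<N. \<bar>x i - real (z i)\<bar> \<le> 1/2" by (auto simp: polycube_def)
    moreover have "z i \<le> 3" if "i < N" for i using z(1) S(1) cells_le that by blast
    moreover have "zigzag_le k k" for k by (simp add: zigzag_le_def)
    ultimately show "\<exists>z\<in>S. \<forall>i<N. cell_gauge (z i) (compress (x i)) \<le> 1/2"
      using cell_gauge_compress_iff by blast
  next
    assume "\<exists>z\<in>S. \<forall>i<N. cell_gauge (z i) (compress (x i)) \<le> 1/2"
    then obtain z where z: "z \<in> S" "\<And>i. i < N \<Longrightarrow> cell_gauge (z i) (compress (x i)) \<le> 1/2" by blast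
    have "\<forall>i. \<exists>k. i < N \<longrightarrow> k \<le> 3 \<and> zigzag_le k (z i) \<and> \<bar>x i - real k\<bar> \<le> 1/2"
      using cell_gauge_compress_iff z S(1) cells_le by blast
    from choice[OF this]
    obtain k where k: "\<And>i. i < N \<Longrightarrow> k i \<le> 3 \<and> zigzag_le (k i) (z i) \<and> \<bar>x i - real (k i)\<bar> \<le> 1/2"
      by blast
    have "restrict k {..<N} \<in> cells N" using k by (auto simp: cells_def)
    moreover have "\<forall>i<N. zigzag_le (restrict k {..<N} i) (z i)" using k by simp
    ultimately have "restrict k {..<N} \<in> S" using S(3) z(1) unfolding down_closed_def by blast
    moreover have "\<forall>i<N. \<bar>x i - real (restrict k {..<N} i)\<bar> \<le> 1/2" using k by simp
    ultimately show "x \<in> polycube N S" using x unfolding polycube_def by blast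
  qed
  also have "\<dots> \<longleftrightarrow> (\<exists>z\<in>S. \<forall>i<N. cell_gauge (z i) (if i < N then compress (x i) else 0) \<le> 1/2)" by auto
  finally show ?thesis by (simp only: cube_gauge_le_iff[OF N S(1,2)])
qed

theorem polycube_smooth_manifold:
  assumes N: "N \<ge> 1" and S: "S \<subseteq> cells N" "S \<noteq> {}" "down_closed N S"
  shows "\<exists>(M :: (nat \<Rightarrow> real) topology) A. smooth_manifold_with_boundary N M A \<and> compact_space M \<and>
    subtopology (Euclidean_space N) (polycube N S) homeomorphic_space M"
proof -
  interpret gauge_domain N "cube_gauge N S" by (rule gauge_domain_cube_gauge[OF N S(1,2)])
  let ?k = "\<lambda>x i. if i < N then compress (x i) else 0"
  let ?h = "\<lambda>x i. if i < N then decompress (x i) else 0"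
  have EP: "real_seq N \<inter> polycube N S = polycube N S" by (auto simp: polycube_def)
  have kh: "?k (?h x) = x" "?h (?k x) = x" if "x \<in> real_seq N" for x
    using that by (auto simp: compress_decompress fun_eq_iff)
  have E: "x \<in> real_seq N" if "x \<in> polycube N S" for x using that by (auto simp: polycube_def)
  have k1: "?k x \<in> K" if "x \<in> polycube N S" for x
    using that down_closed_polycube_iff[OF N S E[OF that]] by (simp add: K_def)
  have h1: "?h x \<in> polycube N S" if "x \<in> K" for x
  proof -
    have "x \<in> real_seq N" using that by (simp add: K_def)
    then show ?thesis using that kh(1)[of x] by (subst down_closed_polycube_iff[OF N S]) (auto simp: K_def)
  qed
  have c: "continuous_on A ?k" "continuous_on A ?h" for A
  proof -
    have "continuous_on A (\<lambda>x. ?k x i)" "continuous_on A (\<lambda>x. ?h x i)" for i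
      unfolding compress_def decompress_def
      by (cases "i < N"; auto intro!: continuous_intros continuous_on_subset[OF continuous_on_product_coordinates])+
    then show "continuous_on A ?k" "continuous_on A ?h"
      by (auto intro: continuous_on_coordinatewise_then_product)
  qed
  have "homeomorphic_maps (top_of_set (polycube N S)) (top_of_set K) ?k ?h"
    unfolding homeomorphic_maps_def using k1 h1 kh c E by (auto simp: K_def)
  then have "subtopology (Euclidean_space N) (polycube N S) homeomorphic_space top_of_set K"
    unfolding Euclidean_space_top_of_set subtopology_subtopology EP
    by (auto simp: homeomorphic_space_def)
  moreover have "compact_space (top_of_set K)"
    using compact_K by (simp add: compact_space_subtopology)
  ultimately show ?thesis using smooth_manifold_K by blast
qed

section \<open>Tilings of a cube by polycubes\<close>

definition affine_map :: "nat \<Rightarrow> (nat \<Rightarrow> real) \<Rightarrow> real \<Rightarrow> (nat \<Rightarrow> real) \<Rightarrow> nat \<Rightarrow> real" where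
  "affine_map N b s x = (\<lambda>i. if i < N then b i + s * x i else 0)"

lemma affine_map_in_real_seq: "affine_map N b s x \<in> real_seq N"
  by (simp add: affine_map_def)

lemma affine_map_affine_map: "affine_map N b s (affine_map N b' s' x) = affine_map N (\<lambda>i. b i + s * b' i) (s * s') x"
  by (auto simp: affine_map_def algebra_simps)

lemma affine_map_inverse:
  assumes "s \<noteq> 0" "x \<in> real_seq N"
  shows "affine_map N (\<lambda>i. - b i / s) (1 / s) (affine_map N b s x) = x" "affine_map N b s (affine_map N (\<lambda>i. - b i / s) (1 / s) x) = x"
  using assms by (auto simp: affine_map_def fun_eq_iff field_simps)

lemma similarity_affine_map:
  assumes "s \<noteq> 0"
  shows "similarity N \<bar>s\<bar> (affine_map N b s)"
  unfolding similarity_def topspace_Euclidean_space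
proof (intro conjI ballI)
  show "bij_betw (affine_map N b s) (real_seq N) (real_seq N)"
    by (rule bij_betw_byWitness[of _ "affine_map N (\<lambda>i. - b i / s) (1 / s)"])
      (use affine_map_inverse[OF assms] affine_map_in_real_seq in auto)
  fix x y
  have "L2_set (\<lambda>i. affine_map N b s x i - affine_map N b s y i) {..<N} = L2_set (\<lambda>i. \<bar>s\<bar> * (x i - y i)) {..<N}"
    unfolding L2_set_def by (intro arg_cong[where f = sqrt] sum.cong) (auto simp: affine_map_def power_mult_distrib simp flip: right_diff_distrib)
  also have "\<dots> = \<bar>s\<bar> * L2_set (\<lambda>i. x i - y i) {..<N}" by (rule L2_set_right_distrib[symmetric]) simp
  finally show "euclid_dist N (affine_map N b s x) (affine_map N b s y) = \<bar>s\<bar> * euclid_dist N x y"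
    by (simp add: euclid_dist_def)
qed (use assms in simp)

lemma isometric_affine_images:
  assumes "X \<subseteq> real_seq N" "\<bar>s\<bar> = \<bar>s'\<bar>" "s \<noteq> 0"
  shows "isometric N (affine_map N b s ` X) (affine_map N b' s' ` X)"
proof -
  define f where "f = affine_map N (\<lambda>i. b' i + s' * (- b i / s)) (s' * (1 / s))"
  have ff: "f (affine_map N b s x) = affine_map N b' s' x" if "x \<in> X" for x
    using affine_map_inverse(1)[OF assms(3), of x N b] assms(1) that
    unfolding f_def by (subst affine_map_affine_map[symmetric]) auto
  have "\<bar>s' * (1 / s)\<bar> = 1" using assms by (simp add: abs_mult)
  moreover have "s' * (1 / s) \<noteq> 0" using assms by auto
  ultimately have "similarity N 1 f" using similarity_affine_map unfolding f_def by metis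
  moreover have "f ` (affine_map N b s ` X) = affine_map N b' s' ` X" using ff by (auto simp: image_image)
  ultimately show ?thesis unfolding isometric_def by blast
qed

text \<open>A basic open box leaves uncountably many choices for each coordinate. It serves to avoid
  the walls of cubes when interiors are compared.\<close>

lemma open_generic_point:
  fixes W :: "(nat \<Rightarrow> real) set"
  assumes "open W" "x \<in> W" "x \<in> real_seq N" "countable C"
  obtains y where "y \<in> W" "y \<in> real_seq N" "\<And>i. i < N \<Longrightarrow> y i \<notin> C"
proof -
  have "openin (powertop_real UNIV) W" using assms(1) by (simp add: euclidean_product_topology)
  from product_topology_open_contains_basis[OF this assms(2)]
  obtain U where U: "\<And>i. openin euclideanreal (U i)" "x \<in> PiE UNIV U" "PiE UNIV U \<subseteq> W"
    by blast
  have "\<exists>t. t \<in> U i \<and> t \<notin> C" for i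
  proof -
    have "open (U i)" "x i \<in> U i" using U by (auto simp: PiE_UNIV_domain)
    then obtain r where "r > 0" "ball (x i) r \<subseteq> U i" using open_contains_ball by blast
    then have "uncountable (U i)"
      using uncountable_ball countable_subset by blast
    moreover have "countable (U i)" if "U i \<subseteq> C" using assms(4) that by (rule countable_subset[rotated])
    ultimately show ?thesis by blast
  qed
  then obtain t where t: "\<And>i. t i \<in> U i \<and> t i \<notin> C" by metis
  show thesis
  proof (rule that)
    have "(\<lambda>i. if i < N then t i else x i) \<in> PiE UNIV U"
      using t U(2) by (auto simp: PiE_UNIV_domain)
    then show "(\<lambda>i. if i < N then t i else x i) \<in> W" using U(3) by blast
  qed (use t assms(3) in auto)
qed

lemma polycube_interior:
  assumes "S \<noteq> {}"
  shows "Euclidean_space N interior_of (polycube N S) \<noteq> {}"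
proof -
  obtain z where z: "z \<in> S" using assms by blast
  define B where "B = (\<Inter>i\<in>{..<N}. {x::nat \<Rightarrow> real. \<bar>x i - real (z i)\<bar> < 1/2})"
  have "open {x::nat \<Rightarrow> real. \<bar>x i - real (z i)\<bar> < 1/2}" for i
    by (intro open_Collect_less continuous_intros continuous_on_product_coordinates)
  then have "open B" unfolding B_def by (intro open_INT) auto
  then have "openin (Euclidean_space N) (real_seq N \<inter> B)"
    by (simp add: Euclidean_space_top_of_set openin_open_Int)
  moreover have "real_seq N \<inter> B \<subseteq> polycube N S" using z by (force simp: B_def polycube_def)
  moreover have "(\<lambda>i. if i < N then real (z i) else 0) \<in> real_seq N \<inter> B" by (auto simp: B_def)
  ultimately show ?thesis unfolding interior_of_def by blast
qed

lemma countable_eighths: "countable {x::real. 8 * x \<in> \<int>}"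
proof -
  have "{x::real. 8 * x \<in> \<int>} = (\<lambda>k. k / 8) ` \<int>" 
    by (auto intro!: image_eqI[of x _ "8 * x" for x])
  moreover have "countable (\<int> :: real set)" unfolding Ints_def by (intro countable_image) simp
  ultimately show ?thesis by (metis countable_image)
qed

lemma near_nat_unique:
  assumes "\<bar>x - real a\<bar> \<le> 1/2" "\<bar>x - real b\<bar> \<le> 1/2" "2 * x \<notin> \<int>"
  shows "a = b"
proof (rule ccontr)
  assume "a \<noteq> b"
  then have "\<bar>real a - real b\<bar> \<ge> 1" by (cases "a < b") auto
  then have "x - real a = 1/2 \<or> x - real a = -1/2" using assms(1,2) by (auto simp: abs_if split: if_splits)
  then have "2 * x = of_int (2 * int a + 1) \<or> 2 * x = of_int (2 * int a - 1)" by auto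
  then show False using assms(3) Ints_of_int by metis
qed

lemma near_nat_exists:
  assumes "-1/2 \<le> x" "x \<le> 7/2"
  obtains k where "k \<le> 3" "\<bar>x - real k\<bar> \<le> 1/2"
proof -
  consider "x \<le> 1/2" | "1/2 \<le> x" "x \<le> 3/2" | "3/2 \<le> x" "x \<le> 5/2" | "5/2 \<le> x" by linarith
  then show thesis
  proof cases
    case 1
    then have "\<bar>x - real 0\<bar> \<le> 1/2" unfolding abs_le_iff using assms by simp
    then show ?thesis using that[of 0] by simp
  next
    case 2
    then have "\<bar>x - real 1\<bar> \<le> 1/2" unfolding abs_le_iff by simp
    then show ?thesis using that[of 1] by simp
  next
    case 3
    then have "\<bar>x - real 2\<bar> \<le> 1/2" unfolding abs_le_iff by simp
    then show ?thesis using that[of 2] by simp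
  next
    case 4
    then have "\<bar>x - real 3\<bar> \<le> 1/2" unfolding abs_le_iff using assms by simp
    then show ?thesis using that[of 3] by simp
  qed
qed

lemma abs_quarter_diff_le: "-1/2 \<le> v \<Longrightarrow> v \<le> 7/2 \<Longrightarrow> \<bar>c + (v - 3/2) / 4 - c\<bar> \<le> 1/2" for c v :: real
  unfolding abs_le_iff by simp

text \<open>The scaled copies of the polycube assemble to a cube of side 4, and each unit cube of the
  polycube is a scaled copy of that cube.\<close>

theorem rep_tile_polycube:
  fixes T :: "'t set" and e :: "'t \<Rightarrow> real" and a :: "'t \<Rightarrow> nat \<Rightarrow> int"
    and th :: "'t \<Rightarrow> (nat \<Rightarrow> nat) \<Rightarrow> nat \<Rightarrow> nat"
  assumes S: "S \<subseteq> cells N" "S \<noteq> {}"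
    and T: "finite T" "card T \<ge> 2"
    and e: "\<And>t. t \<in> T \<Longrightarrow> e t = 1 \<or> e t = -1"
    and th: "\<And>t z. t \<in> T \<Longrightarrow> z \<in> S \<Longrightarrow> th t z \<in> cells N"
      "\<And>t z i. t \<in> T \<Longrightarrow> z \<in> S \<Longrightarrow> i < N \<Longrightarrow> real (th t z i) = e t * real (z i) + a t i"
    and cover: "\<And>c. c \<in> cells N \<Longrightarrow> \<exists>t\<in>T. \<exists>z\<in>S. th t z = c"
    and unique: "\<And>t t' z z'. t \<in> T \<Longrightarrow> t' \<in> T \<Longrightarrow> z \<in> S \<Longrightarrow> z' \<in> S \<Longrightarrow> th t z = th t' z' \<Longrightarrow> t = t'"
  shows "rep_tile N (polycube N S)"
proof -
  let ?X = "polycube N S"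
  \<comment> \<open>The cube of side 4 made up of all cells is [-1/2, 7/2] in each coordinate, with
    center 3/2. Copy \<open>t\<close> inside it is shrunk by 4 about this center and moved to the
    unit cube \<open>c\<close>.\<close>
  define F where "F = (\<lambda>(c, t). affine_map N (\<lambda>i. real (c i) + (a t i - 3/2) / 4) (e t / 4))"
  have F: "F (c, t) x i = real (c i) + (e t * x i + a t i - 3/2) / 4" if "i < N" for c t x i
    using that by (simp add: F_def affine_map_def field_simps)
  have FE: "F p x \<in> real_seq N" for p x by (cases p) (simp add: F_def affine_map_in_real_seq[simplified])
  have finS: "finite S" using S finite_cells finite_subset by blast
  have XE: "?X \<subseteq> real_seq N" by (auto simp: polycube_def)
  have locate: "\<exists>z\<in>S. (\<forall>i<N. \<bar>e t * x i + a t i - real (th t z i)\<bar> \<le> 1/2)"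
    if xt: "x \<in> ?X" "t \<in> T" for x t
  proof -
    obtain z where z: "z \<in> S" "\<forall>i<N. \<bar>x i - real (z i)\<bar> \<le> 1/2"
      using xt unfolding polycube_def by blast
    have "\<bar>e t * x i + a t i - real (th t z i)\<bar> = \<bar>x i - real (z i)\<bar>" if "i < N" for i
      using th(2)[OF \<open>t \<in> T\<close> z(1) that] e[OF \<open>t \<in> T\<close>] by (auto simp: abs_minus_commute)
    then show ?thesis using z by (intro bexI[of _ z]) (simp_all del: of_nat_le_iff)
  qed
  have in_cube: "\<bar>F (c, t) x i - real (c i)\<bar> \<le> 1/2" if xt: "x \<in> ?X" "t \<in> T" "i < N" for c t x i
  proof -
    obtain z where z: "z \<in> S" "\<bar>e t * x i + a t i - real (th t z i)\<bar> \<le> 1/2"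
      using locate[OF xt(1,2)] xt(3) by blast
    have "th t z i \<le> 3" using th(1)[OF xt(2) z(1)] xt(3) cells_le by blast
    then have "real (th t z i) \<le> 3" by simp
    then have "-1/2 \<le> e t * x i + a t i" "e t * x i + a t i \<le> 7/2"
      using z(2) unfolding abs_le_iff by linarith+
    then show ?thesis unfolding F[OF xt(3)] by (rule abs_quarter_diff_le)
  qed
  have union: "?X = (\<Union>p\<in>S \<times> T. F p ` ?X)"
  proof (intro equalityI subsetI)
    fix x assume x: "x \<in> ?X"
    then obtain c where c: "c \<in> S" "\<forall>i<N. \<bar>x i - real (c i)\<bar> \<le> 1/2"
      unfolding polycube_def by blast
    \<comment> \<open>Coordinates of \<open>x\<close> after blowing up the unit cube
      \<open>c\<close> to the cube of side 4.\<close>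
    define u where "u i = 4 * (x i - real (c i)) + 3/2" for i
    have "\<exists>k. i < N \<longrightarrow> k \<le> 3 \<and> \<bar>u i - real k\<bar> \<le> 1/2" for i
    proof (cases "i < N")
      case True
      then have "\<bar>x i - real (c i)\<bar> \<le> 1/2" using c(2) by blast
      then have "-1/2 \<le> u i" "u i \<le> 7/2" unfolding u_def abs_le_iff by auto
      then show ?thesis using near_nat_exists by metis
    qed simp
    then obtain k where k: "\<And>i. i < N \<Longrightarrow> k i \<le> 3 \<and> \<bar>u i - real (k i)\<bar> \<le> 1/2" by metis
    have "restrict k {..<N} \<in> cells N" using k by (auto simp: cells_def)
    then obtain t z where tz: "t \<in> T" "z \<in> S" "th t z = restrict k {..<N}" using cover by blast
    define y where "y i = (if i < N then e t * (u i - a t i) else 0)" for i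
    have "\<bar>y i - real (z i)\<bar> \<le> 1/2" if "i < N" for i
    proof -
      have "real (k i) = e t * real (z i) + a t i" using th(2)[OF tz(1,2) that] tz(3) that by simp
      then have "\<bar>y i - real (z i)\<bar> = \<bar>u i - real (k i)\<bar>"
        using e[OF tz(1)] that by (auto simp: y_def abs_minus_commute algebra_simps)
      then show ?thesis using k[OF that] by simp
    qed
    then have "y \<in> ?X" using tz by (auto simp: polycube_def y_def)
    moreover have "F (c, t) y = x"
    proof
      fix i
      show "F (c, t) y i = x i"
      proof (cases "i < N")
        case True
        then have "e t * y i = u i - a t i" using e[OF tz(1)] by (auto simp: y_def)
        then show ?thesis unfolding F[OF True] by (simp add: u_def diff_divide_distrib)
      next
        case False
        then show ?thesis using FE[of "(c, t)" y] XE x by auto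
      qed
    qed
    ultimately show "x \<in> (\<Union>p\<in>S \<times> T. F p ` ?X)" using c tz by blast
  next
    fix x assume "x \<in> (\<Union>p\<in>S \<times> T. F p ` ?X)"
    then obtain c t y where "c \<in> S" "t \<in> T" "y \<in> ?X" "x = F (c, t) y" by auto
    then show "x \<in> ?X" using in_cube[of y t _ c] FE[of "(c, t)" y] by (auto simp: polycube_def)
  qed
  have disj: "Euclidean_space N interior_of (F p ` ?X) \<inter> Euclidean_space N interior_of (F q ` ?X) = {}"
    if p: "p \<in> S \<times> T" and q: "q \<in> S \<times> T" and "p \<noteq> q" for p q
  proof (rule ccontr)
    assume "\<not> ?thesis"
    then obtain x where x: "x \<in> Euclidean_space N interior_of (F p ` ?X) \<inter> Euclidean_space N interior_of (F q ` ?X)"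
      by blast
    have "openin (Euclidean_space N) (Euclidean_space N interior_of (F p ` ?X) \<inter> Euclidean_space N interior_of (F q ` ?X))"
      by (intro openin_Int) auto
    then obtain W where W: "open W"
      "Euclidean_space N interior_of (F p ` ?X) \<inter> Euclidean_space N interior_of (F q ` ?X) = real_seq N \<inter> W"
      unfolding Euclidean_space_top_of_set openin_open by blast
    \<comment> \<open>Walls between unit cubes have half-integral coordinates, and walls between
      their sub-cubes of side 1/4 have coordinates in the eighths of integers. Off both, the cube
      \<open>c\<close> and the cell inside it are determined by \<open>y\<close>.\<close>
    obtain y where y: "y \<in> W" "y \<in> real_seq N" "\<And>i. i < N \<Longrightarrow> y i \<notin> {x. 8 * x \<in> \<int>}"
      using open_generic_point[OF W(1) _ _ countable_eighths] x W(2) by blast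
    then have yI: "y \<in> Euclidean_space N interior_of (F p ` ?X) \<inter> Euclidean_space N interior_of (F q ` ?X)"
      unfolding W(2) by blast
    have "y \<in> F p ` ?X" by (rule subsetD[OF interior_of_subset IntD1[OF yI]])
    moreover have "y \<in> F q ` ?X" by (rule subsetD[OF interior_of_subset IntD2[OF yI]])
    ultimately obtain u v where uv: "u \<in> ?X" "y = F p u" "v \<in> ?X" "y = F q v" by (elim imageE)
    obtain c t c' t' where pq: "p = (c, t)" "q = (c', t')" by (cases p, cases q)
    have mem: "c \<in> S" "t \<in> T" "c' \<in> S" "t' \<in> T" using p q pq by auto
    have y2: "2 * y i \<notin> \<int>" if "i < N" for i
      using y(3)[OF that] Ints_mult[of 4 "2 * y i"] by (auto simp: mult.assoc[symmetric])
    have cc: "c i = c' i" if "i < N" for i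
      using in_cube[OF uv(1) mem(2) that, of c] in_cube[OF uv(3) mem(4) that, of c'] uv pq y2[OF that]
      by (intro near_nat_unique[of "y i"]) auto
    moreover have "c \<in> {..<N} \<rightarrow>\<^sub>E {..3}" "c' \<in> {..<N} \<rightarrow>\<^sub>E {..3}"
      using mem S by (auto simp: cells_def)
    ultimately have "c = c'" by (auto intro: PiE_ext)
    obtain z where z: "z \<in> S" "\<forall>i<N. \<bar>e t * u i + a t i - real (th t z i)\<bar> \<le> 1/2"
      using locate[OF uv(1) mem(2)] by blast
    obtain z' where z': "z' \<in> S" "\<forall>i<N. \<bar>e t' * v i + a t' i - real (th t' z' i)\<bar> \<le> 1/2"
      using locate[OF uv(3) mem(4)] by blast
    have "th t z i = th t' z' i" if i: "i < N" for i
    proof -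
      define w where "w = 4 * (y i - real (c i)) + 3/2"
      have "y i = real (c i) + (e t * u i + a t i - 3 / 2) / 4" "y i = real (c i) + (e t' * v i + a t' i - 3 / 2) / 4"
        using uv(2,4) F[OF i, of c t u] F[OF i, of c t' v] pq \<open>c = c'\<close> by simp_all
      then have w: "e t * u i + a t i = w" "e t' * v i + a t' i = w"
        unfolding w_def by (simp_all add: field_simps)
      have "\<bar>w - real (th t z i)\<bar> \<le> 1/2" "\<bar>w - real (th t' z' i)\<bar> \<le> 1/2"
        using z(2)[rule_format, OF i] z'(2)[rule_format, OF i] unfolding w by simp_all
      moreover have "2 * w \<notin> \<int>"
      proof
        assume "2 * w \<in> \<int>"
        then obtain m where "2 * w = of_int m" by (elim Ints_cases)
        then have "8 * y i = of_int (m + 8 * int (c i) - 3)" by (simp add: w_def)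
        then have "8 * y i \<in> \<int>" by (metis Ints_of_int)
        then show False using y(3)[OF i] by simp
      qed
      ultimately show ?thesis by (rule near_nat_unique)
    qed
    then have "th t z = th t' z'"
      using th(1)[OF mem(2) z(1)] th(1)[OF mem(4) z'(1)] unfolding cells_def by (auto intro: PiE_ext)
    then have "t = t'" using unique mem z z' by blast
    then show False using \<open>p \<noteq> q\<close> pq \<open>c = c'\<close> by simp
  qed
  define k where "k = card (S \<times> T)"
  have "card S \<ge> 1" using finS S(2) by (simp add: Suc_leI card_gt_0_iff)
  then have k2: "k \<ge> 2" using T(2) mult_le_mono[of 1 "card S" 2 "card T"] by (simp add: k_def card_cartesian_product)
  obtain \<beta> where \<beta>: "bij_betw \<beta> {1..k} (S \<times> T)"
    using ex_bij_betw_nat_finite_1[of "S \<times> T"] finS T(1) by (auto simp: k_def)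
  have \<beta>': "\<beta> i \<in> S \<times> T" if "i \<in> {1..k}" for i using bij_betw_apply[OF \<beta> that] .
  have sl: "\<exists>b s. F p = affine_map N b s \<and> \<bar>s\<bar> = 1/4" if p: "p \<in> S \<times> T" for p
  proof -
    obtain c t where "p = (c, t)" "t \<in> T" using p by auto
    then have "F p = affine_map N (\<lambda>i. real (c i) + (a t i - 3/2) / 4) (e t / 4)" "\<bar>e t / 4\<bar> = 1/4"
      using e[of t] by (auto simp: F_def)
    then show ?thesis by blast
  qed
  show ?thesis
    unfolding rep_tile_def topspace_Euclidean_space
  proof (intro conjI exI[of _ k] exI[of _ "\<lambda>i. F (\<beta> i) ` ?X"] ballI impI)
    show "?X \<subseteq> real_seq N" by (rule XE)
    show "Euclidean_space N interior_of ?X \<noteq> {}" by (rule polycube_interior[OF S(2)])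
    show "2 \<le> k" by (rule k2)
    have "(\<Union>i\<in>{1..k}. F (\<beta> i) ` ?X) = (\<Union>p\<in>\<beta> ` {1..k}. F p ` ?X)" by (simp add: image_image)
    also have "\<dots> = ?X" using union \<beta> by (simp add: bij_betw_def)
    finally show "?X = (\<Union>i\<in>{1..k}. F (\<beta> i) ` ?X)" by simp
  next
    fix i j assume ij: "i \<in> {1..k}" "j \<in> {1..k}"
    obtain b s b' s' where "F (\<beta> i) = affine_map N b s" "\<bar>s\<bar> = 1/4" "F (\<beta> j) = affine_map N b' s'" "\<bar>s'\<bar> = 1/4"
      using sl[OF \<beta>'[OF ij(1)]] sl[OF \<beta>'[OF ij(2)]] by blast
    then show "isometric N (F (\<beta> i) ` ?X) (F (\<beta> j) ` ?X)"
      using isometric_affine_images[OF XE, of s s' b b'] by auto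
    show "Euclidean_space N interior_of F (\<beta> i) ` ?X \<inter> Euclidean_space N interior_of F (\<beta> j) ` ?X = {}" if "i \<noteq> j"
    proof (rule disj[OF \<beta>'[OF ij(1)] \<beta>'[OF ij(2)]])
      show "\<beta> i \<noteq> \<beta> j" using \<beta> ij that by (auto simp: bij_betw_def dest: inj_onD)
    qed
  next
    fix i assume "i \<in> {1..k}"
    then obtain b s where "F (\<beta> i) = affine_map N b s" "\<bar>s\<bar> = 1/4" using sl[OF \<beta>'] by blast
    then show "similar N ?X (F (\<beta> i) ` ?X)"
      unfolding similar_def using similarity_affine_map[of s N b] by fastforce
  qed
qed

section \<open>Plates with plugs and their four placings\<close>

lemma zigzag_le_refl [simp]: "zigzag_le k k"
  by (simp add: zigzag_le_def)

text \<open>Because the reflection reverses the order, the reflected complement of a down-closed set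
  is down-closed again; this makes plugs admissible.\<close>

lemma zigzag_le_reflect: "zigzag_le k m \<Longrightarrow> zigzag_le (3 - m) (3 - k)"
  by (auto simp: zigzag_le_def)

text \<open>A plate \<open>P\<close> with plugs on top: its copy reflected in the center of the box fills the holes.\<close>

definition plugged :: "nat \<Rightarrow> ((nat \<Rightarrow> nat) \<Rightarrow> bool) \<Rightarrow> (nat \<Rightarrow> nat) set" where
  "plugged d P = {z \<in> cells (Suc d). z d = 2 \<and> P z \<or> z d = 3 \<and> \<not> P (\<lambda>j. 3 - z j)}"

text \<open>The first flag reflects in the center of the box of layers 2 and 3, whence 5 in the last
  coordinate; the second moves this box down to layers 0 and 1. On \<open>plugged\<close> cells no
  subtraction is truncated, as the last coordinate is 2 or 3 and the others are at most 3.\<close>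

definition placing :: "nat \<Rightarrow> bool \<times> bool \<Rightarrow> (nat \<Rightarrow> nat) \<Rightarrow> nat \<Rightarrow> nat" where
  "placing d t z = (\<lambda>i\<in>{..<Suc d}.
     (if fst t then (if i = d then 5 else 3) - z i else z i) - (if snd t \<and> i = d then 2 else 0))"

text \<open>The assumption \<open>reflect\<close> says that no hole is reflected to a hole. Hence
  below every plug there is a cell of the plate.\<close>

context
  fixes d :: nat and P :: "(nat \<Rightarrow> nat) \<Rightarrow> bool"
  assumes down: "\<And>z z'. P z \<Longrightarrow> (\<And>i. i < d \<Longrightarrow> zigzag_le (z' i) (z i)) \<Longrightarrow> P z'"
    and reflect: "\<And>z. (\<And>i. i < d \<Longrightarrow> z i \<le> 3) \<Longrightarrow> P z \<or> P (\<lambda>j. 3 - z j)"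
begin

lemma P_cong: "(\<And>i. i < d \<Longrightarrow> z i = z' i) \<Longrightarrow> P z \<longleftrightarrow> P z'"
  using down[of z z'] down[of z' z] by auto

text \<open>A plug cell has predecessors in both layers. Those in layer 2 lie in the plate, because
  the plug stands on the plate; those in layer 3 are plugs again, because reflection reverses the
  order.\<close>

lemma down_closed_plugged: "down_closed (Suc d) (plugged d P)"
  unfolding down_closed_def
proof (intro ballI impI)
  fix z z' assume z: "z \<in> plugged d P" and z': "z' \<in> cells (Suc d)"
    and b: "\<forall>i<Suc d. zigzag_le (z' i) (z i)"
  have zc: "z i \<le> 3" if "i < d" for i using z that cells_le[of z "Suc d" i] by (simp add: plugged_def)
  consider "z d = 2" "P z" | "z d = 3" "\<not> P (\<lambda>j. 3 - z j)" using z by (auto simp: plugged_def)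
  then show "z' \<in> plugged d P"
  proof cases
    case 1
    then have "z' d = 2" using b by (auto simp: zigzag_le_def)
    moreover have "P z'" using down[OF 1(2)] b by simp
    ultimately show ?thesis using z' by (simp add: plugged_def)
  next
    case 2
    then have "P z" using reflect zc by blast
    then have "P z'" by (rule down) (use b in simp)
    moreover have "\<not> P (\<lambda>j. 3 - z' j)"
    proof
      assume "P (\<lambda>j. 3 - z' j)"
      then have "P (\<lambda>j. 3 - z j)" by (rule down) (use b in \<open>simp add: zigzag_le_reflect\<close>)
      with 2 show False by simp
    qed
    moreover have "z' d = 3 \<or> z' d = 2" using b 2 by (auto simp: zigzag_le_def)
    ultimately show ?thesis using z' by (auto simp: plugged_def)
  qed
qed

lemma plugged_last: "z \<in> plugged d P \<Longrightarrow> z d = 2 \<or> z d = 3"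
  by (auto simp: plugged_def)

lemma placing_nth:
  assumes "z \<in> plugged d P" "i < Suc d"
  shows "placing d t z i \<le> 3"
    and "int (placing d t z i) = (if fst t then -1 else 1) * int (z i) +
       ((if fst t then (if i = d then 5 else 3) else 0) - (if snd t \<and> i = d then 2 else 0))"
proof -
  have "z i \<le> 3" using assms cells_le[of z "Suc d" i] by (simp add: plugged_def)
  then show "placing d t z i \<le> 3" "int (placing d t z i) = (if fst t then -1 else 1) * int (z i) +
       ((if fst t then (if i = d then 5 else 3) else 0) - (if snd t \<and> i = d then 2 else 0))"
    using assms(2) plugged_last[OF assms(1)] by (auto simp: placing_def)
qed

lemma placing_last: "z \<in> plugged d P \<Longrightarrow> placing d t z d < 2 \<longleftrightarrow> snd t"
  using plugged_last[of z] by (auto simp: placing_def)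

text \<open>In layer 2 membership of a cell is \<open>P\<close>, while membership of its mirror
  image in layer 3 is the negation of \<open>P\<close> at that same cell. So of a cell and its
  mirror image at least one belongs to the tile.\<close>

lemma placing_cover:
  assumes "c \<in> cells (Suc d)"
  shows "\<exists>t\<in>UNIV. \<exists>z\<in>plugged d P. placing d t z = c"
proof -
  have c3: "c i \<le> 3" if "i < Suc d" for i using assms that by (rule cells_le)
  \<comment> \<open>Lifting to layers 2 and 3 disposes of the shift; only the choice between the
    tile and its reflection remains.\<close>
  define c' where "c' = c(d := if c d < 2 then c d + 2 else c d)"
  have c': "c' \<in> cells (Suc d)" using assms c3[of d] by (auto simp: c'_def cells_def PiE_iff extensional_def)
  have cd: "c' d = 2 \<or> c' d = 3" using c3[of d] by (auto simp: c'_def)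
  have c'3: "c' i \<le> 3" if "i < Suc d" for i using c' that by (rule cells_le)
  have cx: "c i = undefined" if "\<not> i < Suc d" for i using assms that by (auto simp: cells_def PiE_iff extensional_def)
  show ?thesis
  proof (cases "c' \<in> plugged d P")
    case True
    have "placing d (False, c d < 2) c' = c"
      using cx by (auto simp: placing_def c'_def fun_eq_iff)
    then show ?thesis using True by blast
  next
    case False
    define z where "z = (\<lambda>i\<in>{..<Suc d}. (if i = d then 5 else 3) - c' i)"
    have "z \<in> cells (Suc d)" using cd by (auto simp: z_def cells_def)
    moreover have "P z \<longleftrightarrow> P (\<lambda>j. 3 - c' j)" by (rule P_cong) (simp add: z_def)
    moreover have "P (\<lambda>j. 3 - z j) \<longleftrightarrow> P c'" by (rule P_cong) (use c'3 in \<open>simp add: z_def\<close>)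
    ultimately have "z \<in> plugged d P" using cd False c' by (auto simp: plugged_def z_def)
    moreover have "placing d (True, c d < 2) z = c"
    proof
      fix i
      show "placing d (True, c d < 2) z i = c i"
        using cx[of i] c3[of i] by (auto simp: placing_def z_def c'_def)
    qed
    ultimately show ?thesis by blast
  qed
qed

text \<open>Of the two cells one is in layer 2 and the other in layer 3. The first requires
  \<open>P\<close> and the second forbids it at the same place.\<close>

lemma plugged_disjoint_reflection:
  assumes "z \<in> plugged d P" "z' \<in> plugged d P" "\<And>i. i < d \<Longrightarrow> z i + z' i = 3" "z d + z' d = 5"
  shows False
proof -
  have "P (\<lambda>j. 3 - z' j) \<longleftrightarrow> P z" by (rule P_cong) (use assms(3) in \<open>force\<close>)
  moreover have "P (\<lambda>j. 3 - z j) \<longleftrightarrow> P z'" by (rule P_cong) (use assms(3) in \<open>force\<close>)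
  ultimately show False using assms(1,2,4) by (auto simp: plugged_def)
qed

lemma placing_unique:
  assumes z: "z \<in> plugged d P" "z' \<in> plugged d P" and eq: "placing d t z = placing d t' z'"
  shows "t = t'"
proof -
  \<comment> \<open>Shifted copies occupy layers 0 and 1, unshifted ones layers 2 and 3.\<close>
  have s: "snd t = snd t'" using placing_last[OF z(1), of t] placing_last[OF z(2), of t'] eq by simp
  have *: "(if fst t then -1 else 1) * int (z i) + (if fst t then (if i = d then 5 else 3) else 0) =
      (if fst t' then -1 else 1) * int (z' i) + (if fst t' then (if i = d then 5 else 3) else 0)"
    if "i < Suc d" for i
    using placing_nth(2)[OF z(1) that, of t] placing_nth(2)[OF z(2) that, of t'] eq s by simp
  have "fst t = fst t'"
  proof (rule ccontr)
    assume ne: "fst t \<noteq> fst t'"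
    have "z i + z' i = 3" if "i < d" for i using *[of i] that ne by (auto split: if_splits)
    moreover have "z d + z' d = 5" using *[of d] ne by (auto split: if_splits)
    ultimately show False using plugged_disjoint_reflection[OF z] by blast
  qed
  with s show ?thesis by (simp add: prod_eq_iff)
qed

lemma plugged_nonempty: "P z \<Longrightarrow> (\<And>i. i < d \<Longrightarrow> z i \<le> 3) \<Longrightarrow> plugged d P \<noteq> {}"
proof -
  assume "P z" "\<And>i. i < d \<Longrightarrow> z i \<le> 3"
  then have "(\<lambda>i\<in>{..<Suc d}. if i = d then 2 else z i) \<in> plugged d P"
    using P_cong[of "\<lambda>i\<in>{..<Suc d}. if i = d then 2 else z i" z] by (auto simp: plugged_def cells_def)
  then show ?thesis by blast
qed

theorem dim_rep_tile_plugged: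
  assumes "P z" "\<And>i. i < d \<Longrightarrow> z i \<le> 3"
  shows "dim_rep_tile (Suc d) (polycube (Suc d) (plugged d P))"
proof -
  have sub: "plugged d P \<subseteq> cells (Suc d)" by (auto simp: plugged_def)
  note ne = plugged_nonempty[OF assms]
  have "rep_tile (Suc d) (polycube (Suc d) (plugged d P))"
  proof (rule rep_tile_polycube[where T = UNIV and th = "placing d" and e = "\<lambda>t. if fst t then -1 else 1"
        and a = "\<lambda>t i. (if fst t then (if i = d then 5 else 3) else 0) - (if snd t \<and> i = d then 2 else 0)"])
    show "placing d t z \<in> cells (Suc d)" if "z \<in> plugged d P" for t z
      using placing_nth(1)[OF that] by (auto simp: cells_def placing_def)
    show "real (placing d t z i) = (if fst t then -1 else 1) * real (z i) +
      real_of_int ((if fst t then (if i = d then 5 else 3) else 0) - (if snd t \<and> i = d then 2 else 0))"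
      if "z \<in> plugged d P" "i < Suc d" for t z i
      using arg_cong[OF placing_nth(2)[OF that, of t], of real_of_int] by (simp split: if_splits)
    show "2 \<le> card (UNIV :: (bool \<times> bool) set)" by (simp add: card_prod)
  qed (use sub ne placing_cover placing_unique in auto)
  then show ?thesis
    unfolding dim_rep_tile_def
    using polycube_smooth_manifold[OF _ sub ne down_closed_plugged] by simp
qed

end

section \<open>A tile homotopy equivalent to a wedge of spheres\<close>

lemma homotopic_with_straight_line:
  fixes f g :: "'a::topological_space \<Rightarrow> nat \<Rightarrow> real"
  assumes f: "continuous_on X f" and g: "continuous_on X g"
    and seg: "\<And>x t. x \<in> X \<Longrightarrow> 0 \<le> t \<Longrightarrow> t \<le> 1 \<Longrightarrow> (\<lambda>i. (1 - t) * f x i + t * g x i) \<in> Y"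
  shows "homotopic_with_canon (\<lambda>_. True) X Y f g"
proof -
  let ?h = "\<lambda>p i. (1 - fst p) * f (snd p) i + fst p * g (snd p) i"
  have coord: "continuous_on ({0..1::real} \<times> X) (\<lambda>p. u (snd p) i)"
    if "continuous_on X u" for u :: "'a \<Rightarrow> nat \<Rightarrow> real" and i
  proof -
    have "continuous_on ({0..1} \<times> X) (\<lambda>p. u (snd p))"
      by (rule continuous_on_compose2[OF that continuous_on_snd[OF continuous_on_id]]) auto
    then show ?thesis by (rule continuous_on_product_then_coordinatewise)
  qed
  have "continuous_on ({0..1} \<times> X) ?h"
    by (rule continuous_on_coordinatewise_then_product)
      (intro continuous_on_add continuous_on_mult continuous_on_diff continuous_on_const
        continuous_on_fst continuous_on_id coord f g)
  moreover have "?h \<in> {0..1} \<times> X \<rightarrow> Y" using seg by auto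
  ultimately have "continuous_map (top_of_set ({0..1} \<times> X)) (top_of_set Y) ?h" by simp
  then show ?thesis
    unfolding homotopic_with_def by (intro exI[of _ ?h]) simp
qed

text \<open>Flattens cell 0 to the point 0 and cell 2 to the point 2, and stretches cell 1 over
  [0,2]; applied coordinatewise it collapses the thickened cube boundary onto the boundary
  itself.\<close>

definition squash :: "real \<Rightarrow> real" where "squash x = max 0 (min 2 (2 * x - 1))"
text \<open>A cut-off between the top 1/2 of the thickened wedge and the bottom 3/2 of the
  box.\<close>

definition fade :: "real \<Rightarrow> real" where "fade s = max 0 (min 1 (3/2 - s))"

lemma squash_simps:
  "x \<le> 1/2 \<Longrightarrow> squash x = 0" "3/2 \<le> x \<Longrightarrow> squash x = 2" "0 \<le> squash x" "squash x \<le> 2"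
  by (auto simp: squash_def)

lemma fade_simps: "s \<le> 1/2 \<Longrightarrow> fade s = 1" "3/2 \<le> s \<Longrightarrow> fade s = 0"
  by (auto simp: fade_def)

lemma segment_bounds:
  fixes a b t lo hi :: real
  assumes "0 \<le> t" "t \<le> 1" "lo \<le> a" "a \<le> hi" "lo \<le> b" "b \<le> hi"
  shows "lo \<le> (1 - t) * a + t * b" "(1 - t) * a + t * b \<le> hi"
proof -
  have "(1 - t) * lo + t * lo \<le> (1 - t) * a + t * b" "(1 - t) * a + t * b \<le> (1 - t) * hi + t * hi"
    using assms by (auto intro!: add_mono mult_left_mono)
  then show "lo \<le> (1 - t) * a + t * b" "(1 - t) * a + t * b \<le> hi" by (simp_all add: algebra_simps)
qed

text \<open>At 1/2 and 3/2 two cells are possible. Taking the outer one keeps clear of the central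
  cell of the cube, which \<open>core\<close> leaves out.\<close>

lemma near_nat_le2:
  assumes "-1/2 \<le> x" "x \<le> 5/2"
  obtains k where "k \<le> 2" "\<bar>x - real k\<bar> \<le> 1/2" "x \<le> 1/2 \<or> 3/2 \<le> x \<Longrightarrow> k \<noteq> 1"
proof -
  consider "x \<le> 1/2" | "1/2 < x" "x < 3/2" | "3/2 \<le> x" by linarith
  then show thesis
  proof cases
    case 1
    then have "\<bar>x - real 0\<bar> \<le> 1/2" unfolding abs_le_iff using assms by simp
    then show ?thesis using that[of 0] by simp
  next
    case 2
    then have "\<bar>x - real 1\<bar> \<le> 1/2" unfolding abs_le_iff by simp
    then show ?thesis using that[of 1] 2 by simp
  next
    case 3
    then have "\<bar>x - real 2\<bar> \<le> 1/2" unfolding abs_le_iff using assms by simp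
    then show ?thesis using that[of 2] by simp
  qed
qed

definition build :: "nat \<Rightarrow> (nat \<Rightarrow> real) \<Rightarrow> real \<Rightarrow> real \<Rightarrow> nat \<Rightarrow> real" where
  "build D y s t = (\<lambda>j. if j < D then y j else if j = D then s else if j = Suc D then t else 0)"

lemma build_simps [simp]:
  "j < D \<Longrightarrow> build D y s t j = y j" "build D y s t D = s" "build D y s t (Suc D) = t"
  by (auto simp: build_def)

lemma build_in_real_seq: "build D y s t \<in> real_seq (Suc (Suc D))"
  by (auto simp: build_def)

lemma build_segment:
  "(\<lambda>j. (1 - u) * build D y s t j + u * build D y' s' t' j) =
   build D (\<lambda>j. (1 - u) * y j + u * y' j) ((1 - u) * s + u * s') ((1 - u) * t + u * t')"
  by (auto simp: build_def fun_eq_iff)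

lemma continuous_on_build:
  assumes "\<And>j. j < D \<Longrightarrow> continuous_on A (\<lambda>x. y x j)" "continuous_on A s" "continuous_on A t"
  shows "continuous_on A (\<lambda>x. build D (y x) (s x) (t x))"
proof (rule continuous_on_coordinatewise_then_product)
  fix j
  consider "j < D" | "j = D" | "j = Suc D" | "Suc D < j" by linarith
  then show "continuous_on A (\<lambda>x. build D (y x) (s x) (t x) j)"
    by cases (use assms in \<open>simp_all add: build_def\<close>)
qed

lemma continuous_on_coord: "continuous_on A (\<lambda>x::nat \<Rightarrow> real. x j)"
  by (rule continuous_on_subset[OF continuous_on_product_coordinates]) simp

lemma continuous_on_squash_fade:
  "continuous_on A f \<Longrightarrow> continuous_on A (\<lambda>x. squash (f x))"
  "continuous_on A f \<Longrightarrow> continuous_on A (\<lambda>x. fade (f x))"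
  unfolding squash_def fade_def by (auto intro!: continuous_intros)

context
  fixes D :: nat and I :: "'i set" and B :: "'i \<Rightarrow> nat set"
  assumes I: "I \<noteq> {}" and B: "\<And>i. i \<in> I \<Longrightarrow> B i \<noteq> {}" "\<And>i. i \<in> I \<Longrightarrow> B i \<subseteq> {..<D}"
begin

text \<open>Removing the central cell (all block coordinates 1) from the 3 by ... by 3 cells of the
  cube leaves a thickening of its boundary. For a block with one element the cells 0 and 2 remain,
  as is right for a sphere of dimension 0.\<close>

definition core :: "(nat \<Rightarrow> nat) \<Rightarrow> bool" where
  "core z \<longleftrightarrow> (\<exists>i\<in>I. (\<forall>j<D. j \<notin> B i \<longrightarrow> z j = 0) \<and> (\<forall>j\<in>B i. z j \<le> 2) \<and> (\<exists>j\<in>B i. z j \<noteq> 1))"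

text \<open>At height 0 a thickened wedge, at height 1 a stalk over its base point, above it a solid box.\<close>

definition plate :: "(nat \<Rightarrow> nat) \<Rightarrow> bool" where
  "plate z \<longleftrightarrow> 2 \<le> z D \<or> z D = 1 \<and> (\<forall>j<D. z j = 0) \<or> z D = 0 \<and> core z"

definition tile :: "(nat \<Rightarrow> real) set" where
  "tile = polycube (Suc (Suc D)) (plugged (Suc D) plate)"

lemma core_zero: "(\<And>j. j < D \<Longrightarrow> z j = 0) \<Longrightarrow> core z"
proof -
  assume z: "\<And>j. j < D \<Longrightarrow> z j = 0"
  obtain i j where ij: "i \<in> I" "j \<in> B i" using I B(1) by blast
  have "z k = 0" if "k \<in> B i" for k using that B(2)[OF ij(1)] z by auto
  then show ?thesis unfolding core_def using ij z by (intro bexI[of _ i]) auto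
qed

lemma core_down:
  assumes "core z" "\<And>i. i < D \<Longrightarrow> zigzag_le (z' i) (z i)"
  shows "core z'"
proof -
  obtain i where i: "i \<in> I" "\<forall>j<D. j \<notin> B i \<longrightarrow> z j = 0" "\<forall>j\<in>B i. z j \<le> 2" "\<exists>j\<in>B i. z j \<noteq> 1"
    using assms(1) by (auto simp: core_def)
  have b: "zigzag_le (z' j) (z j)" if "j \<in> B i" for j using that assms(2) B(2)[OF i(1)] by auto
  have "z' j \<le> 2" if "j \<in> B i" for j
    using b[OF that] i(3) that by (auto simp: zigzag_le_def)
  moreover obtain j where "j \<in> B i" "z j \<noteq> 1" using i(4) by blast
  moreover from this have "z' j \<noteq> 1" using b[of j] i(3) by (auto simp: zigzag_le_def)
  moreover have "z' j = 0" if "j < D" "j \<notin> B i" for j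
    using assms(2)[OF that(1)] i(2) that by (auto simp: zigzag_le_def)
  ultimately show ?thesis using i(1) unfolding core_def by blast
qed

text \<open>Heights mix only in the stalk at height 1. Its predecessors at heights 0 and 2 still lie
  over the base point, so they belong to \<open>core\<close> and to the box. This is also why stalk
  and wedge meet at the cell 0.\<close>

lemma plate_down:
  assumes "plate z" "\<And>i. i < Suc D \<Longrightarrow> zigzag_le (z' i) (z i)"
  shows "plate z'"
proof -
  have b: "zigzag_le (z' D) (z D)" using assms(2) by simp
  consider "2 \<le> z D" | "z D = 1" "\<forall>j<D. z j = 0" | "z D = 0" "core z"
    using assms(1) by (auto simp: plate_def)
  then show ?thesis
  proof cases
    case 1
    then show ?thesis using b by (auto simp: plate_def zigzag_le_def)
  next
    case 2
    have z0: "z' j = 0" if "j < D" for j using assms(2)[of j] 2 that by (auto simp: zigzag_le_def)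
    then have "core z'" by (rule core_zero)
    with z0 show ?thesis using b 2 by (auto simp: plate_def zigzag_le_def)
  next
    case 3
    then have "core z'" using assms(2) by (auto intro: core_down)
    then show ?thesis using b 3 by (auto simp: plate_def zigzag_le_def)
  qed
qed

text \<open>One of the heights \<open>z D\<close> and \<open>3 - z D\<close> is at least 2, and
  there the plate is solid.\<close>

lemma plate_reflect: "(\<And>i. i < Suc D \<Longrightarrow> z i \<le> 3) \<Longrightarrow> plate z \<or> plate (\<lambda>j. 3 - z j)"
  by (auto simp: plate_def)

lemma dim_rep_tile_tile: "dim_rep_tile (Suc (Suc D)) tile"
  unfolding tile_def
proof (rule dim_rep_tile_plugged[where P = plate and z = "\<lambda>_. 2"])
  show "plate z'" if "plate z" "\<And>i. i < Suc D \<Longrightarrow> zigzag_le (z' i) (z i)" for z z'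
    using that by (rule plate_down)
  show "plate z \<or> plate (\<lambda>j. 3 - z j)" if "\<And>i. i < Suc D \<Longrightarrow> z i \<le> 3" for z
    using that by (rule plate_reflect)
qed (simp_all add: plate_def)

text \<open>The solid described by \<open>core\<close>, by inequalities instead of a choice of
  cells: a block coordinate outside the open interval from 1/2 to 3/2 witnesses an outer
  cell.\<close>

definition core_set :: "(nat \<Rightarrow> real) set" where
  "core_set = {x. \<exists>i\<in>I. (\<forall>j<D. j \<notin> B i \<longrightarrow> \<bar>x j\<bar> \<le> 1/2) \<and> (\<forall>j\<in>B i. -1/2 \<le> x j \<and> x j \<le> 5/2) \<and>
      (\<exists>j\<in>B i. x j \<le> 1/2 \<or> 3/2 \<le> x j)}"

definition plate_set :: "(nat \<Rightarrow> real) set" where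
  "plate_set = {x. (\<forall>j<D. -1/2 \<le> x j \<and> x j \<le> 7/2) \<and> 3/2 \<le> x D \<and> x D \<le> 7/2 \<or>
     (\<forall>j<D. \<bar>x j\<bar> \<le> 1/2) \<and> 1/2 \<le> x D \<and> x D \<le> 3/2 \<or>
     x \<in> core_set \<and> -1/2 \<le> x D \<and> x D \<le> 1/2}"

lemma core_set_cong:
  assumes "\<And>j. j < D \<Longrightarrow> x j = y j" "x \<in> core_set"
  shows "y \<in> core_set"
proof -
  obtain i where i: "i \<in> I" "\<forall>j<D. j \<notin> B i \<longrightarrow> \<bar>x j\<bar> \<le> 1/2"
      "\<forall>j\<in>B i. -1/2 \<le> x j \<and> x j \<le> 5/2" "\<exists>j\<in>B i. x j \<le> 1/2 \<or> 3/2 \<le> x j"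
    using assms(2) unfolding core_set_def by blast
  have "x j = y j" if "j \<in> B i" for j using that assms(1) B(2)[OF i(1)] by auto
  then show ?thesis using i assms(1) unfolding core_set_def by (intro CollectI bexI[of _ i]) simp_all
qed

lemma plate_set_cong:
  assumes "\<And>j. j < Suc D \<Longrightarrow> x j = y j" "x \<in> plate_set"
  shows "y \<in> plate_set"
proof -
  have "x \<in> core_set \<longrightarrow> y \<in> core_set" using core_set_cong[of x y] assms(1) by simp
  then show ?thesis using assms unfolding plate_set_def by (simp, blast)
qed

lemma plate_setI:
  assumes P: "plate z" and z: "\<And>j. j < Suc D \<Longrightarrow> z j \<le> 3 \<and> \<bar>x j - real (z j)\<bar> \<le> 1/2"
  shows "x \<in> plate_set"
proof -
  have b: "-1/2 \<le> x j \<and> x j \<le> 7/2" if "j < Suc D" for j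
  proof -
    have "real (z j) \<le> 3" "\<bar>x j - real (z j)\<bar> \<le> 1/2" using z[OF that] by auto
    then show ?thesis unfolding abs_le_iff by auto
  qed
  have xD: "\<bar>x D - real (z D)\<bar> \<le> 1/2" using z by simp
  consider "2 \<le> z D" | "z D = 1" "\<forall>j<D. z j = 0" | "z D = 0" "core z"
    using P by (auto simp: plate_def)
  then show ?thesis
  proof cases
    case 1
    then have "real (z D) \<ge> 2" by simp
    then have "3/2 \<le> x D" using xD unfolding abs_le_iff by auto
    then show ?thesis using b by (simp add: plate_set_def)
  next
    case 2
    then have "\<bar>x j\<bar> \<le> 1/2" if "j < D" for j using z[of j] that by simp
    moreover have "1/2 \<le> x D" "x D \<le> 3/2" using xD 2 unfolding abs_le_iff by auto
    ultimately show ?thesis by (simp add: plate_set_def)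
  next
    case 3
    obtain i where i: "i \<in> I" "\<forall>j<D. j \<notin> B i \<longrightarrow> z j = 0" "\<forall>j\<in>B i. z j \<le> 2" "\<exists>j\<in>B i. z j \<noteq> 1"
      using 3 by (auto simp: core_def)
    have zB: "\<bar>x j - real (z j)\<bar> \<le> 1/2" if "j \<in> B i" for j using that z B(2)[OF i(1)] by auto
    have "-1/2 \<le> x j \<and> x j \<le> 5/2" if "j \<in> B i" for j
    proof -
      have "real (z j) \<le> 2" using i(3) that by (metis of_nat_le_iff of_nat_numeral)
      then show ?thesis using zB[OF that] of_nat_0_le_iff[of "z j"] unfolding abs_le_iff by auto
    qed
    moreover have "\<bar>x j\<bar> \<le> 1/2" if "j < D" "j \<notin> B i" for j using z[of j] i(2) that by simp
    moreover obtain j where j: "j \<in> B i" "z j \<noteq> 1" using i(4) by blast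
    moreover have "x j \<le> 1/2 \<or> 3/2 \<le> x j"
    proof -
      have "z j = 0 \<or> z j = 2" using j i(3) by force
      then show ?thesis using zB[OF j(1)] unfolding abs_le_iff by auto
    qed
    ultimately have "x \<in> core_set" using i(1) unfolding core_set_def by blast
    moreover have "\<bar>x D\<bar> \<le> 1/2" using xD 3 by simp
    ultimately show ?thesis unfolding plate_set_def abs_le_iff by auto
  qed
qed

lemma plate_setE:
  assumes "x \<in> plate_set"
  obtains z where "plate z" "\<And>j. j < Suc D \<Longrightarrow> z j \<le> 3 \<and> \<bar>x j - real (z j)\<bar> \<le> 1/2"
proof -
  consider "\<forall>j<D. -1/2 \<le> x j \<and> x j \<le> 7/2" "3/2 \<le> x D" "x D \<le> 7/2"
    | "\<forall>j<D. \<bar>x j\<bar> \<le> 1/2" "1/2 \<le> x D" "x D \<le> 3/2"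
    | "x \<in> core_set" "-1/2 \<le> x D" "x D \<le> 1/2"
    using assms by (auto simp: plate_set_def)
  then show thesis
  proof cases
    case 1
    have "\<exists>k. j < D \<longrightarrow> k \<le> 3 \<and> \<bar>x j - real k\<bar> \<le> 1/2" for j
    proof (cases "j < D")
      case True
      then have "-1/2 \<le> x j" "x j \<le> 7/2" using 1 by auto
      then show ?thesis by (rule near_nat_exists) blast
    qed simp
    from choice[OF allI[OF this]] obtain k where k: "\<forall>j. j < D \<longrightarrow> k j \<le> 3 \<and> \<bar>x j - real (k j)\<bar> \<le> 1/2" ..
    define m where "m = (if x D \<le> 5/2 then 2 else 3::nat)"
    have m: "2 \<le> m" "m \<le> 3" "\<bar>x D - real m\<bar> \<le> 1/2" using 1 unfolding m_def abs_le_iff by auto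
    have "plate (k(D := m))" using m by (simp add: plate_def)
    moreover have "(k(D := m)) j \<le> 3 \<and> \<bar>x j - real ((k(D := m)) j)\<bar> \<le> 1/2" if "j < Suc D" for j
      using that k m by (cases "j = D") auto
    ultimately show ?thesis by (rule that)
  next
    case 2
    define z :: "nat \<Rightarrow> nat" where "z = (\<lambda>j. if j = D then 1 else 0)"
    have "\<bar>x D - real 1\<bar> \<le> 1/2" using 2 unfolding abs_le_iff by simp
    then have "z j \<le> 3 \<and> \<bar>x j - real (z j)\<bar> \<le> 1/2" if "j < Suc D" for j
      using 2 that by (cases "j = D") (auto simp: z_def)
    moreover have "plate z" by (simp add: plate_def z_def)
    ultimately show ?thesis using that by blast
  next
    case 3
    then obtain i where i: "i \<in> I" "\<forall>j<D. j \<notin> B i \<longrightarrow> \<bar>x j\<bar> \<le> 1/2"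
      "\<forall>j\<in>B i. -1/2 \<le> x j \<and> x j \<le> 5/2" "\<exists>j\<in>B i. x j \<le> 1/2 \<or> 3/2 \<le> x j"
      unfolding core_set_def by blast
    have "\<exists>k. j \<in> B i \<longrightarrow> k \<le> 2 \<and> \<bar>x j - real k\<bar> \<le> 1/2 \<and> (x j \<le> 1/2 \<or> 3/2 \<le> x j \<longrightarrow> k \<noteq> 1)" for j
    proof (cases "j \<in> B i")
      case True
      then have "-1/2 \<le> x j" "x j \<le> 5/2" using i(3) by auto
      then show ?thesis by (rule near_nat_le2) blast
    qed simp
    from choice[OF allI[OF this]] obtain k where
      k: "\<forall>j. j \<in> B i \<longrightarrow> k j \<le> 2 \<and> \<bar>x j - real (k j)\<bar> \<le> 1/2 \<and> (x j \<le> 1/2 \<or> 3/2 \<le> x j \<longrightarrow> k j \<noteq> 1)" ..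
    define z where "z j = (if j \<in> B i then k j else 0)" for j
    have DB: "D \<notin> B i" using B(2)[OF i(1)] by auto
    have "core z" unfolding core_def using i(1,4) k by (intro bexI[of _ i]) (auto simp: z_def)
    then have "plate z" using DB by (simp add: plate_def z_def)
    moreover have "z j \<le> 3 \<and> \<bar>x j - real (z j)\<bar> \<le> 1/2" if "j < Suc D" for j
    proof (cases "j \<in> B i")
      case True
      then have "k j \<le> 2" "\<bar>x j - real (k j)\<bar> \<le> 1/2" using k by auto
      then show ?thesis using True by (simp add: z_def)
    next
      case False
      have "\<bar>x j\<bar> \<le> 1/2"
      proof (cases "j = D")
        case True
        then show ?thesis using 3 unfolding abs_le_iff by simp
      next
        case False
        then show ?thesis using i(2) \<open>j \<notin> B i\<close> that by simp
      qed
      then show ?thesis using False by (simp add: z_def)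
    qed
    ultimately show ?thesis by (rule that)
  qed
qed

lemma tileI:
  assumes "x \<in> real_seq (Suc (Suc D))" "x \<in> plate_set" "3/2 \<le> x (Suc D)" "x (Suc D) \<le> 5/2"
  shows "x \<in> tile"
proof -
  obtain z where z: "plate z" "\<And>j. j < Suc D \<Longrightarrow> z j \<le> 3 \<and> \<bar>x j - real (z j)\<bar> \<le> 1/2"
    using plate_setE[OF assms(2)] by blast
  define w where "w = (\<lambda>j\<in>{..<Suc (Suc D)}. if j = Suc D then 2 else z j)"
  have "plate w" by (rule plate_down[OF z(1)]) (simp add: w_def)
  then have "w \<in> plugged (Suc D) plate" using z(2) by (auto simp: plugged_def cells_def w_def)
  moreover have "\<bar>x j - real (w j)\<bar> \<le> 1/2" if "j < Suc (Suc D)" for j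
  proof (cases "j = Suc D")
    case True
    have "\<bar>x (Suc D) - real 2\<bar> \<le> 1/2" unfolding abs_le_iff using assms(3,4) by simp
    then show ?thesis using True by (simp add: w_def)
  next
    case False
    then show ?thesis using z(2)[of j] that by (simp add: w_def)
  qed
  ultimately show ?thesis using assms(1) unfolding tile_def polycube_def by blast
qed

text \<open>Plugs stand on plate cells, so without its last coordinate the whole tile projects into
  the plate. The last claim moves a point vertically towards the middle height 2 of the plate's
  layer.\<close>

lemma tileD:
  assumes "x \<in> tile"
  shows "x \<in> real_seq (Suc (Suc D))" "x \<in> plate_set" "3/2 \<le> x (Suc D)"
    and "0 \<le> t \<Longrightarrow> t \<le> 1 \<Longrightarrow> x(Suc D := (1 - t) * x (Suc D) + t * 2) \<in> tile"
proof -
  obtain z where z: "z \<in> plugged (Suc D) plate" "\<forall>j<Suc (Suc D). \<bar>x j - real (z j)\<bar> \<le> 1/2"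
    and xE: "x \<in> real_seq (Suc (Suc D))"
    using assms unfolding tile_def polycube_def by blast
  have z3: "z j \<le> 3" if "j < Suc (Suc D)" for j using z(1) that cells_le by (auto simp: plugged_def)
  show "x \<in> real_seq (Suc (Suc D))" by (rule xE)
  have "plate z" using z(1) plate_reflect[of z] z3 by (auto simp: plugged_def)
  then show xP: "x \<in> plate_set" by (rule plate_setI) (use z z3 in auto)
  have xl: "\<bar>x (Suc D) - real (z (Suc D))\<bar> \<le> 1/2" using z(2) by blast
  have zl: "z (Suc D) = 2 \<or> z (Suc D) = 3" using z(1) by (auto simp: plugged_def)
  show x32: "3/2 \<le> x (Suc D)" using xl zl unfolding abs_le_iff by auto
  assume t: "0 \<le> t" "t \<le> 1"
  define u where "u = (1 - t) * x (Suc D) + t * 2"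
  have lo: "3/2 \<le> u" unfolding u_def using segment_bounds(1)[OF t, of "3/2" "x (Suc D)" "max 2 (x (Suc D))" 2] x32 by simp
  show "x(Suc D := u) \<in> tile"
  \<comment> \<open>Up to height 5/2 the point is in the plate's layer. Above that, \<open>u\<close>
    lies between 5/2 and the old height, hence in the same plug cell.\<close>
  proof (cases "u \<le> 5/2")
    case True
    have "x(Suc D := u) \<in> plate_set" by (rule plate_set_cong[OF _ xP]) simp
    then show ?thesis using xE lo True by (intro tileI) auto
  next
    case False
    have "u \<le> max 2 (x (Suc D))" unfolding u_def using segment_bounds(2)[OF t, of "3/2" "x (Suc D)" "max 2 (x (Suc D))" 2] x32 by simp
    then have ux: "u \<le> x (Suc D)" using False by simp
    then have "z (Suc D) = 3" using xl zl False unfolding abs_le_iff by auto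
    then have "\<bar>u - real (z (Suc D))\<bar> \<le> 1/2" using xl ux False unfolding abs_le_iff by auto
    then have "\<bar>(x(Suc D := u)) j - real (z j)\<bar> \<le> 1/2" if "j < Suc (Suc D)" for j
      using z(2) that by simp
    moreover have "x(Suc D := u) \<in> real_seq (Suc (Suc D))" using xE by auto
    ultimately show ?thesis using z(1) unfolding tile_def polycube_def by blast
  qed
qed

text \<open>The cube boundaries are placed at the middle heights of their layers: 0 for the wedge
  inside the plate, 2 for the plate inside the tile.\<close>

definition spheres :: "(nat \<Rightarrow> real) set" where
  "spheres = {x \<in> real_seq (Suc (Suc D)). x D = 0 \<and> x (Suc D) = 2 \<and>
     (\<exists>i\<in>I. (\<forall>j<D. j \<notin> B i \<longrightarrow> x j = 0) \<and> (\<forall>j\<in>B i. 0 \<le> x j \<and> x j \<le> 2) \<and> (\<exists>j\<in>B i. x j = 0 \<or> x j = 2))}"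

text \<open>Since \<open>squash\<close> takes the half-lines up to 1/2 and from 3/2 on into
  themselves, the straight path to it keeps a coordinate that is in an outer cell on the same
  side.\<close>

lemma core_set_squash:
  assumes "x \<in> core_set" "0 \<le> t" "t \<le> 1" "\<And>j. j < D \<Longrightarrow> y j = (1 - t) * x j + t * squash (x j)"
  shows "y \<in> core_set"
proof -
  obtain i where i: "i \<in> I" "\<forall>j<D. j \<notin> B i \<longrightarrow> \<bar>x j\<bar> \<le> 1/2"
      "\<forall>j\<in>B i. -1/2 \<le> x j \<and> x j \<le> 5/2" "\<exists>j\<in>B i. x j \<le> 1/2 \<or> 3/2 \<le> x j"
    using assms(1) unfolding core_set_def by blast
  have y: "y j = (1 - t) * x j + t * squash (x j)" if "j \<in> B i" for j
    using that assms(4) B(2)[OF i(1)] by auto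
  have "\<bar>y j\<bar> \<le> 1/2" if "j < D" "j \<notin> B i" for j
  proof -
    have "\<bar>x j\<bar> \<le> 1/2" using i(2) that by blast
    then have "-1/2 \<le> x j" "x j \<le> 1/2" "squash (x j) = 0" by (auto simp: abs_le_iff squash_simps)
    then show ?thesis unfolding assms(4)[OF that(1)] abs_le_iff
      using segment_bounds[OF assms(2,3), of "-1/2" "x j" "1/2" 0] by auto
  qed
  moreover have "-1/2 \<le> y j \<and> y j \<le> 5/2" if "j \<in> B i" for j
    unfolding y[OF that] using i(3) that squash_simps(3,4)[of "x j"]
      segment_bounds[OF assms(2,3), of "-1/2" "x j" "5/2" "squash (x j)"] by force
  moreover have "y j \<le> 1/2 \<or> 3/2 \<le> y j" if "j \<in> B i" "x j \<le> 1/2 \<or> 3/2 \<le> x j" for j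
    using that(2)
  proof
    assume "x j \<le> 1/2"
    then show ?thesis unfolding y[OF that(1)]
      using segment_bounds(2)[OF assms(2,3), of "min (x j) 0" "x j" "1/2" 0] by (simp add: squash_simps)
  next
    assume "3/2 \<le> x j"
    then show ?thesis unfolding y[OF that(1)]
      using segment_bounds(1)[OF assms(2,3), of "3/2" "x j" "max (x j) 2" 2] by (simp add: squash_simps)
  qed
  ultimately show ?thesis using i(1,4) unfolding core_set_def by blast
qed

lemma core_set_zero: "(\<And>j. j < D \<Longrightarrow> x j = 0) \<Longrightarrow> x \<in> core_set"
proof -
  assume x: "\<And>j. j < D \<Longrightarrow> x j = 0"
  obtain i j where ij: "i \<in> I" "j \<in> B i" using I B(1) by blast
  have "x k = 0" if "k \<in> B i" for k using that x B(2)[OF ij(1)] by auto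
  then show ?thesis using ij x unfolding core_set_def by (intro CollectI bexI[of _ i]) auto
qed

lemma plate_set_zero:
  assumes "\<And>j. j < D \<Longrightarrow> x j = 0" "-1/2 \<le> x D" "x D \<le> 7/2"
  shows "x \<in> plate_set"
  using assms core_set_zero[OF assms(1)] by (auto simp: plate_set_def)

lemma build_in_tile: "build D y s 2 \<in> plate_set \<Longrightarrow> build D y s 2 \<in> tile"
  by (rule tileI[OF build_in_real_seq]) auto

lemma plate_set_cases:
  assumes "x \<in> plate_set"
  obtains (box) "\<And>j. j < D \<Longrightarrow> -1/2 \<le> x j \<and> x j \<le> 7/2" "3/2 \<le> x D" "x D \<le> 7/2" "fade (x D) = 0"
    | (stalk) "\<And>j. j < D \<Longrightarrow> -1/2 \<le> x j \<and> x j \<le> 1/2 \<and> squash (x j) = 0" "1/2 \<le> x D" "x D \<le> 3/2"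
    | (core) "x \<in> core_set" "-1/2 \<le> x D" "x D \<le> 1/2" "fade (x D) = 1"
proof -
  consider "\<forall>j<D. -1/2 \<le> x j \<and> x j \<le> 7/2" "3/2 \<le> x D" "x D \<le> 7/2"
    | "\<forall>j<D. \<bar>x j\<bar> \<le> 1/2" "1/2 \<le> x D" "x D \<le> 3/2"
    | "x \<in> core_set" "-1/2 \<le> x D" "x D \<le> 1/2"
    using assms unfolding plate_set_def by blast
  then show thesis
  proof cases
    case 1
    then show ?thesis using box by (simp add: fade_simps)
  next
    case 2
    have "-1/2 \<le> x j \<and> x j \<le> 1/2 \<and> squash (x j) = 0" if "j < D" for j
    proof -
      have "\<bar>x j\<bar> \<le> 1/2" using 2 that by blast
      then have "-1/2 \<le> x j" "x j \<le> 1/2" unfolding abs_le_iff by auto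
      then show ?thesis by (simp add: squash_simps)
    qed
    then show ?thesis using 2 stalk by blast
  next
    case 3
    then show ?thesis using core by (simp add: fade_simps)
  qed
qed

section \<open>Deformation of the tile to the cube boundaries\<close>

definition retract_tile :: "(nat \<Rightarrow> real) \<Rightarrow> nat \<Rightarrow> real" where
  "retract_tile x = build D (\<lambda>j. fade (x D) * squash (x j)) 0 2"

lemma continuous_on_stages:
  "continuous_on A (\<lambda>x. build D x (x D) 2)"
  "continuous_on A (\<lambda>x. build D (\<lambda>j. squash (x j)) (x D) 2)"
  "continuous_on A (\<lambda>x. build D (\<lambda>j. fade (x D) * squash (x j)) (x D) 2)"
  by (intro continuous_on_build continuous_on_mult continuous_on_squash_fade continuous_on_coord continuous_on_const)+

lemma continuous_on_retract_tile: "continuous_on A retract_tile"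
  unfolding retract_tile_def
  by (intro continuous_on_build continuous_on_mult continuous_on_squash_fade continuous_on_coord continuous_on_const)

text \<open>Plugs are pressed into the solid below them.\<close>

lemma homotopic_step1: "homotopic_with_canon (\<lambda>_. True) tile tile id (\<lambda>x. build D x (x D) 2)"
proof (rule homotopic_with_straight_line)
  fix x t assume "x \<in> tile" "0 \<le> t" "t \<le> (1::real)"
  have "(\<lambda>j. (1 - t) * id x j + t * build D x (x D) 2 j) = x(Suc D := (1 - t) * x (Suc D) + t * 2)"
    using tileD(1)[OF \<open>x \<in> tile\<close>] by (auto simp: build_def fun_eq_iff less_Suc_eq algebra_simps)
  then show "(\<lambda>j. (1 - t) * id x j + t * build D x (x D) 2 j) \<in> tile"
    using tileD(4)[OF \<open>x \<in> tile\<close>] \<open>0 \<le> t\<close> \<open>t \<le> 1\<close> by simp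
qed (rule continuous_on_stages continuous_on_id')+

text \<open>The thickened wedge is flattened to the cube boundaries and the stalk to the axis over
  the base point, all heights being kept. The convex box simply absorbs the motion.\<close>

lemma homotopic_step2:
  "homotopic_with_canon (\<lambda>_. True) tile tile (\<lambda>x. build D x (x D) 2) (\<lambda>x. build D (\<lambda>j. squash (x j)) (x D) 2)"
proof (rule homotopic_with_straight_line)
  fix x t assume x: "x \<in> tile" and t: "0 \<le> t" "t \<le> (1::real)"
  let ?y = "build D (\<lambda>j. (1 - t) * x j + t * squash (x j)) (x D) 2"
  have "?y \<in> plate_set"
    using tileD(2)[OF x]
  proof (cases rule: plate_set_cases)
    case box
    have "-1/2 \<le> ?y j \<and> ?y j \<le> 7/2" if "j < D" for j
      using segment_bounds[OF t, of "-1/2" "x j" "7/2" "squash (x j)"] box(1)[OF that] squash_simps(3,4)[of "x j"] that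
      by simp
    then show ?thesis using box by (simp add: plate_set_def)
  next
    case stalk
    have "\<bar>?y j\<bar> \<le> 1/2" if "j < D" for j
      using segment_bounds[OF t, of "-1/2" "x j" "1/2" "squash (x j)"] stalk(1)[OF that] that
      unfolding abs_le_iff by simp
    then show ?thesis using stalk by (simp add: plate_set_def)
  next
    case core
    then show ?thesis using core_set_squash[OF core(1) t, of ?y] by (simp add: plate_set_def)
  qed
  then show "(\<lambda>j. (1 - t) * build D x (x D) 2 j + t * build D (\<lambda>j. squash (x j)) (x D) 2 j) \<in> tile"
    unfolding build_segment using build_in_tile by (simp add: algebra_simps)
qed (rule continuous_on_stages)+

text \<open>The box shrinks to the axis, where \<open>fade\<close> is 0. In the stalk
  \<open>fade\<close> varies, but all squashed coordinates are 0 there; in the wedge it is 1. Thus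
  nothing tears.\<close>

lemma homotopic_step3:
  "homotopic_with_canon (\<lambda>_. True) tile tile (\<lambda>x. build D (\<lambda>j. squash (x j)) (x D) 2)
     (\<lambda>x. build D (\<lambda>j. fade (x D) * squash (x j)) (x D) 2)"
proof (rule homotopic_with_straight_line)
  fix x t assume x: "x \<in> tile" and t: "0 \<le> t" "t \<le> (1::real)"
  let ?y = "build D (\<lambda>j. (1 - t) * squash (x j) + t * (fade (x D) * squash (x j))) (x D) 2"
  have "?y \<in> plate_set"
    using tileD(2)[OF x]
  proof (cases rule: plate_set_cases)
    case box
    have "-1/2 \<le> ?y j \<and> ?y j \<le> 7/2" if "j < D" for j
      using segment_bounds[OF t, of "-1/2" "squash (x j)" "7/2" 0] squash_simps(3,4)[of "x j"] that box(4)
      by simp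
    then show ?thesis using box by (simp add: plate_set_def)
  next
    case stalk
    \<comment> \<open>The axis over the base point is contained in the plate at all heights.\<close>
    then show ?thesis by (intro plate_set_zero) auto
  next
    case core
    then show ?thesis using core_set_squash[OF core(1), of 1 ?y] by (simp add: plate_set_def algebra_simps)
  qed
  then show "(\<lambda>j. (1 - t) * build D (\<lambda>j. squash (x j)) (x D) 2 j +
      t * build D (\<lambda>j. fade (x D) * squash (x j)) (x D) 2 j) \<in> tile"
    unfolding build_segment using build_in_tile by (simp add: algebra_simps)
qed (rule continuous_on_stages)+

text \<open>What remains above the wedge is the axis, which slides down through the stalk to the
  base point.\<close>

lemma homotopic_step4:
  "homotopic_with_canon (\<lambda>_. True) tile tile (\<lambda>x. build D (\<lambda>j. fade (x D) * squash (x j)) (x D) 2) retract_tile"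
proof (rule homotopic_with_straight_line)
  fix x t assume x: "x \<in> tile" and t: "0 \<le> t" "t \<le> (1::real)"
  let ?y = "build D (\<lambda>j. fade (x D) * squash (x j)) ((1 - t) * x D) 2"
  have "?y \<in> plate_set"
    using tileD(2)[OF x]
  proof (cases rule: plate_set_cases)
    case box
    then show ?thesis using segment_bounds[OF t, of "-1/2" "x D" "7/2" 0] by (intro plate_set_zero) auto
  next
    case stalk
    then show ?thesis using segment_bounds[OF t, of "-1/2" "x D" "7/2" 0] by (intro plate_set_zero) auto
  next
    case core
    then show ?thesis using core_set_squash[OF core(1), of 1 ?y] segment_bounds[OF t, of "-1/2" "x D" "1/2" 0]
      by (simp add: plate_set_def)
  qed
  moreover have "(\<lambda>j. (1 - t) * build D (\<lambda>j. fade (x D) * squash (x j)) (x D) 2 j + t * retract_tile x j) = ?y"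
    unfolding retract_tile_def build_segment by (simp add: algebra_simps)
  ultimately show "(\<lambda>j. (1 - t) * build D (\<lambda>j. fade (x D) * squash (x j)) (x D) 2 j + t * retract_tile x j) \<in> tile"
    using build_in_tile by simp
qed (rule continuous_on_stages continuous_on_retract_tile)+

lemma homotopic_retract_tile: "homotopic_with_canon (\<lambda>_. True) tile tile id retract_tile"
  by (rule homotopic_with_trans[OF homotopic_with_trans[OF homotopic_with_trans[OF
          homotopic_step1 homotopic_step2] homotopic_step3] homotopic_step4])

lemma spheres_zero: "build D (\<lambda>j. 0) 0 2 \<in> spheres"
proof -
  obtain i j where ij: "i \<in> I" "j \<in> B i" using I B(1) by blast
  have "build D (\<lambda>j. 0) 0 2 k = 0" if "k \<in> B i" for k using that B(2)[OF ij(1)] by auto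
  then show ?thesis using ij build_in_real_seq unfolding spheres_def by (intro CollectI conjI bexI[of _ i]) auto
qed

lemma retract_tile_spheres:
  assumes "x \<in> tile" shows "retract_tile x \<in> spheres"
  using tileD(2)[OF assms]
proof (cases rule: plate_set_cases)
  case box
  then show ?thesis using spheres_zero by (simp add: retract_tile_def)
next
  case stalk
  then have "retract_tile x = build D (\<lambda>j. 0) 0 2" by (auto simp: retract_tile_def build_def fun_eq_iff)
  then show ?thesis using spheres_zero by simp
next
  case core
  then obtain i where i: "i \<in> I" "\<forall>j<D. j \<notin> B i \<longrightarrow> \<bar>x j\<bar> \<le> 1/2" "\<exists>j\<in>B i. x j \<le> 1/2 \<or> 3/2 \<le> x j"
    unfolding core_set_def by blast
  have r: "retract_tile x j = squash (x j)" if "j < D" for j using that core(4) by (simp add: retract_tile_def)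
  have BD: "j < D" if "j \<in> B i" for j using that B(2)[OF i(1)] by auto
  have "retract_tile x j = 0" if "j < D" "j \<notin> B i" for j
    using i(2) that by (auto simp: r abs_le_iff squash_simps)
  moreover have "\<exists>j\<in>B i. retract_tile x j = 0 \<or> retract_tile x j = 2"
  proof -
    obtain j where "j \<in> B i" "x j \<le> 1/2 \<or> 3/2 \<le> x j" using i(3) by blast
    then show ?thesis using r[OF BD] squash_simps(1,2)[of "x j"] by (intro bexI[of _ j]) auto
  qed
  moreover have "0 \<le> retract_tile x j \<and> retract_tile x j \<le> 2" if "j \<in> B i" for j
    using r BD[OF that] squash_simps(3,4) by simp
  moreover have "retract_tile x \<in> real_seq (Suc (Suc D))" "retract_tile x D = 0" "retract_tile x (Suc D) = 2"
    unfolding retract_tile_def using build_in_real_seq by simp_all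
  ultimately show ?thesis using i(1) unfolding spheres_def by blast
qed

lemma spheres_subset_tile: "spheres \<subseteq> tile"
proof
  fix x assume "x \<in> spheres"
  then obtain i where i: "x \<in> real_seq (Suc (Suc D))" "x D = 0" "x (Suc D) = 2" "i \<in> I" "\<forall>j<D. j \<notin> B i \<longrightarrow> x j = 0"
    "\<forall>j\<in>B i. 0 \<le> x j \<and> x j \<le> 2" "\<exists>j\<in>B i. x j = 0 \<or> x j = 2"
    unfolding spheres_def by blast
  have "\<bar>x j\<bar> \<le> 1/2" if "j < D" "j \<notin> B i" for j using i(5) that by simp
  moreover have "-1/2 \<le> x j \<and> x j \<le> 5/2" if "j \<in> B i" for j
  proof -
    have "0 \<le> x j" "x j \<le> 2" using i(6) that by auto
    then show ?thesis by simp
  qed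
  moreover have "\<exists>j\<in>B i. x j \<le> 1/2 \<or> 3/2 \<le> x j"
  proof -
    obtain j where "j \<in> B i" "x j = 0 \<or> x j = 2" using i(7) by blast
    then show ?thesis by (intro bexI[of _ j]) auto
  qed
  ultimately have "x \<in> core_set" unfolding core_set_def using i(4) by blast
  then show "x \<in> tile" using i by (intro tileI) (auto simp: plate_set_def)
qed

text \<open>The map \<open>squash\<close> is not the identity on [0,2], so this is no strict
  retraction. It fixes 0 and 2, however, so a coordinate that puts a point on the cube's boundary
  stays constant along the straight path.\<close>

lemma homotopic_retract_spheres: "homotopic_with_canon (\<lambda>_. True) spheres spheres retract_tile id"
proof (rule homotopic_with_straight_line)
  fix x t assume "x \<in> spheres" and t: "0 \<le> t" "t \<le> (1::real)"
  then obtain i where i: "x \<in> real_seq (Suc (Suc D))" "x D = 0" "x (Suc D) = 2" "i \<in> I" "\<forall>j<D. j \<notin> B i \<longrightarrow> x j = 0"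
    "\<forall>j\<in>B i. 0 \<le> x j \<and> x j \<le> 2" "\<exists>j\<in>B i. x j = 0 \<or> x j = 2"
    unfolding spheres_def by blast
  let ?y = "\<lambda>j. (1 - t) * retract_tile x j + t * id x j"
  have r: "?y j = (1 - t) * squash (x j) + t * x j" if "j < D" for j
    using that i(2) by (simp add: retract_tile_def fade_simps)
  have BD: "j < D" if "j \<in> B i" for j using that B(2)[OF i(4)] by auto
  have "?y j = 0" if "j < D" "j \<notin> B i" for j unfolding r[OF that(1)] using i(5) that by (simp add: squash_simps)
  moreover have "0 \<le> ?y j \<and> ?y j \<le> 2" if "j \<in> B i" for j
    unfolding r[OF BD[OF that]] using segment_bounds[OF t, of 0 "squash (x j)" 2 "x j"] squash_simps(3,4) i(6) that by simp
  moreover have "\<exists>j\<in>B i. ?y j = 0 \<or> ?y j = 2"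
  proof -
    obtain j where j: "j \<in> B i" "x j = 0 \<or> x j = 2" using i(7) by blast
    then have "?y j = 0 \<or> ?y j = 2" unfolding r[OF BD[OF j(1)]] by (auto simp: squash_simps algebra_simps)
    then show ?thesis using j(1) by blast
  qed
  moreover have "?y \<in> real_seq (Suc (Suc D))" "?y D = 0" "?y (Suc D) = 2"
    using i(1-3) by (auto simp: retract_tile_def build_def)
  ultimately show "?y \<in> spheres" using i(4) unfolding spheres_def by blast
qed (rule continuous_on_retract_tile continuous_on_id')+

theorem tile_homotopy_equivalent_spheres:
  "subtopology (Euclidean_space (Suc (Suc D))) tile homotopy_equivalent_space top_of_set spheres"
proof -
  have T: "subtopology (Euclidean_space (Suc (Suc D))) tile = top_of_set tile"
    using tileD(1) by (simp add: Euclidean_space_top_of_set subtopology_subtopology inf.absorb2 subset_iff)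
  have "continuous_map (top_of_set tile) (top_of_set spheres) retract_tile"
    using retract_tile_spheres continuous_on_retract_tile by auto
  moreover have "continuous_map (top_of_set spheres) (top_of_set tile) id"
    using spheres_subset_tile by auto
  moreover have "homotopic_with_canon (\<lambda>_. True) tile tile (id \<circ> retract_tile) id"
    using homotopic_retract_tile by (simp add: homotopic_with_sym)
  moreover have "homotopic_with_canon (\<lambda>_. True) spheres spheres (retract_tile \<circ> id) id"
    using homotopic_retract_spheres by simp
  ultimately show ?thesis
    unfolding T homotopy_equivalent_space_def by blast
qed

end

section \<open>Recognising a wedge as a quotient of a disjoint sum\<close>

lemma homeomorphic_space_same_quotient:
  assumes f: "quotient_map X Y f" and g: "quotient_map X Z g"
    and fg: "\<And>x y. x \<in> topspace X \<Longrightarrow> y \<in> topspace X \<Longrightarrow> f x = f y \<longleftrightarrow> g x = g y"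
  shows "Y homeomorphic_space Z"
proof -
  obtain u where u: "continuous_map Y Z u" "\<And>x. x \<in> topspace X \<Longrightarrow> u (f x) = g x"
    using quotient_map_lift_exists[OF f quotient_imp_continuous_map[OF g]] fg by metis
  obtain v where v: "continuous_map Z Y v" "\<And>x. x \<in> topspace X \<Longrightarrow> v (g x) = f x"
    using quotient_map_lift_exists[OF g quotient_imp_continuous_map[OF f]] fg by metis
  have "v (u y) = y" if "y \<in> topspace Y" for y
    using that u(2) v(2) quotient_imp_surjective_map[OF f] by force
  moreover have "u (v z) = z" if "z \<in> topspace Z" for z
    using that u(2) v(2) quotient_imp_surjective_map[OF g] by force
  ultimately show ?thesis
    using u(1) v(1) unfolding homeomorphic_space_def homeomorphic_maps_def by blast
qed

lemma continuous_map_from_sum_topology: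
  assumes "\<And>i. i \<in> I \<Longrightarrow> continuous_map (X i) Y (\<lambda>x. f (i, x))"
  shows "continuous_map (sum_topology X I) Y f"
  unfolding continuous_map_def
proof (intro conjI allI impI)
  show "f \<in> topspace (sum_topology X I) \<rightarrow> topspace Y"
    using assms by (auto simp: continuous_map_def Pi_iff)
  fix U assume U: "openin Y U"
  have "openin (X i) {x. (i, x) \<in> {p \<in> topspace (sum_topology X I). f p \<in> U}}" if "i \<in> I" for i
    using openin_continuous_map_preimage[OF assms[OF that] U] that by simp
  then show "openin (sum_topology X I) {p \<in> topspace (sum_topology X I). f p \<in> U}"
    unfolding openin_sum_topology by auto
qed

lemma compact_space_sum_topology:
  assumes "finite I" "\<And>i. i \<in> I \<Longrightarrow> compact_space (X i)"
  shows "compact_space (sum_topology X I)"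
proof -
  have "compactin (sum_topology X I) (\<Union>i\<in>I. Pair i ` topspace (X i))"
  proof (rule compactin_Union)
    fix K assume "K \<in> (\<lambda>i. Pair i ` topspace (X i)) ` I"
    then obtain i where i: "i \<in> I" "K = Pair i ` topspace (X i)" by blast
    show "compactin (sum_topology X I) K"
      unfolding i(2)
      by (rule image_compactin[OF _ continuous_map_component_injection[OF i(1)]])
        (use assms(2)[OF i(1)] in \<open>simp add: compact_space_def\<close>)
  qed (use assms(1) in auto)
  moreover have "(\<Union>i\<in>I. Pair i ` topspace (X i)) = topspace (sum_topology X I)" by auto
  ultimately show ?thesis by (simp add: compact_space_def)
qed

text \<open>A continuous surjection from a compact space to a Hausdorff space is a quotient map, and
  by \<open>eq\<close> its fibres are the classes of \<open>collapse_rel\<close>. Two quotients of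
  one space with the same fibres are homeomorphic.\<close>

lemma wedge_homeomorphic_space:
  assumes "finite I" "\<And>i. i \<in> I \<Longrightarrow> compact_space (X i)" "Hausdorff_space Y"
    and cont: "\<And>i. i \<in> I \<Longrightarrow> continuous_map (X i) Y (\<lambda>x. f (i, x))"
    and onto: "\<And>y. y \<in> topspace Y \<Longrightarrow> \<exists>i\<in>I. \<exists>x\<in>topspace (X i). f (i, x) = y"
    and eq: "\<And>i j x y. i \<in> I \<Longrightarrow> j \<in> I \<Longrightarrow> x \<in> topspace (X i) \<Longrightarrow> y \<in> topspace (X j) \<Longrightarrow>
      f (i, x) = f (j, y) \<longleftrightarrow> (i = j \<and> x = y) \<or> (x = p i \<and> y = p j)"
  shows "Y homeomorphic_space wedge I X p"
proof -
  let ?S = "sum_topology X I"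
  let ?R = "collapse_rel ?S ((\<lambda>i. (i, p i)) ` I)"
  have c: "continuous_map ?S Y f" by (rule continuous_map_from_sum_topology[OF cont])
  have "f ` topspace ?S = topspace Y"
  proof
    show "f ` topspace ?S \<subseteq> topspace Y" using c by (auto simp: continuous_map_def)
    show "topspace Y \<subseteq> f ` topspace ?S"
    proof
      fix y assume "y \<in> topspace Y"
      then obtain i x where "i \<in> I" "x \<in> topspace (X i)" "f (i, x) = y" using onto by blast
      then show "y \<in> f ` topspace ?S" by (intro image_eqI[of _ _ "(i, x)"]) auto
    qed
  qed
  then have q1: "quotient_map ?S Y f"
    using continuous_imp_quotient_map[OF c compact_space_sum_topology[OF assms(1,2)] assms(3)] by simp
  have q2: "quotient_map ?S (wedge I X p) (\<lambda>a. ?R `` {a})"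
    unfolding wedge_def by (rule quotient_map_quotient_topology[OF equiv_collapse_rel])
  show ?thesis
  proof (rule homeomorphic_space_same_quotient[OF q1 q2])
    fix a b assume ab: "a \<in> topspace ?S" "b \<in> topspace ?S"
    obtain i x j y where ij: "a = (i, x)" "b = (j, y)" by (cases a, cases b)
    have m: "i \<in> I" "x \<in> topspace (X i)" "j \<in> I" "y \<in> topspace (X j)" using ab ij by auto
    have "?R `` {a} = ?R `` {b} \<longleftrightarrow> (a, b) \<in> ?R"
      by (rule eq_equiv_class_iff[OF equiv_collapse_rel ab])
    also have "\<dots> \<longleftrightarrow> (i = j \<and> x = y) \<or> (x = p i \<and> y = p j)"
      using ab m unfolding collapse_rel_def ij by auto
    also have "\<dots> \<longleftrightarrow> f a = f b" unfolding ij by (rule eq[OF m(1,3,2,4), symmetric])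
    finally show "f a = f b \<longleftrightarrow> ?R `` {a} = ?R `` {b}" by simp
  qed
qed

section \<open>Spheres as boundaries of cubes\<close>

definition sphere_set :: "nat \<Rightarrow> (nat \<Rightarrow> real) set" where
  "sphere_set n = {x. (\<Sum>i\<le>n. x i ^ 2) = 1 \<and> (\<forall>i>n. x i = 0)}"

lemma nsphere_top_of_set: "nsphere n = top_of_set (sphere_set n)"
  by (simp add: nsphere sphere_set_def euclidean_product_topology)

lemma compact_sphere_set: "compact (sphere_set n)"
proof -
  let ?P = "PiE UNIV (\<lambda>i. if i \<le> n then {-1..1} else {0::real})"
  have "compactin (powertop_real UNIV) ?P" by (auto simp: compactin_PiE)
  then have C: "compact ?P" by (simp add: euclidean_product_topology)
  have "closed {x::nat \<Rightarrow> real. (\<Sum>i\<le>n. x i ^ 2) = 1}"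
    by (intro closed_Collect_eq continuous_on_sum continuous_on_power continuous_on_coord continuous_on_const)
  moreover have "sphere_set n = ?P \<inter> {x. (\<Sum>i\<le>n. x i ^ 2) = 1}"
  proof -
    have "-1 \<le> x i \<and> x i \<le> 1" if "x \<in> sphere_set n" "i \<le> n" for x i
    proof -
      have "x i ^ 2 \<le> (\<Sum>i\<le>n. x i ^ 2)" by (rule member_le_sum) (use that(2) in auto)
      then have "\<bar>x i\<bar> \<le> 1" using that(1) by (simp add: sphere_set_def abs_square_le_1)
      then show ?thesis by (simp add: abs_le_iff)
    qed
    then have "x \<in> ?P" if "x \<in> sphere_set n" for x
      using that unfolding PiE_UNIV_domain by (intro Pi_I) (auto simp: sphere_set_def)
    moreover have "x i = 0" if "x \<in> ?P" "n < i" for x i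
      using PiE_mem[OF that(1), of i] that(2) by simp
    ultimately show ?thesis unfolding sphere_set_def by blast
  qed
  ultimately show ?thesis using C by (simp add: compact_Int_closed)
qed

text \<open>A linear involution taking the base point to the direction of the vertex \<open>0\<close> of \<open>[0,2]\<close> to the
  power \<open>n + 1\<close> as seen from its center.\<close>

definition turn :: "(nat \<Rightarrow> real) \<Rightarrow> nat \<Rightarrow> real" where
  "turn y j = (if j = 0 then - y 0 else y j - y 0)"

definition maxnorm :: "nat \<Rightarrow> (nat \<Rightarrow> real) \<Rightarrow> real" where
  "maxnorm n v = Max ((\<lambda>j. \<bar>v j\<bar>) ` {..n})"

text \<open>After the linear map \<open>turn\<close>, this is radial projection to the boundary of
  the cube from its center, where all coordinates are 1.\<close>

definition cube_point :: "nat \<Rightarrow> (nat \<Rightarrow> real) \<Rightarrow> nat \<Rightarrow> real" where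
  "cube_point n y j = 1 + turn y j / maxnorm n (turn y)"

lemma turn_turn: "turn (turn y) j = y j"
  by (simp add: turn_def)

lemma maxnorm_ge: "j \<le> n \<Longrightarrow> \<bar>v j\<bar> \<le> maxnorm n v"
  unfolding maxnorm_def by (intro Max_ge) auto

lemma maxnorm_attained: "\<exists>j\<le>n. \<bar>v j\<bar> = maxnorm n v"
proof -
  have "maxnorm n v \<in> (\<lambda>j. \<bar>v j\<bar>) ` {..n}" unfolding maxnorm_def by (rule Max_in) auto
  then show ?thesis by auto
qed

lemma maxnorm_eqI: "(\<And>j. j \<le> n \<Longrightarrow> \<bar>v j\<bar> \<le> m) \<Longrightarrow> k \<le> n \<Longrightarrow> \<bar>v k\<bar> = m \<Longrightarrow> maxnorm n v = m"
  using maxnorm_ge[of k n v] maxnorm_attained[of n v] by (metis order_antisym)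

lemma maxnorm_turn_pos:
  assumes "y \<in> sphere_set n" shows "0 < maxnorm n (turn y)"
proof (rule ccontr)
  assume "\<not> 0 < maxnorm n (turn y)"
  then have z: "turn y j = 0" if "j \<le> n" for j using maxnorm_ge[OF that, of "turn y"] by simp
  have "y j = 0" if "j \<le> n" for j
    using z[of 0] z[OF that] by (cases "j = 0") (auto simp: turn_def)
  then have "(\<Sum>i\<le>n. y i ^ 2) = 0" by simp
  then show False using assms by (simp add: sphere_set_def)
qed

lemma cube_point_bounds:
  assumes "y \<in> sphere_set n" "j \<le> n" shows "0 \<le> cube_point n y j" "cube_point n y j \<le> 2"
proof -
  have "\<bar>turn y j / maxnorm n (turn y)\<bar> \<le> 1"
    using maxnorm_ge[OF assms(2), of "turn y"] maxnorm_turn_pos[OF assms(1)] by (simp add: abs_divide)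
  then show "0 \<le> cube_point n y j" "cube_point n y j \<le> 2" unfolding cube_point_def abs_le_iff by auto
qed

lemma cube_point_boundary:
  assumes "y \<in> sphere_set n" shows "\<exists>j\<le>n. cube_point n y j = 0 \<or> cube_point n y j = 2"
proof -
  obtain j where j: "j \<le> n" "\<bar>turn y j\<bar> = maxnorm n (turn y)" using maxnorm_attained by blast
  then have "turn y j = maxnorm n (turn y) \<or> turn y j = - maxnorm n (turn y)"
    by (auto simp: abs_if split: if_splits)
  then have "turn y j / maxnorm n (turn y) = 1 \<or> turn y j / maxnorm n (turn y) = -1"
    using maxnorm_turn_pos[OF assms] by auto
  then show ?thesis using j(1) unfolding cube_point_def by (intro exI[of _ j]) auto
qed

text \<open>Equal images mean that \<open>turn y\<close> and \<open>turn y'\<close> lie on one ray.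
  As \<open>turn\<close> is linear and injective, \<open>y\<close> is a positive multiple of
  \<open>y'\<close>, and both have Euclidean norm 1.\<close>

lemma cube_point_inj:
  assumes y: "y \<in> sphere_set n" "y' \<in> sphere_set n" and eq: "\<And>j. j \<le> n \<Longrightarrow> cube_point n y j = cube_point n y' j"
  shows "y = y'"
proof -
  define m m' where "m = maxnorm n (turn y)" and "m' = maxnorm n (turn y')"
  have m: "0 < m" "0 < m'" using maxnorm_turn_pos y by (auto simp: m_def m'_def)
  define r where "r = m / m'"
  have r: "0 < r" using m by (simp add: r_def)
  have t: "turn y j = r * turn y' j" if "j \<le> n" for j
  proof -
    have "turn y j / m = turn y' j / m'" using eq[OF that] by (simp add: cube_point_def m_def m'_def)
    then show ?thesis using m by (simp add: r_def field_simps)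
  qed
  have yr: "y j = r * y' j" if "j \<le> n" for j
    using t[of 0] t[OF that] by (cases "j = 0") (auto simp: turn_def algebra_simps)
  have "(\<Sum>i\<le>n. y i ^ 2) = r ^ 2 * (\<Sum>i\<le>n. y' i ^ 2)"
    by (simp add: yr power_mult_distrib sum_distrib_left)
  then have "r ^ 2 = 1" using y by (simp add: sphere_set_def)
  then have "r = 1" using r by (auto simp: power2_eq_1_iff)
  then have "y j = y' j" for j using yr[of j] y by (cases "j \<le> n") (auto simp: sphere_set_def)
  then show ?thesis by blast
qed

lemma basepoint_in_sphere_set: "sphere_basepoint \<in> sphere_set n"
  using sphere_basepoint_in_nsphere[of n] by (simp add: nsphere_top_of_set)

lemma cube_point_basepoint: "j \<le> n \<Longrightarrow> cube_point n sphere_basepoint j = 0"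
proof -
  have t: "turn sphere_basepoint k = -1" for k by (simp add: turn_def sphere_basepoint_def)
  then have "maxnorm n (turn sphere_basepoint) = 1" by (intro maxnorm_eqI[of n _ 1 0]) auto
  then show ?thesis by (simp add: cube_point_def t)
qed

lemma cube_point_zero_iff:
  "y \<in> sphere_set n \<Longrightarrow> (\<forall>j\<le>n. cube_point n y j = 0) \<longleftrightarrow> y = sphere_basepoint"
  using cube_point_inj[OF _ basepoint_in_sphere_set, of y n] cube_point_basepoint[of _ n] by auto

lemma cube_point_surj:
  assumes "\<And>j. j \<le> n \<Longrightarrow> 0 \<le> x j \<and> x j \<le> 2" "k \<le> n" "x k = 0 \<or> x k = 2"
  shows "\<exists>y\<in>sphere_set n. \<forall>j\<le>n. cube_point n y j = x j"
proof -
  \<comment> \<open>The preimage is found by going backwards: direction from the center of the cube,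
    then the involution \<open>turn\<close>, then division by the Euclidean norm \<open>s\<close>.
    The maximum norm of \<open>v\<close> is 1 because \<open>x\<close> is on the boundary.\<close>
  define v where "v j = (if j \<le> n then x j - 1 else 0)" for j
  define s where "s = sqrt (\<Sum>j\<le>n. (turn v j)\<^sup>2)"
  have vk: "\<bar>v k\<bar> = 1" using assms by (auto simp: v_def)
  have "\<not> (\<forall>j\<le>n. turn v j = 0)"
  proof
    assume "\<forall>j\<le>n. turn v j = 0"
    then have "turn (turn v) k = 0" using assms(2) unfolding turn_def[of "turn v"] by simp
    then show False using vk by (simp add: turn_turn)
  qed
  then obtain i where i: "i \<le> n" "turn v i \<noteq> 0" by blast
  then have "0 < (\<Sum>j\<le>n. (turn v j)\<^sup>2)" by (intro sum_pos2[of _ i]) auto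
  then have s: "0 < s" "s\<^sup>2 = (\<Sum>j\<le>n. (turn v j)\<^sup>2)" by (auto simp: s_def)
  define y where "y j = (if j \<le> n then turn v j / s else 0)" for j
  have "(\<Sum>j\<le>n. (y j)\<^sup>2) = (\<Sum>j\<le>n. (turn v j)\<^sup>2) / s\<^sup>2"
    by (simp add: y_def power_divide sum_divide_distrib)
  also have "\<dots> = 1" using s(1) unfolding s(2)[symmetric] by simp
  finally have y: "y \<in> sphere_set n" by (simp add: sphere_set_def y_def)
  have t: "turn y j = v j / s" if "j \<le> n" for j
  proof -
    have "turn y j = turn (turn v) j / s" using that by (simp add: turn_def y_def diff_divide_distrib)
    then show ?thesis by (simp add: turn_turn)
  qed
  have "\<bar>v j\<bar> \<le> 1" if "j \<le> n" for j using assms(1)[OF that] that unfolding abs_le_iff by (simp add: v_def)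
  then have "maxnorm n (turn y) = 1 / s"
    using s assms(2) vk by (intro maxnorm_eqI[of n _ "1 / s" k]) (auto simp: t abs_divide divide_right_mono)
  then have "cube_point n y j = x j" if "j \<le> n" for j
    using s that by (simp add: cube_point_def t) (simp add: v_def)
  then show ?thesis using y by blast
qed

lemma continuous_on_cube_point: "continuous_on (sphere_set n) (\<lambda>y. cube_point n y j)"
proof -
  have t: "continuous_on (sphere_set n) (\<lambda>y. turn y j)" for j
    unfolding turn_def by (cases "j = 0") (auto intro!: continuous_on_minus continuous_on_diff continuous_on_coord)
  have "continuous_on (sphere_set n) (\<lambda>y. maxnorm n (turn y))"
    unfolding maxnorm_def by (rule continuous_on_Max_image) (auto intro!: continuous_on_rabs t)
  moreover have "maxnorm n (turn y) \<noteq> 0" if "y \<in> sphere_set n" for y using maxnorm_turn_pos[OF that] by simp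
  ultimately show ?thesis
    unfolding cube_point_def by (intro continuous_on_add continuous_on_divide continuous_on_const t) auto
qed

text \<open>Sphere \<open>i\<close> takes \<open>n i + 1\<close> consecutive coordinates, with
  numbering of spheres from 1; the start of block \<open>l + 1\<close> is thus the total number
  \<open>D\<close>.\<close>

definition block_start :: "(nat \<Rightarrow> nat) \<Rightarrow> nat \<Rightarrow> nat" where
  "block_start n i = (\<Sum>k\<in>{1..<i}. n k + 1)"

definition block :: "(nat \<Rightarrow> nat) \<Rightarrow> nat \<Rightarrow> nat set" where
  "block n i = {block_start n i..block_start n i + n i}"

lemma block_start_less: "1 \<le> i \<Longrightarrow> i < j \<Longrightarrow> block_start n i + n i < block_start n j"
proof -
  assume ij: "1 \<le> i" "i < j"
  have "block_start n i + n i + 1 = (\<Sum>k\<in>{1..<Suc i}. n k + 1)"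
    using ij by (simp add: block_start_def)
  also have "\<dots> \<le> block_start n j" unfolding block_start_def using ij by (intro sum_mono2) auto
  finally show ?thesis by simp
qed

lemma block_disjoint:
  assumes "1 \<le> i" "1 \<le> j" "i \<noteq> j" "k \<in> block n i" shows "k \<notin> block n j"
  using assms block_start_less[of i j n] block_start_less[of j i n]
  by (cases "i < j") (auto simp: block_def)

definition embed_sphere :: "nat \<Rightarrow> (nat \<Rightarrow> nat) \<Rightarrow> nat \<times> (nat \<Rightarrow> real) \<Rightarrow> nat \<Rightarrow> real" where
  "embed_sphere D n = (\<lambda>(i, y). build D
     (\<lambda>j. if j \<in> block n i then cube_point (n i) y (j - block_start n i) else 0) 0 2)"

text \<open>Distinct spheres use disjoint blocks, so a common point has only zeros in both blocks.
  It is the vertex 0 of each cube, and on either sphere only the base point is mapped there.\<close>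

lemma spheres_homeomorphic_wedge:
  assumes l: "l \<ge> 1" and D: "D = block_start n (Suc l)"
  shows "top_of_set (spheres D {1..l} (block n)) homeomorphic_space wedge_of_spheres l n"
proof -
  let ?I = "{1..l}"
  have BD: "block n i \<subseteq> {..<D}" if "i \<in> ?I" for i
    using block_start_less[of i "Suc l" n] that by (auto simp: D block_def)
  have Bne: "block n i \<noteq> {}" for i by (simp add: block_def)
  have I: "?I \<noteq> {}" using l by simp
  note ctx = I Bne BD
  let ?V = "spheres D ?I (block n)"
  have V: "?V = {x \<in> real_seq (Suc (Suc D)). x D = 0 \<and> x (Suc D) = 2 \<and>
     (\<exists>i\<in>?I. (\<forall>j<D. j \<notin> block n i \<longrightarrow> x j = 0) \<and> (\<forall>j\<in>block n i. 0 \<le> x j \<and> x j \<le> 2) \<and>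
        (\<exists>j\<in>block n i. x j = 0 \<or> x j = 2))}"
    by (rule spheres_def[OF ctx])
  have val: "embed_sphere D n (i, y) j = cube_point (n i) y (j - block_start n i)" if "i \<in> ?I" "j \<in> block n i" for i y j
    using BD[OF that(1)] that(2) unfolding embed_sphere_def build_def by auto
  have val0: "embed_sphere D n (i, y) j = 0" if "j < D" "j \<notin> block n i" for i y j
    using that unfolding embed_sphere_def build_def by auto
  have valD: "embed_sphere D n (i, y) D = 0" "embed_sphere D n (i, y) (Suc D) = 2"
    "Suc D < j \<Longrightarrow> embed_sphere D n (i, y) j = 0" for i y j
    unfolding embed_sphere_def build_def by auto
  have sub: "j - block_start n i \<le> n i" if "j \<in> block n i" for i j using that by (auto simp: block_def)
  have add: "block_start n i + j \<in> block n i" if "j \<le> n i" for i j using that by (auto simp: block_def)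
  have in_V: "embed_sphere D n (i, y) \<in> ?V" if i: "i \<in> ?I" and y: "y \<in> sphere_set (n i)" for i y
  proof -
    obtain j where "j \<le> n i" "cube_point (n i) y j = 0 \<or> cube_point (n i) y j = 2"
      using cube_point_boundary[OF y] by blast
    then have "\<exists>j\<in>block n i. embed_sphere D n (i, y) j = 0 \<or> embed_sphere D n (i, y) j = 2"
      using val[OF i] add by (intro bexI[of _ "block_start n i + j"]) auto
    moreover have "0 \<le> embed_sphere D n (i, y) j \<and> embed_sphere D n (i, y) j \<le> 2" if "j \<in> block n i" for j
      using val[OF i that] cube_point_bounds[OF y sub[OF that]] by simp
    moreover have "embed_sphere D n (i, y) \<in> real_seq (Suc (Suc D))" using valD(3) by auto
    ultimately show ?thesis unfolding V using i val0 valD by blast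
  qed
  have vanish: "y = sphere_basepoint" if "i \<in> ?I" "y \<in> sphere_set (n i)" "\<And>j. j \<in> block n i \<Longrightarrow> embed_sphere D n (i, y) j = 0" for i y
  proof -
    have "cube_point (n i) y j = 0" if "j \<le> n i" for j
      using val[OF \<open>i \<in> ?I\<close> add[OF that], of y] \<open>\<And>j. j \<in> block n i \<Longrightarrow> embed_sphere D n (i, y) j = 0\<close>[OF add[OF that]] by simp
    then show ?thesis using cube_point_zero_iff[OF that(2)] by blast
  qed
  have base: "embed_sphere D n (i, sphere_basepoint) = build D (\<lambda>j. 0) 0 2" if "i \<in> ?I" for i
    using cube_point_basepoint[OF sub] unfolding embed_sphere_def build_def by (auto simp: fun_eq_iff)
  have "top_of_set ?V homeomorphic_space wedge ?I (\<lambda>i. nsphere (n i)) (\<lambda>i. sphere_basepoint)"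
  proof (rule wedge_homeomorphic_space[where f = "embed_sphere D n"])
    show "compact_space (nsphere (n i))" for i
      using compact_sphere_set by (simp add: nsphere_top_of_set compact_space_subtopology)
    show "Hausdorff_space (top_of_set ?V)" by (simp add: Hausdorff_space_subtopology)
    show "continuous_map (nsphere (n i)) (top_of_set ?V) (\<lambda>y. embed_sphere D n (i, y))" if i: "i \<in> ?I" for i
    proof -
      have "continuous_on (sphere_set (n i)) (\<lambda>y. if j \<in> block n i then cube_point (n i) y (j - block_start n i) else 0)" for j
        by (cases "j \<in> block n i") (auto intro: continuous_on_cube_point)
      then have "continuous_on (sphere_set (n i)) (\<lambda>y. embed_sphere D n (i, y))"
        unfolding embed_sphere_def prod.case
        by (intro continuous_on_build continuous_on_const)
      then show ?thesis using in_V[OF i] by (auto simp: nsphere_top_of_set)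
    qed
    show "\<exists>i\<in>?I. \<exists>y\<in>topspace (nsphere (n i)). embed_sphere D n (i, y) = x" if "x \<in> topspace (top_of_set ?V)" for x
    proof -
      have xV: "x \<in> ?V" using that by simp
      obtain i where i: "x \<in> real_seq (Suc (Suc D))" "x D = 0" "x (Suc D) = 2" "i \<in> ?I" "\<forall>j<D. j \<notin> block n i \<longrightarrow> x j = 0"
        "\<forall>j\<in>block n i. 0 \<le> x j \<and> x j \<le> 2" "\<exists>j\<in>block n i. x j = 0 \<or> x j = 2"
        using xV unfolding V by blast
      obtain k where k: "k \<in> block n i" "x k = 0 \<or> x k = 2" using i(7) by blast
      have ks: "block_start n i + (k - block_start n i) = k" using k(1) by (simp add: block_def)
      obtain y where y: "y \<in> sphere_set (n i)" "\<forall>j\<le>n i. cube_point (n i) y j = x (block_start n i + j)"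
        using cube_point_surj[of "n i" "\<lambda>j. x (block_start n i + j)" "k - block_start n i"] add i(6) sub[OF k(1)] k(2) ks
        by auto
      have "embed_sphere D n (i, y) j = x j" for j
      proof -
        consider "j \<in> block n i" | "j < D" "j \<notin> block n i" | "j = D" | "j = Suc D" | "Suc D < j" by linarith
        then show ?thesis
        proof cases
          case 1
          then have "block_start n i + (j - block_start n i) = j" by (simp add: block_def)
          then show ?thesis using val[OF i(4) 1, of y] y(2) sub[OF 1] by simp
        qed (use val0 valD i in auto)
      qed
      then have "embed_sphere D n (i, y) = x" by blast
      then show ?thesis using i(4) y(1) unfolding nsphere_top_of_set topspace_euclidean_subtopology by blast
    qed
    show "embed_sphere D n (i, x) = embed_sphere D n (j, y) \<longleftrightarrow>
        (i = j \<and> x = y) \<or> (x = sphere_basepoint \<and> y = sphere_basepoint)"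
      if ij: "i \<in> ?I" "j \<in> ?I" and xy: "x \<in> topspace (nsphere (n i))" "y \<in> topspace (nsphere (n j))" for i j x y
    proof
      assume eq: "embed_sphere D n (i, x) = embed_sphere D n (j, y)"
      have xs: "x \<in> sphere_set (n i)" "y \<in> sphere_set (n j)" using xy by (auto simp: nsphere_top_of_set)
      show "(i = j \<and> x = y) \<or> (x = sphere_basepoint \<and> y = sphere_basepoint)"
      proof (cases "i = j")
        case True
        have "cube_point (n i) x k = cube_point (n i) y k" if "k \<le> n i" for k
        proof -
          have "embed_sphere D n (i, x) (block_start n i + k) = embed_sphere D n (i, y) (block_start n i + k)"
            using eq True by simp
          then show ?thesis
            using val[OF ij(1) add[OF that], of x] val[OF ij(1) add[OF that], of y] by simp
        qed
        moreover have "y \<in> sphere_set (n i)" using xs(2) True by simp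
        ultimately have "x = y" using cube_point_inj[OF xs(1)] by blast
        then show ?thesis using True by blast
      next
        case False
        have "embed_sphere D n (i, x) k = 0" if "k \<in> block n i" for k
        proof -
          have "k < D" "k \<notin> block n j" using BD[OF ij(1)] that block_disjoint[of i j k n] ij False by auto
          then show ?thesis unfolding eq by (rule val0)
        qed
        moreover have "embed_sphere D n (j, y) k = 0" if "k \<in> block n j" for k
        proof -
          have "k < D" "k \<notin> block n i" using BD[OF ij(2)] that block_disjoint[of j i k n] ij False by auto
          then show ?thesis unfolding eq[symmetric] by (rule val0)
        qed
        ultimately show ?thesis using vanish ij xs by blast
      qed
    next
      assume "(i = j \<and> x = y) \<or> (x = sphere_basepoint \<and> y = sphere_basepoint)"
      then show "embed_sphere D n (i, x) = embed_sphere D n (j, y)" using base ij by auto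
    qed
  qed simp
  then show ?thesis by (simp add: wedge_of_spheres_def)
qed

theorem mainTheorem5:
  fixes l :: nat and n :: "nat \<Rightarrow> nat"
  assumes "l \<ge> 1"
  shows "\<exists>N X. N \<ge> 1 \<and> dim_rep_tile N X \<and>
           subtopology (Euclidean_space N) X homotopy_equivalent_space wedge_of_spheres l n"
proof -
  define D where "D = block_start n (Suc l)"
  have BD: "block n i \<subseteq> {..<D}" if "i \<in> {1..l}" for i
    using block_start_less[of i "Suc l" n] that by (auto simp: D_def block_def)
  have Bne: "block n i \<noteq> {}" for i by (simp add: block_def)
  have I: "{1..l} \<noteq> {}" using assms by simp
  note ctx = I Bne BD
  have "subtopology (Euclidean_space (Suc (Suc D))) (tile D {1..l} (block n))
      homotopy_equivalent_space wedge_of_spheres l n"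
    using homotopy_eqv_trans[OF tile_homotopy_equivalent_spheres[OF ctx]
        homeomorphic_imp_homotopy_equivalent_space[OF spheres_homeomorphic_wedge[OF assms D_def]]] .
  moreover have "dim_rep_tile (Suc (Suc D)) (tile D {1..l} (block n))"
    by (rule dim_rep_tile_tile[OF ctx])
  ultimately show ?thesis by (intro exI[of _ "Suc (Suc D)"] exI[of _ "tile D {1..l} (block n)"]) simp
qed

end
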